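(* Let $n\in\mathbb{N}$ and let $d$ be an integer satisfying $0\le d\le n-1$. Then $$\mathbf{Sing}_n:=\mathbf{Sing}_n^0=\mathbf{Sing}_n^d\qquad\text{and}\qquad\mathbf{Bad}_n:=\mathbf{Bad}_n^0=\mathbf{Bad}_n^d.$$
   Context: $\omega_d:=\frac{d+1}{n-d}$. For a $d$-dimensional affine subspace $L\subset\mathbb{R}^n$, let $V_L$ be the unique $(d+1)$-dimensional linear subspace of $\mathbb{R}^{n+1}$ containing $\{(\mathbf{y},1):\mathbf{y}\in L\}$. $L$ is rational if $V_L$ has a basis in $\mathbb{Z}^{n+1}$, and its height $H(L)$ is the covolume of the lattice $V_L\cap\mathbb{Z}^{n+1}$ in $V_L$. Let $d(\mathbf{x},L):=\min_{\mathbf{y}\in L}\max_{1\le i\le n}|x_i-y_i|$. $\mathbf{Sing}_n^d$ ($d$-singular points) is the set of $\mathbf{x}\in\mathbb{R}^n$ such that for any $\varepsilon\in(0,1)$ and all sufficiently large $N>N_0(\mathbf{x},\varepsilon,d)$ there exists a $d$-dimensional rational affine subspace $L\subset\mathbb{R}^n$ with $d(\mathbf{x},L)\le\varepsilon H(L)^{-1}N^{-\omega_d}$ and $H(L)\le N$. $\mathbf{Bad}_n^d$ ($d$-badly approximable points) is the set of $\mathbf{x}\in\mathbb{R}^n$ for which there exists $\varepsilon=\varepsilon(\mathbf{x})\in(0,1)$ such that $d(\mathbf{x},L)>\varepsilon H(L)^{-1-\omega_d}$ for all $d$-dimensional rational affine subspaces $L\subset\mathbb{R}^n$. *)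

theory Defs
  imports "HOL-Analysis.Analysis"
begin

text \<open>
  Throughout, \<open>\<real>\<^sup>n\<close> is \<open>real ^ 'n\<close> with \<open>n = CARD('n)\<close>, and \<open>\<real>\<^sup>n\<^sup>+\<^sup>1\<close> is
  \<open>(real ^ 'n) \<times> real\<close>, whose norm and inner product are the standard Euclidean ones.
\<close>

definition omega :: "nat \<Rightarrow> nat \<Rightarrow> real" where
  "omega n d = (real d + 1) / (real n - real d)"

definition integer_points :: "((real ^ 'n) \<times> real) set" where
  "integer_points = {(p, q). (\<forall>i. p $ i \<in> \<int>) \<and> q \<in> \<int>}"

definition homogenization :: "(real ^ 'n) set \<Rightarrow> ((real ^ 'n) \<times> real) set" where
  "homogenization L =
     (THE V. subspace V \<and> int (dim V) = aff_dim L + 1 \<and> (\<lambda>y. (y, 1)) ` L \<subseteq> V)"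

lemma homogenization_unique_span:
  fixes L V :: "_ set"
  defines "S \<equiv> (\<lambda>y :: real ^ 'n. (y, 1 :: real)) ` L"
  shows "subspace V \<and> int (dim V) = aff_dim L + 1 \<and> S \<subseteq> V \<longleftrightarrow> V = span S"
proof -
  have S_eq: "S = (+) (0, 1) ` (\<lambda>y. (y, 0)) ` L"
    unfolding S_def by (auto simp: image_image)
  have "linear (\<lambda>y :: real ^ 'n. (y, 0 :: real))"
    by (rule linearI) auto
  then have "aff_dim ((\<lambda>y. (y, 0 :: real)) ` L) = aff_dim L"
    by (rule aff_dim_injective_linear_image) (auto simp: inj_on_def)
  then have dim_S: "aff_dim S = aff_dim L"
    unfolding S_eq by (simp add: aff_dim_translation_eq)
  have "affine {v :: (real ^ 'n) \<times> real. snd v = 1}"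
    by (auto simp: affine_def)
  then have "affine hull S \<subseteq> {v. snd v = 1}"
    by (intro hull_minimal) (auto simp: S_def)
  then have "0 \<notin> affine hull S"
    by auto
  then have "aff_dim (insert 0 S) = aff_dim L + 1"
    by (simp add: aff_dim_insert dim_S)
  moreover have "aff_dim (insert 0 S) = int (dim S)"
    using aff_dim_zero[of "insert 0 S"] by (simp add: hull_inc dim_insert span_0)
  ultimately have "int (dim (span S)) = aff_dim L + 1"
    by simp
  moreover have "V = span S" if "subspace V" "int (dim V) = aff_dim L + 1" "S \<subseteq> V"
    using that calculation
    by (metis span_minimal subspace_span subspace_dim_equal order_refl of_nat_eq_iff)
  ultimately show ?thesis
    using span_superset[of S] subspace_span[of S] by metis
qed

lemma homogenization_eq_span: "homogenization L = span ((\<lambda>y. (y, 1)) ` L)"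
  unfolding homogenization_def homogenization_unique_span by simp

definition rational_affine :: "nat \<Rightarrow> (real ^ 'n) set \<Rightarrow> bool" where
  "rational_affine d L \<longleftrightarrow>
     affine L \<and> aff_dim L = int d \<and>
     (\<exists>B \<subseteq> integer_points. independent B \<and> span B = homogenization L)"

text \<open>
  Lebesgue measure on a linear subspace, built from an orthonormal basis in the same way as
  \<^const>\<open>lborel\<close> is built from \<^const>\<open>Basis\<close>; it does not depend on the chosen basis.
\<close>

definition orthonormal_basis_of :: "'a::euclidean_space set \<Rightarrow> 'a set \<Rightarrow> bool" where
  "orthonormal_basis_of V U \<longleftrightarrow>
     pairwise orthogonal U \<and> (\<forall>u\<in>U. norm u = 1) \<and> span U = V"

definition subspace_lborel :: "'a::euclidean_space set \<Rightarrow> 'a measure" where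
  "subspace_lborel V =
     (let U = (SOME U. orthonormal_basis_of V U)
      in distr (\<Pi>\<^sub>M u\<in>U. lborel) borel (\<lambda>f. \<Sum>u\<in>U. f u *\<^sub>R u))"

definition lattice_basis :: "'a::euclidean_space set \<Rightarrow> 'a set \<Rightarrow> bool" where
  "lattice_basis \<Lambda> B \<longleftrightarrow>
     independent B \<and> \<Lambda> = range (\<lambda>c :: 'a \<Rightarrow> int. \<Sum>b\<in>B. of_int (c b) *\<^sub>R b)"

definition fundamental_parallelepiped :: "'a::euclidean_space set \<Rightarrow> 'a set" where
  "fundamental_parallelepiped B = {\<Sum>b\<in>B. t b *\<^sub>R b | t. \<forall>b\<in>B. 0 \<le> t b \<and> t b < 1}"

text \<open>
  The covolume of a lattice \<open>\<Lambda>\<close> spanning \<open>V\<close>; again independent of the chosen basis of \<open>\<Lambda>\<close>.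
\<close>

definition covolume :: "'a::euclidean_space set \<Rightarrow> 'a set \<Rightarrow> real" where
  "covolume V \<Lambda> =
     measure (subspace_lborel V) (fundamental_parallelepiped (SOME B. lattice_basis \<Lambda> B))"

definition height :: "(real ^ 'n) set \<Rightarrow> real" where
  "height L = covolume (homogenization L) (homogenization L \<inter> integer_points)"

text \<open>For nonempty affine \<open>L\<close> the infimum is attained.\<close>

definition sup_dist :: "real ^ 'n \<Rightarrow> (real ^ 'n) set \<Rightarrow> real" where
  "sup_dist x L = (INF y\<in>L. infnorm (x - y))"

definition Sing :: "nat \<Rightarrow> (real ^ 'n) set" where
  "Sing d = {x. \<forall>\<epsilon>\<in>{0<..<1}. \<exists>N\<^sub>0 :: real. \<forall>N>N\<^sub>0. \<exists>L. rational_affine d L \<and>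
     sup_dist x L \<le> \<epsilon> * inverse (height L) * N powr (- omega CARD('n) d) \<and> height L \<le> N}"

definition Bad :: "nat \<Rightarrow> (real ^ 'n) set" where
  "Bad d = {x. \<exists>\<epsilon>\<in>{0<..<1}. \<forall>L. rational_affine d L \<longrightarrow>
     sup_dist x L > \<epsilon> * height L powr (- 1 - omega CARD('n) d)}"

end

theory Submission
  imports Defs
begin

text \<open>
  Attach to a \<open>d\<close>-dimensional rational affine subspace \<open>L\<close> the lattice \<open>\<Lambda>\<close> of integer points of its
  homogenization \<open>V\<close>; it has rank \<open>d + 1\<close> and covolume \<open>H(L)\<close>. Apply the unimodular flow
  \<open>A (p, q) = (T (p - q x), q / T\<^sup>n)\<close>. If \<open>y\<close> is the point of \<open>L\<close> nearest to \<open>x\<close>, then \<open>A\<close>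
  stretches the \<open>d\<close> horizontal directions of \<open>V\<close> by \<open>T\<close> and makes \<open>(y, 1)\<close> orthogonal to them. So
  \<open>covolume (A \<Lambda>) = H(L) T\<^sup>d |A (y, 1)| / |(y\<^sub>0, 1)|\<close> with \<open>y\<^sub>0\<close> the point of \<open>L\<close> nearest to the
  origin (lemma \<open>covolume_flow\<close>). For \<open>L\<close> near \<open>x\<close> this is, up to factors depending on \<open>x\<close> and \<open>n\<close> only,
  the larger of \<open>T ^ (d + 1) d(x, L) H(L)\<close> and \<open>H(L) / T ^ (n - d)\<close>. With \<open>N\<close> comparable to
  \<open>T ^ (n - d)\<close>, these are the two quantities bounded in the definition of \<open>Sing\<close>; eliminating \<open>T\<close>
  from the two bounds gives the inequality in the definition of \<open>Bad\<close>. Hence \<open>x\<close> is \<open>d\<close>-singular iff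
  the least covolume of a sublattice of \<open>A \<int>\<^sup>n\<^sup>+\<^sup>1\<close> of rank \<open>d + 1\<close> tends to \<open>0\<close> as \<open>T \<rightarrow> \<infinity>\<close>, and
  \<open>d\<close>-badly approximable iff it stays bounded away from \<open>0\<close> for \<open>T \<ge> 1\<close>.

  It remains to see that in a lattice of covolume \<open>1\<close> and rank \<open>n + 1\<close> a sublattice of rank
  \<open>d + 1 \<le> n\<close> of small covolume exists iff a short nonzero vector does, a condition without \<open>d\<close>. This
  is read off a reduced basis, whose Gram--Schmidt lengths satisfy \<open>r\<^sub>i \<le> 2 r\<^sub>i\<^sub>+\<^sub>1\<close>. Given a sublattice,
  the first length of a reduced basis of it is at most a constant times the geometric mean of all of
  them, that is, a root of its covolume (\<open>approximable_imp_short_vector\<close>). Given a short vector, take a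
  reduced basis of the whole lattice: \<open>r\<^sub>0\<close> is small, and if \<open>r\<^sub>0 \<cdots> r\<^sub>d\<close> were not small, then the
  product of the remaining lengths would be bounded, hence so would be \<open>r\<close> at \<open>d + 1\<close> and all lengths
  before it, and the factor \<open>r\<^sub>0\<close> would make the product small after all (\<open>prefix_product_small\<close>,
  \<open>short_vector_imp_approximable\<close>).

  Since the covolume is defined as the measure of a parallelepiped, its behaviour under change of
  basis and under linear maps is derived from the uniqueness of translation-invariant measures on a
  subspace (\<open>haar_on_proportional\<close>) instead of from determinants.
\<close>

section \<open>Translation-invariant measures on a subspace\<close>

text \<open>
  Haar measures of the subspace \<open>V\<close> and the zero measure, viewed as measures on the ambient space concentrated on \<open>V\<close>: no
  Borel structure on \<open>V\<close> itself has to be set up, and linear maps act by \<^const>\<open>distr\<close>.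
\<close>

definition haar_on :: "'a::euclidean_space set \<Rightarrow> 'a measure \<Rightarrow> bool" where
  "haar_on V \<mu> \<longleftrightarrow> sets \<mu> = sets borel \<and> (\<forall>R. emeasure \<mu> (cball 0 R) < \<infinity>) \<and>
     (\<forall>v\<in>V. distr \<mu> borel ((+) v) = \<mu>) \<and> (AE x in \<mu>. x \<in> V)"

lemma haar_on_sigma_finite:
  assumes "haar_on V \<mu>"
  shows "sigma_finite_measure \<mu>"
proof
  have s: "sets \<mu> = sets borel" and f: "\<And>R. emeasure \<mu> (cball 0 R) < \<infinity>"
    using assms by (auto simp: haar_on_def)
  have sp: "space \<mu> = UNIV"
    using sets_eq_imp_space_eq[OF s] by simp
  have "\<exists>i. norm x \<le> real i" for x :: 'a
    by (meson real_arch_simple)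
  then have "(\<Union>i. cball (0::'a) (real i)) = UNIV"
    by (auto simp: set_eq_iff)
  then show "\<exists>A. countable A \<and> A \<subseteq> sets \<mu> \<and> \<Union> A = space \<mu> \<and> (\<forall>a\<in>A. emeasure \<mu> a \<noteq> \<infinity>)"
    using f s sp by (intro exI[of _ "range (\<lambda>i::nat. cball 0 (real i))"]) (auto simp: less_top)
qed

lemma haar_on_nn_integral_translate:
  assumes "haar_on V \<mu>" "v \<in> V" and [measurable]: "f \<in> borel_measurable borel"
  shows "(\<integral>\<^sup>+x. f (v + x) \<partial>\<mu>) = (\<integral>\<^sup>+x. f x \<partial>\<mu>)"
proof -
  have [measurable_cong]: "sets \<mu> = sets borel" and t: "distr \<mu> borel ((+) v) = \<mu>"
    using assms by (auto simp: haar_on_def)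
  have "(\<integral>\<^sup>+x. f x \<partial>\<mu>) = (\<integral>\<^sup>+x. f x \<partial>distr \<mu> borel ((+) v))"
    using t by simp
  also have "\<dots> = (\<integral>\<^sup>+x. f (v + x) \<partial>\<mu>)"
    by (intro nn_integral_distr) measurable
  finally show ?thesis ..
qed

text \<open>
  The two translation-invariant measures are compared by computing the double integral of
  \<open>1\<^sub>A(x) 1\<^sub>B(x + y)\<close> in both orders. Integrating over \<open>y\<close> first gives the left-hand side. Substituting
  \<open>x - y\<close> for \<open>x\<close> in the integral over \<open>x\<close>, and then integrating over \<open>y\<close> first, gives the right-hand
  side.
\<close>

lemma haar_on_cross_ratio:
  assumes V: "subspace V" and mu: "haar_on V \<mu>" and nu: "haar_on V \<nu>"
    and [measurable]: "A \<in> sets borel" "B \<in> sets borel"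
  shows "emeasure \<mu> A * emeasure \<nu> B = emeasure \<nu> (uminus -` A) * emeasure \<mu> B"
proof -
  have [measurable_cong]: "sets \<mu> = sets borel" "sets \<nu> = sets borel"
    and muV: "AE x in \<mu>. x \<in> V" and nuV: "AE x in \<nu>. x \<in> V"
    using mu nu by (auto simp: haar_on_def)
  interpret M: sigma_finite_measure \<mu> by (rule haar_on_sigma_finite[OF mu])
  interpret N: sigma_finite_measure \<nu> by (rule haar_on_sigma_finite[OF nu])
  interpret P: pair_sigma_finite \<mu> \<nu> ..
  define a :: "'a \<Rightarrow> ennreal" where "a = indicator A"
  define b :: "'a \<Rightarrow> ennreal" where "b = indicator B"
  have [measurable]: "a \<in> borel_measurable borel" "b \<in> borel_measurable borel"
    by (auto simp: a_def b_def)
  have [measurable]: "uminus -` A \<in> sets borel"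
    using measurable_sets[of uminus borel borel A] by simp
  have "emeasure \<mu> A * emeasure \<nu> B = (\<integral>\<^sup>+x. a x * (\<integral>\<^sup>+y. b y \<partial>\<nu>) \<partial>\<mu>)"
    by (simp add: nn_integral_multc a_def b_def)
  also have "\<dots> = (\<integral>\<^sup>+x. (\<integral>\<^sup>+y. a x * b (x + y) \<partial>\<nu>) \<partial>\<mu>)"
    by (rule nn_integral_cong_AE, rule AE_mp[OF muV], rule AE_I2)
      (auto simp: nn_integral_cmult haar_on_nn_integral_translate[OF nu])
  also have "\<dots> = (\<integral>\<^sup>+y. (\<integral>\<^sup>+x. a x * b (x + y) \<partial>\<mu>) \<partial>\<nu>)"
    by (rule P.Fubini'[symmetric]) measurable
  also have "\<dots> = (\<integral>\<^sup>+y. (\<integral>\<^sup>+x. a (x - y) * b x \<partial>\<mu>) \<partial>\<nu>)"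
  proof (rule nn_integral_cong_AE, rule AE_mp[OF nuV], rule AE_I2, rule impI)
    fix y assume "y \<in> V"
    then have "- y \<in> V" using V by (simp add: subspace_neg)
    from haar_on_nn_integral_translate[OF mu this, of "\<lambda>x. a x * b (x + y)"]
    show "(\<integral>\<^sup>+x. a x * b (x + y) \<partial>\<mu>) = (\<integral>\<^sup>+x. a (x - y) * b x \<partial>\<mu>)"
      by (simp add: algebra_simps)
  qed
  also have "\<dots> = (\<integral>\<^sup>+x. (\<integral>\<^sup>+y. a (x - y) * b x \<partial>\<nu>) \<partial>\<mu>)"
    by (rule P.Fubini') measurable
  also have "\<dots> = (\<integral>\<^sup>+x. (\<integral>\<^sup>+y. indicator (uminus -` A) y \<partial>\<nu>) * b x \<partial>\<mu>)"
  proof (rule nn_integral_cong_AE, rule AE_mp[OF muV], rule AE_I2, rule impI)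
    fix x assume "x \<in> V"
    then have "- x \<in> V" using V by (simp add: subspace_neg)
    from haar_on_nn_integral_translate[OF nu this, of "indicator (uminus -` A)"]
    have "(\<integral>\<^sup>+y. indicator (uminus -` A) y \<partial>\<nu>) = (\<integral>\<^sup>+y. a (x - y) \<partial>\<nu>)"
      by (simp add: a_def indicator_def)
    then show "(\<integral>\<^sup>+y. a (x - y) * b x \<partial>\<nu>) = (\<integral>\<^sup>+y. indicator (uminus -` A) y \<partial>\<nu>) * b x"
      by (simp add: nn_integral_multc)
  qed
  also have "\<dots> = emeasure \<nu> (uminus -` A) * emeasure \<mu> B"
    by (simp add: nn_integral_cmult b_def)
  finally show ?thesis .
qed

lemma haar_on_symmetric:
  assumes "subspace V" "haar_on V \<mu>" "A \<in> sets borel"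
    and B: "B \<in> sets borel" "emeasure \<mu> B \<noteq> 0" "emeasure \<mu> B \<noteq> \<infinity>"
  shows "emeasure \<mu> (uminus -` A) = emeasure \<mu> A"
  using haar_on_cross_ratio[OF assms(1,2,2,3) B(1)] B(2,3)
  by (metis ennreal_mult_cancel_left infinity_ennreal_def mult.commute)

text \<open>
  The reflection in the preceding identity disappears because, applied to a single measure, the same
  identity shows that Haar measures are symmetric.
\<close>

lemma haar_on_proportional:
  assumes "subspace V" "haar_on V \<mu>" "haar_on V \<nu>" "A \<in> sets borel" "B \<in> sets borel"
    and C: "C \<in> sets borel" "emeasure \<nu> C \<noteq> 0" "emeasure \<nu> C \<noteq> \<infinity>"
  shows "emeasure \<mu> A * emeasure \<nu> B = emeasure \<nu> A * emeasure \<mu> B"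
  using haar_on_cross_ratio[OF assms(1-5)] haar_on_symmetric[OF assms(1,3,4) C] by simp

section \<open>Lebesgue measure on a subspace\<close>

abbreviation orthonormal :: "'a::euclidean_space set \<Rightarrow> bool" where
  "orthonormal U \<equiv> orthonormal_basis_of (span U) U"

definition coordinate_measure :: "'a::euclidean_space set \<Rightarrow> 'a measure" where
  "coordinate_measure U = distr (\<Pi>\<^sub>M u\<in>U. lborel) borel (\<lambda>f. \<Sum>u\<in>U. f u *\<^sub>R u)"

lemma orthonormal_finite: "orthonormal U \<Longrightarrow> finite U"
  by (simp add: orthonormal_basis_of_def pairwise_orthogonal_imp_finite)

lemma orthonormal_independent: "orthonormal U \<Longrightarrow> independent U"
  by (rule pairwise_orthogonal_independent) (auto simp: orthonormal_basis_of_def)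

lemma orthonormal_inner:
  "orthonormal U \<Longrightarrow> u \<in> U \<Longrightarrow> v \<in> U \<Longrightarrow> u \<bullet> v = (if u = v then 1 else 0)"
  by (auto simp: orthonormal_basis_of_def pairwise_def orthogonal_def norm_eq_1)

lemma orthonormal_sum_inner:
  assumes "orthonormal U" "u \<in> U"
  shows "(\<Sum>v\<in>U. f v *\<^sub>R v) \<bullet> u = f u"
proof -
  have "(\<Sum>v\<in>U. f v *\<^sub>R v) \<bullet> u = (\<Sum>v\<in>U. if v = u then f u else 0)"
    using assms by (auto simp: inner_sum_left orthonormal_inner intro!: sum.cong)
  then show ?thesis using assms(2) orthonormal_finite[OF assms(1)] by simp
qed

lemma orthonormal_norm_sum:
  assumes "orthonormal U"
  shows "(norm (\<Sum>v\<in>U. f v *\<^sub>R v))\<^sup>2 = (\<Sum>v\<in>U. (f v)\<^sup>2)"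
proof -
  have "(norm (\<Sum>v\<in>U. f v *\<^sub>R v))\<^sup>2 = (\<Sum>u\<in>U. f u * ((\<Sum>v\<in>U. f v *\<^sub>R v) \<bullet> u))"
    by (simp only: power2_norm_eq_inner inner_sum_right inner_scaleR_right)
  also have "\<dots> = (\<Sum>u\<in>U. (f u)\<^sup>2)"
    using assms by (intro sum.cong) (auto simp: orthonormal_sum_inner power2_eq_square)
  finally show ?thesis .
qed

interpretation lborel_product: product_sigma_finite "\<lambda>_. lborel :: real measure"
  by standard

lemma PiM_lborel_translate:
  assumes "finite I"
  shows "distr (\<Pi>\<^sub>M i\<in>I. lborel) (\<Pi>\<^sub>M i\<in>I. lborel) (\<lambda>f. \<lambda>i\<in>I. c i + f i) = (\<Pi>\<^sub>M i\<in>I. (lborel :: real measure))"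
proof (rule lborel_product.PiM_eqI)
  fix A :: "'a \<Rightarrow> real set" assume A: "\<And>i. i \<in> I \<Longrightarrow> A i \<in> sets lborel"
  have B: "(+) (c i) -` A i \<in> sets lborel" if "i \<in> I" for i
    using measurable_sets[of "(+) (c i)" borel borel "A i"] A[OF that] by simp
  have "emeasure (distr (\<Pi>\<^sub>M i\<in>I. lborel) (\<Pi>\<^sub>M i\<in>I. lborel) (\<lambda>f. \<lambda>i\<in>I. c i + f i)) (Pi\<^sub>E I A)
     = emeasure (\<Pi>\<^sub>M i\<in>I. lborel) ((\<lambda>f. \<lambda>i\<in>I. c i + f i) -` (Pi\<^sub>E I A) \<inter> space (\<Pi>\<^sub>M i\<in>I. lborel))"
    using A assms by (intro emeasure_distr) (auto intro!: sets_PiM_I_finite)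
  also have "(\<lambda>f. \<lambda>i\<in>I. c i + f i) -` (Pi\<^sub>E I A) \<inter> space (\<Pi>\<^sub>M i\<in>I. lborel) = Pi\<^sub>E I (\<lambda>i. (+) (c i) -` A i)"
    by (auto simp: space_PiM PiE_iff)
  also have "emeasure (\<Pi>\<^sub>M i\<in>I. lborel) \<dots> = (\<Prod>i\<in>I. emeasure lborel ((+) (c i) -` A i))"
    using B assms by (intro lborel_product.emeasure_PiM) auto
  also have "\<dots> = (\<Prod>i\<in>I. emeasure lborel (A i))"
  proof (rule prod.cong[OF refl])
    fix i assume "i \<in> I"
    have "emeasure lborel (A i) = emeasure (distr lborel borel ((+) (c i))) (A i)"
      by (simp add: lborel_distr_plus)
    also have "\<dots> = emeasure lborel ((+) (c i) -` A i)"
      using A[OF \<open>i \<in> I\<close>] by (subst emeasure_distr) auto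
    finally show "emeasure lborel ((+) (c i) -` A i) = emeasure lborel (A i)" ..
  qed
  finally show "emeasure (distr (\<Pi>\<^sub>M i\<in>I. lborel) (\<Pi>\<^sub>M i\<in>I. lborel) (\<lambda>f. \<lambda>i\<in>I. c i + f i)) (Pi\<^sub>E I A)
     = (\<Prod>i\<in>I. emeasure lborel (A i))" .
qed (use assms in auto)

lemma PiM_lborel_reindex:
  assumes "finite I" and g: "bij_betw g I J"
  shows "distr (\<Pi>\<^sub>M j\<in>J. lborel) (\<Pi>\<^sub>M i\<in>I. lborel) (\<lambda>f. \<lambda>i\<in>I. f (g i)) = (\<Pi>\<^sub>M i\<in>I. (lborel :: real measure))"
proof (rule lborel_product.PiM_eqI)
  have fJ: "finite J" and gJ: "\<And>i. i \<in> I \<Longrightarrow> g i \<in> J"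
    using assms bij_betw_finite bij_betwE by blast+
  fix A :: "'a \<Rightarrow> real set" assume A: "\<And>i. i \<in> I \<Longrightarrow> A i \<in> sets lborel"
  define h where "h = the_inv_into I g"
  have h: "\<And>i. i \<in> I \<Longrightarrow> h (g i) = i" "\<And>j. j \<in> J \<Longrightarrow> h j \<in> I" "\<And>j. j \<in> J \<Longrightarrow> g (h j) = j"
    using g unfolding h_def
    by (auto simp: bij_betw_def the_inv_into_f_f f_the_inv_into_f intro: the_inv_into_into)
  have [measurable]: "(\<lambda>f. \<lambda>i\<in>I. f (g i)) \<in> (\<Pi>\<^sub>M j\<in>J. (lborel::real measure)) \<rightarrow>\<^sub>M (\<Pi>\<^sub>M i\<in>I. (lborel::real measure))"
    using gJ by (intro measurable_restrict) auto
  have "emeasure (distr (\<Pi>\<^sub>M j\<in>J. lborel) (\<Pi>\<^sub>M i\<in>I. lborel) (\<lambda>f. \<lambda>i\<in>I. f (g i))) (Pi\<^sub>E I A)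
     = emeasure (\<Pi>\<^sub>M i\<in>J. lborel) ((\<lambda>f. \<lambda>i\<in>I. f (g i)) -` (Pi\<^sub>E I A) \<inter> space (\<Pi>\<^sub>M j\<in>J. lborel))"
    using A assms by (intro emeasure_distr) (auto intro!: sets_PiM_I_finite)
  also have "(\<lambda>f. \<lambda>i\<in>I. f (g i)) -` (Pi\<^sub>E I A) \<inter> space (\<Pi>\<^sub>M j\<in>J. lborel) = Pi\<^sub>E J (\<lambda>j. A (h j))"
    using h gJ by (auto simp: space_PiM PiE_iff) metis+
  also have "emeasure (\<Pi>\<^sub>M i\<in>J. lborel) \<dots> = (\<Prod>j\<in>J. emeasure lborel (A (h j)))"
    using A h fJ by (intro lborel_product.emeasure_PiM) auto
  also have "\<dots> = (\<Prod>i\<in>I. emeasure lborel (A i))"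
    by (subst prod.reindex_bij_betw[OF g, symmetric]) (auto simp: h)
  finally show "emeasure (distr (\<Pi>\<^sub>M j\<in>J. lborel) (\<Pi>\<^sub>M i\<in>I. lborel) (\<lambda>f. \<lambda>i\<in>I. f (g i))) (Pi\<^sub>E I A)
     = (\<Prod>i\<in>I. emeasure lborel (A i))" .
qed (use assms in auto)

lemma coordinate_measurable [measurable]:
  "(\<lambda>f. \<Sum>u\<in>U. f u *\<^sub>R u) \<in> (\<Pi>\<^sub>M u\<in>U. (lborel::real measure)) \<rightarrow>\<^sub>M (borel :: 'a::euclidean_space measure)"
  by measurable

lemma coordinate_preimage_eq:
  "(\<lambda>f. \<Sum>u\<in>U. f u *\<^sub>R u) -` S \<inter> space (\<Pi>\<^sub>M u\<in>U. (lborel::real measure)) =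
    {f \<in> extensional U. (\<Sum>u\<in>U. f u *\<^sub>R u) \<in> S}"
  by (auto simp: space_PiM PiE_def)

lemma coordinate_preimage_sets:
  fixes S :: "'a::euclidean_space set"
  assumes "S \<in> sets borel"
  shows "{f \<in> extensional U. (\<Sum>u\<in>U. f u *\<^sub>R u) \<in> S} \<in> sets (\<Pi>\<^sub>M u\<in>U. (lborel::real measure))"
  unfolding coordinate_preimage_eq[symmetric]
  using coordinate_measurable assms by (rule measurable_sets)

lemma emeasure_coordinate_measure:
  assumes "S \<in> sets borel"
  shows "emeasure (coordinate_measure U) S =
    emeasure (\<Pi>\<^sub>M u\<in>U. lborel) {f \<in> extensional U. (\<Sum>u\<in>U. f u *\<^sub>R u) \<in> S}"
  unfolding coordinate_measure_def emeasure_distr[OF coordinate_measurable assms]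
  by (simp only: coordinate_preimage_eq)

lemma haar_on_coordinate_measure:
  assumes U: "orthonormal U"
  shows "haar_on (span U) (coordinate_measure U)"
  unfolding haar_on_def
proof (intro conjI allI ballI)
  have fU: "finite U" using U by (rule orthonormal_finite)
  show "sets (coordinate_measure U) = sets borel"
    by (simp add: coordinate_measure_def)
  fix R :: real
  have "emeasure (coordinate_measure U) (cball 0 R) \<le> emeasure (\<Pi>\<^sub>M u\<in>U. lborel) (Pi\<^sub>E U (\<lambda>_. {-R..R}))"
    unfolding emeasure_coordinate_measure[OF borel_closed[OF closed_cball]]
  proof (rule emeasure_mono)
    show "{f \<in> extensional U. (\<Sum>u\<in>U. f u *\<^sub>R u) \<in> cball 0 R} \<subseteq> Pi\<^sub>E U (\<lambda>_. {-R..R})"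
    proof
      fix f assume f: "f \<in> {f \<in> extensional U. (\<Sum>u\<in>U. f u *\<^sub>R u) \<in> cball 0 R}"
      have "\<bar>f u\<bar> \<le> R" if "u \<in> U" for u
      proof -
        have "\<bar>f u\<bar> = \<bar>(\<Sum>v\<in>U. f v *\<^sub>R v) \<bullet> u\<bar>"
          using orthonormal_sum_inner[OF U that] by simp
        also have "\<dots> \<le> norm (\<Sum>v\<in>U. f v *\<^sub>R v) * norm u"
          by (rule Cauchy_Schwarz_ineq2)
        also have "\<dots> \<le> R"
          using U that f by (simp add: orthonormal_basis_of_def)
        finally show ?thesis .
      qed
      then show "f \<in> Pi\<^sub>E U (\<lambda>_. {-R..R})"
        using f by (force simp: PiE_def)
    qed
  qed (use fU in \<open>auto intro!: sets_PiM_I_finite\<close>)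
  also have "\<dots> = (\<Prod>u\<in>U. emeasure lborel {-R..R})"
    using fU by (intro lborel_product.emeasure_PiM) auto
  also have "\<dots> < \<infinity>"
    by (simp add: emeasure_lborel_Icc_eq prod_constant power_less_top_ennreal)
  finally show "emeasure (coordinate_measure U) (cball 0 R) < \<infinity>" .
next
  fix v assume "v \<in> span U"
  have fU: "finite U" using U by (rule orthonormal_finite)
  obtain c where c: "v = (\<Sum>u\<in>U. c u *\<^sub>R u)"
    using \<open>v \<in> span U\<close> fU by (auto simp: span_finite)
  let ?P = "\<Pi>\<^sub>M u\<in>U. (lborel::real measure)"
  let ?\<phi> = "\<lambda>f. \<Sum>u\<in>U. f u *\<^sub>R u"
  let ?t = "\<lambda>f. \<lambda>u\<in>U. c u + f u"
  have [measurable]: "?t \<in> ?P \<rightarrow>\<^sub>M ?P" by measurable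
  have "distr (coordinate_measure U) borel ((+) v) = distr ?P borel ((+) v \<circ> ?\<phi>)"
    unfolding coordinate_measure_def by (subst distr_distr) auto
  also have "(+) v \<circ> ?\<phi> = ?\<phi> \<circ> ?t"
    by (auto simp: c scaleR_add_left sum.distrib)
  also have "distr ?P borel \<dots> = distr (distr ?P ?P ?t) borel ?\<phi>"
    by (subst distr_distr) auto
  also have "\<dots> = coordinate_measure U"
    using fU by (simp add: PiM_lborel_translate coordinate_measure_def)
  finally show "distr (coordinate_measure U) borel ((+) v) = coordinate_measure U" .
next
  have "AE f in \<Pi>\<^sub>M u\<in>U. lborel. (\<Sum>u\<in>U. f u *\<^sub>R u) \<in> span U"
    by (intro AE_I2 span_sum span_mul span_base)
  moreover have "{x \<in> space borel. x \<in> span U} \<in> sets borel"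
    by (simp add: borel_closed closed_subspace)
  ultimately show "AE x in coordinate_measure U. x \<in> span U"
    unfolding coordinate_measure_def by (subst AE_distr_iff) auto
qed

lemma orthonormal_card_dim: "orthonormal U \<Longrightarrow> card U = dim (span U)"
  using dim_span_eq_card_independent[OF orthonormal_independent] by metis

lemma coordinate_measure_cball_pos:
  assumes U: "orthonormal U"
  shows "emeasure (coordinate_measure U) (cball 0 1) \<noteq> 0"
proof -
  have fU: "finite U" using U by (rule orthonormal_finite)
  let ?s = "1 / (real (card U) + 1)"
  have "Pi\<^sub>E U (\<lambda>_. {0..?s}) \<subseteq> {f \<in> extensional U. (\<Sum>u\<in>U. f u *\<^sub>R u) \<in> cball 0 1}"
  proof
    fix f assume f: "f \<in> Pi\<^sub>E U (\<lambda>_. {0..?s})"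
    have "norm (\<Sum>u\<in>U. f u *\<^sub>R u) \<le> (\<Sum>u\<in>U. norm (f u *\<^sub>R u))"
      by (rule norm_sum)
    also have "\<dots> \<le> (\<Sum>u\<in>U. ?s)"
      using f U by (intro sum_mono) (auto simp: orthonormal_basis_of_def PiE_iff)
    also have "\<dots> \<le> 1"
      by simp
    finally show "f \<in> {f \<in> extensional U. (\<Sum>u\<in>U. f u *\<^sub>R u) \<in> cball 0 1}"
      using f by (auto simp: PiE_def)
  qed
  moreover have "{f \<in> extensional U. (\<Sum>u\<in>U. f u *\<^sub>R u) \<in> cball 0 1} \<in> sets (\<Pi>\<^sub>M u\<in>U. lborel)"
    by (rule coordinate_preimage_sets) auto
  ultimately have "emeasure (\<Pi>\<^sub>M u\<in>U. lborel) (Pi\<^sub>E U (\<lambda>_. {0..?s})) \<le> emeasure (coordinate_measure U) (cball 0 1)"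
    by (subst emeasure_coordinate_measure) (auto intro: emeasure_mono)
  moreover have "emeasure (\<Pi>\<^sub>M u\<in>U. lborel) (Pi\<^sub>E U (\<lambda>_. {0..?s})) = ennreal (?s ^ card U)"
    using fU by (subst lborel_product.emeasure_PiM) (auto simp: ennreal_power)
  moreover have "?s ^ card U > 0" by simp
  ultimately show ?thesis
    by (metis ennreal_eq_0_iff le_zero_eq not_less)
qed

text \<open>
  Both measures are Haar measures of the same subspace, hence proportional. They agree on the unit
  ball, whose description in orthonormal coordinates depends only on the number of coordinates.
\<close>

lemma coordinate_measure_unique:
  assumes U: "orthonormal U" and W: "orthonormal W" and UW: "span U = span W"
  shows "coordinate_measure U = coordinate_measure W"
proof (rule measure_eqI)
  show s: "sets (coordinate_measure U) = sets (coordinate_measure W)"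
    by (simp add: coordinate_measure_def)
  fix A assume "A \<in> sets (coordinate_measure U)"
  then have A: "A \<in> sets borel" by (simp add: coordinate_measure_def)
  have fU: "finite U" "finite W" using U W by (auto simp: orthonormal_finite)
  have "card U = card W" using U W UW by (simp add: orthonormal_card_dim)
  then obtain g where g: "bij_betw g U W"
    using fU by (meson finite_same_card_bij)
  let ?B = "cball (0::'a) 1"
  let ?g = "\<lambda>f. \<lambda>u\<in>U. f (g u)"
  have gW: "\<And>u. u \<in> U \<Longrightarrow> g u \<in> W" using g by (rule bij_betwE[rule_format])
  have gm: "?g \<in> (\<Pi>\<^sub>M j\<in>W. (lborel::real measure)) \<rightarrow>\<^sub>M (\<Pi>\<^sub>M i\<in>U. (lborel::real measure))"
    using gW by (intro measurable_restrict) auto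
  have eq: "emeasure (coordinate_measure U) ?B = emeasure (coordinate_measure W) ?B"
  proof -
    let ?S = "{f \<in> extensional U. (\<Sum>u\<in>U. f u *\<^sub>R u) \<in> ?B}"
    have S: "?S \<in> sets (\<Pi>\<^sub>M u\<in>U. lborel)"
      by (rule coordinate_preimage_sets) auto
    have "emeasure (coordinate_measure U) ?B = emeasure (\<Pi>\<^sub>M u\<in>U. lborel) ?S"
      by (simp add: emeasure_coordinate_measure)
    also have "\<dots> = emeasure (\<Pi>\<^sub>M u\<in>W. lborel) (?g -` ?S \<inter> space (\<Pi>\<^sub>M u\<in>W. lborel))"
      using S by (subst PiM_lborel_reindex[OF fU(1) g, symmetric]) (rule emeasure_distr[OF gm])
    also have "?g -` ?S \<inter> space (\<Pi>\<^sub>M u\<in>W. lborel) = {f \<in> extensional W. (\<Sum>w\<in>W. f w *\<^sub>R w) \<in> ?B}"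
    proof -
      have "(norm (\<Sum>u\<in>U. ?g f u *\<^sub>R u))\<^sup>2 = (norm (\<Sum>w\<in>W. f w *\<^sub>R w))\<^sup>2" for f
        unfolding orthonormal_norm_sum[OF U] orthonormal_norm_sum[OF W]
        using sum.reindex_bij_betw[OF g, of "\<lambda>w. (f w)\<^sup>2"] by simp
      then have "norm (\<Sum>u\<in>U. ?g f u *\<^sub>R u) = norm (\<Sum>w\<in>W. f w *\<^sub>R w)" for f
        by (simp only: power2_eq_iff_nonneg[OF norm_ge_zero norm_ge_zero])
      then show ?thesis
        by (auto simp: space_PiM PiE_def)
    qed
    finally show ?thesis by (simp add: emeasure_coordinate_measure)
  qed
  have fin: "emeasure (coordinate_measure W) ?B \<noteq> \<infinity>"
    using haar_on_coordinate_measure[OF W] unfolding haar_on_def by (metis less_irrefl)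
  have "emeasure (coordinate_measure U) A * emeasure (coordinate_measure W) ?B
      = emeasure (coordinate_measure W) A * emeasure (coordinate_measure U) ?B"
    using haar_on_coordinate_measure[OF U] haar_on_coordinate_measure[OF W]
    by (intro haar_on_proportional[of "span W" _ _ _ _ ?B] A fin coordinate_measure_cball_pos[OF W])
       (auto simp: UW)
  then show "emeasure (coordinate_measure U) A = emeasure (coordinate_measure W) A"
    using fin coordinate_measure_cball_pos[OF W] unfolding eq
    by (metis ennreal_mult_cancel_left infinity_ennreal_def mult.commute)
qed

lemma subspace_lborel_eq:
  assumes "orthonormal U" "span U = V"
  shows "subspace_lborel V = coordinate_measure U"
proof -
  let ?W = "SOME W. orthonormal_basis_of V W"
  have "orthonormal_basis_of V ?W"
    using assms by (metis someI_ex)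
  then have "orthonormal ?W" "span ?W = V"
    by (auto simp: orthonormal_basis_of_def)
  moreover have "subspace_lborel V = coordinate_measure ?W"
    by (simp add: subspace_lborel_def Let_def coordinate_measure_def)
  ultimately show ?thesis
    using coordinate_measure_unique assms by metis
qed

lemma orthonormal_basis_exists:
  assumes "subspace V"
  obtains U where "orthonormal U" "span U = V"
proof -
  obtain B where "B \<subseteq> V" "pairwise orthogonal B" "\<And>x. x \<in> B \<Longrightarrow> norm x = 1" "span B = V"
    using orthonormal_basis_subspace[OF assms] by metis
  then show ?thesis
    by (intro that[of B]) (auto simp: orthonormal_basis_of_def)
qed

lemma haar_on_subspace_lborel: "subspace V \<Longrightarrow> haar_on V (subspace_lborel V)"
  by (metis orthonormal_basis_exists haar_on_coordinate_measure subspace_lborel_eq)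

section \<open>Parallelepipeds\<close>

lemma dual_basis_exists:
  fixes B :: "'a::euclidean_space set"
  assumes B: "independent B"
  obtains g :: "'a \<Rightarrow> 'a \<Rightarrow> real"
  where "\<And>b. linear (g b)"
    and "\<And>b t. b \<in> B \<Longrightarrow> g b (\<Sum>c\<in>B. t c *\<^sub>R c) = t b"
    and "\<And>x. x \<in> span B \<Longrightarrow> x = (\<Sum>b\<in>B. g b x *\<^sub>R b)"
proof -
  have fB: "finite B" using B by (rule finiteI_independent)
  have "\<forall>b. \<exists>h::'a \<Rightarrow> real. linear h \<and> (\<forall>c\<in>B. h c = (if c = b then 1 else 0))"
  proof
    fix b :: 'a
    show "\<exists>h::'a \<Rightarrow> real. linear h \<and> (\<forall>c\<in>B. h c = (if c = b then 1 else 0))"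
      using linear_independent_extend[OF B, of "\<lambda>c. if c = b then 1 else 0"] by simp
  qed
  then obtain g :: "'a \<Rightarrow> 'a \<Rightarrow> real"
    where g: "\<And>b. linear (g b)" and gd: "\<And>b c. c \<in> B \<Longrightarrow> g b c = (if c = b then 1 else 0)"
    by metis
  have gs: "g b (\<Sum>c\<in>B. t c *\<^sub>R c) = t b" if "b \<in> B" for b t
  proof -
    have "g b (\<Sum>c\<in>B. t c *\<^sub>R c) = (\<Sum>c\<in>B. if c = b then t c else 0)"
      using gd by (auto simp: linear_sum[OF g] linear_scale[OF g] intro!: sum.cong)
    then show ?thesis using that fB by simp
  qed
  moreover have "x = (\<Sum>b\<in>B. g b x *\<^sub>R b)" if x: "x \<in> span B" for x
  proof -
    obtain t where t: "x = (\<Sum>b\<in>B. t b *\<^sub>R b)"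
      using x fB by (auto simp: span_finite)
    show ?thesis
      by (subst t, rule sum.cong) (simp_all add: t gs)
  qed
  ultimately show ?thesis using that g by blast
qed

lemma linear_borel_measurable:
  fixes A :: "'a::euclidean_space \<Rightarrow> 'b::euclidean_space"
  assumes "linear A"
  shows "A \<in> borel_measurable borel"
  using assms by (intro borel_measurable_continuous_onI linear_continuous_on)
    (simp add: linear_conv_bounded_linear)

lemma fundamental_parallelepiped_borel:
  assumes B: "independent B"
  shows "fundamental_parallelepiped B \<in> sets borel"
proof -
  have fB: "finite B" using B by (rule finiteI_independent)
  obtain g where g: "\<And>b. linear (g b :: 'a \<Rightarrow> real)"
    and gs: "\<And>b t. b \<in> B \<Longrightarrow> g b (\<Sum>c\<in>B. t c *\<^sub>R c) = t b"
    and rep: "\<And>x. x \<in> span B \<Longrightarrow> x = (\<Sum>b\<in>B. g b x *\<^sub>R b)"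
    by (rule dual_basis_exists[OF B]) (rule that)
  have [measurable]: "g b \<in> borel_measurable borel" for b
    by (rule linear_borel_measurable[OF g])
  have [measurable]: "span B \<in> sets borel"
    by (simp add: borel_closed closed_subspace)
  have "fundamental_parallelepiped B = {x \<in> span B. \<forall>b\<in>B. 0 \<le> g b x \<and> g b x < 1}"
  proof safe
    fix x assume "x \<in> fundamental_parallelepiped B"
    then obtain t where t: "x = (\<Sum>b\<in>B. t b *\<^sub>R b)" "\<forall>b\<in>B. 0 \<le> t b \<and> t b < 1"
      by (auto simp: fundamental_parallelepiped_def)
    show "x \<in> span B" unfolding t by (intro span_sum span_mul span_base)
    show "0 \<le> g b x" "g b x < 1" if "b \<in> B" for b
      using t that by (auto simp: gs)
  next
    fix x assume "x \<in> span B" "\<forall>b\<in>B. 0 \<le> g b x \<and> g b x < 1"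
    then show "x \<in> fundamental_parallelepiped B"
      using rep[of x] unfolding fundamental_parallelepiped_def by (intro CollectI exI[of _ "\<lambda>b. g b x"] conjI)
  qed
  also have "\<dots> \<in> sets borel"
    using fB by measurable
  finally show ?thesis .
qed

lemma fundamental_parallelepiped_bounded:
  assumes "finite B"
  shows "fundamental_parallelepiped B \<subseteq> cball 0 (\<Sum>b\<in>B. norm b)"
proof
  fix x assume "x \<in> fundamental_parallelepiped B"
  then obtain t where t: "x = (\<Sum>b\<in>B. t b *\<^sub>R b)" "\<forall>b\<in>B. 0 \<le> t b \<and> t b < 1"
    by (auto simp: fundamental_parallelepiped_def)
  have "norm x \<le> (\<Sum>b\<in>B. norm (t b *\<^sub>R b))"
    unfolding t by (rule norm_sum)
  also have "\<dots> \<le> (\<Sum>b\<in>B. norm b)"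
    using t by (intro sum_mono) (auto intro!: mult_left_le_one_le)
  finally show "x \<in> cball 0 (\<Sum>b\<in>B. norm b)" by simp
qed

lemma fundamental_parallelepiped_finite_measure:
  assumes V: "subspace V" and B: "independent B"
  shows "emeasure (subspace_lborel V) (fundamental_parallelepiped B) =
    ennreal (measure (subspace_lborel V) (fundamental_parallelepiped B))"
proof -
  have h: "haar_on V (subspace_lborel V)" by (rule haar_on_subspace_lborel[OF V])
  then have "emeasure (subspace_lborel V) (fundamental_parallelepiped B)
    \<le> emeasure (subspace_lborel V) (cball 0 (\<Sum>b\<in>B. norm b))"
    using fundamental_parallelepiped_bounded[OF finiteI_independent[OF B]]
    by (intro emeasure_mono) (auto simp: haar_on_def)
  also have "\<dots> < \<infinity>" using h by (auto simp: haar_on_def)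
  finally show ?thesis by (simp add: emeasure_eq_ennreal_measure)
qed

section \<open>Independence of the lattice basis\<close>

lemma lattice_basis_span:
  assumes "lattice_basis \<Lambda> B"
  shows "span \<Lambda> = span B"
proof
  have B: "independent B" and L: "\<Lambda> = range (\<lambda>c :: 'a \<Rightarrow> int. \<Sum>b\<in>B. of_int (c b) *\<^sub>R b)"
    using assms by (auto simp: lattice_basis_def)
  have fB: "finite B" using B by (rule finiteI_independent)
  show "span \<Lambda> \<subseteq> span B"
    by (rule span_minimal) (auto simp: L intro!: span_sum span_mul intro: span_base)
  have "b \<in> \<Lambda>" if "b \<in> B" for b
  proof -
    have "(\<Sum>c\<in>B. of_int (if c = b then 1 else 0) *\<^sub>R c) = (\<Sum>c\<in>B. if c = b then b else 0)"
      by (intro sum.cong) auto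
    also have "\<dots> = b" using that fB by simp
    finally show ?thesis unfolding L
      by (intro range_eqI[of _ _ "\<lambda>c. if c = b then 1 else 0"]) simp
  qed
  then show "span B \<subseteq> span \<Lambda>" by (intro span_mono) auto
qed

lemma lattice_basis_countable:
  assumes "lattice_basis \<Lambda> B"
  shows "countable \<Lambda>"
proof -
  have B: "independent B" and L: "\<Lambda> = range (\<lambda>c :: 'a \<Rightarrow> int. \<Sum>b\<in>B. of_int (c b) *\<^sub>R b)"
    using assms by (auto simp: lattice_basis_def)
  have fB: "finite B" using B by (rule finiteI_independent)
  have "\<Lambda> \<subseteq> (\<lambda>c. \<Sum>b\<in>B. of_int (c b) *\<^sub>R b) ` (Pi\<^sub>E B (\<lambda>_. UNIV :: int set))"
  proof
    fix v assume "v \<in> \<Lambda>"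
    then obtain c :: "'a \<Rightarrow> int" where c: "v = (\<Sum>b\<in>B. of_int (c b) *\<^sub>R b)" by (auto simp: L)
    show "v \<in> (\<lambda>c. \<Sum>b\<in>B. of_int (c b) *\<^sub>R b) ` (Pi\<^sub>E B (\<lambda>_. UNIV :: int set))"
      by (rule image_eqI[of _ _ "restrict c B"]) (simp_all add: c)
  qed
  then show ?thesis
    using fB by (meson countable_PiE countable_image countable_subset countableI_type)
qed

lemma lattice_basis_diff:
  assumes "lattice_basis \<Lambda> B" "x \<in> \<Lambda>" "y \<in> \<Lambda>"
  shows "x - y \<in> \<Lambda>"
proof -
  have L: "\<Lambda> = range (\<lambda>c :: 'a \<Rightarrow> int. \<Sum>b\<in>B. of_int (c b) *\<^sub>R b)"
    using assms by (auto simp: lattice_basis_def)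
  obtain c d :: "'a \<Rightarrow> int" where "x = (\<Sum>b\<in>B. of_int (c b) *\<^sub>R b)" "y = (\<Sum>b\<in>B. of_int (d b) *\<^sub>R b)"
    using assms(2,3) by (auto simp: L)
  then have "x - y = (\<Sum>b\<in>B. of_int (c b - d b) *\<^sub>R b)"
    by (simp add: sum_subtractf scaleR_diff_left)
  then show ?thesis unfolding L by (rule range_eqI[of _ _ "\<lambda>b. c b - d b"])
qed

lemma lattice_basis_tiling:
  assumes "lattice_basis \<Lambda> B" "x \<in> span B"
  shows "\<exists>!v. v \<in> \<Lambda> \<and> x - v \<in> fundamental_parallelepiped B"
proof -
  have B: "independent B" and L: "\<Lambda> = range (\<lambda>c :: 'a \<Rightarrow> int. \<Sum>b\<in>B. of_int (c b) *\<^sub>R b)"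
    using assms by (auto simp: lattice_basis_def)
  obtain g where g: "\<And>b. linear (g b :: 'a \<Rightarrow> real)"
    and gs: "\<And>b t. b \<in> B \<Longrightarrow> g b (\<Sum>c\<in>B. t c *\<^sub>R c) = t b"
    and rep: "\<And>x. x \<in> span B \<Longrightarrow> x = (\<Sum>b\<in>B. g b x *\<^sub>R b)"
    by (rule dual_basis_exists[OF B]) (rule that)
  show ?thesis
  proof (rule ex1I)
    let ?v = "\<Sum>b\<in>B. of_int \<lfloor>g b x\<rfloor> *\<^sub>R b"
    have "x - ?v = (\<Sum>b\<in>B. (g b x - of_int \<lfloor>g b x\<rfloor>) *\<^sub>R b)"
      by (subst rep[OF assms(2)]) (simp add: sum_subtractf scaleR_diff_left)
    then have "x - ?v \<in> fundamental_parallelepiped B"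
      unfolding fundamental_parallelepiped_def
      by (intro CollectI exI[of _ "\<lambda>b. g b x - of_int \<lfloor>g b x\<rfloor>"]) (auto; linarith)
    then show "?v \<in> \<Lambda> \<and> x - ?v \<in> fundamental_parallelepiped B"
      unfolding L by (intro conjI range_eqI[of _ _ "\<lambda>b. \<lfloor>g b x\<rfloor>"]) simp_all
  next
    fix v assume v: "v \<in> \<Lambda> \<and> x - v \<in> fundamental_parallelepiped B"
    obtain c :: "'a \<Rightarrow> int" where c: "v = (\<Sum>b\<in>B. of_int (c b) *\<^sub>R b)" using v by (auto simp: L)
    obtain t where t: "x - v = (\<Sum>b\<in>B. t b *\<^sub>R b)" "\<forall>b\<in>B. 0 \<le> t b \<and> t b < 1"
      using v by (auto simp: fundamental_parallelepiped_def)
    have "x = (\<Sum>b\<in>B. (of_int (c b) + t b) *\<^sub>R b)"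
      using t(1) c by (simp add: scaleR_add_left sum.distrib diff_eq_eq)
    then have "g b x = of_int (c b) + t b" if "b \<in> B" for b
      using gs[OF that, of "\<lambda>b. of_int (c b) + t b"] by simp
    then have "\<lfloor>g b x\<rfloor> = c b" if "b \<in> B" for b
      using that t(2) by (auto intro!: floor_unique)
    then show "v = (\<Sum>b\<in>B. of_int \<lfloor>g b x\<rfloor> *\<^sub>R b)"
      unfolding c by (intro sum.cong) auto
  qed
qed

text \<open>
  The translates of the parallelepiped by lattice vectors partition \<open>V\<close>, so they cut \<open>Q\<close> into
  countably many pieces.
\<close>

lemma emeasure_lattice_tiling:
  assumes lb: "lattice_basis \<Lambda> B" and h: "haar_on (span B) \<mu>" and [measurable]: "Q \<in> sets borel"
  shows "emeasure \<mu> Q =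
    (\<integral>\<^sup>+v. emeasure \<mu> (Q \<inter> {x. x - v \<in> fundamental_parallelepiped B}) \<partial>count_space \<Lambda>)"
proof -
  let ?P = "fundamental_parallelepiped B"
  have s [measurable_cong]: "sets \<mu> = sets borel" and AE: "AE x in \<mu>. x \<in> span B"
    using h by (auto simp: haar_on_def)
  have [measurable]: "?P \<in> sets borel"
    using lb by (auto simp: lattice_basis_def intro: fundamental_parallelepiped_borel)
  have meas: "{x. x - v \<in> ?P} \<in> sets borel" for v
    using measurable_sets[of "\<lambda>x. x - v" borel borel ?P] by (simp add: vimage_def)
  have "emeasure \<mu> Q = emeasure \<mu> (\<Union>v\<in>\<Lambda>. Q \<inter> {x. x - v \<in> ?P})"
  proof (rule emeasure_eq_AE)
    show "AE x in \<mu>. (x \<in> Q) = (x \<in> (\<Union>v\<in>\<Lambda>. Q \<inter> {x. x - v \<in> ?P}))"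
      by (rule AE_mp[OF AE], rule AE_I2) (use lattice_basis_tiling[OF lb] in blast)
    show "(\<Union>v\<in>\<Lambda>. Q \<inter> {x. x - v \<in> ?P}) \<in> sets \<mu>"
      using meas lattice_basis_countable[OF lb] by (intro sets.countable_UN'') (auto simp: s)
  qed (simp add: s)
  also have "\<dots> = (\<integral>\<^sup>+v. emeasure \<mu> (Q \<inter> {x. x - v \<in> ?P}) \<partial>count_space \<Lambda>)"
  proof (rule emeasure_UN_countable)
    show "disjoint_family_on (\<lambda>v. Q \<inter> {x. x - v \<in> ?P}) \<Lambda>"
      unfolding disjoint_family_on_def
    proof (intro ballI impI equals0I)
      fix v w x assume vw: "v \<in> \<Lambda>" "w \<in> \<Lambda>" "v \<noteq> w"
        and x: "x \<in> (Q \<inter> {x. x - v \<in> ?P}) \<inter> (Q \<inter> {x. x - w \<in> ?P})"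
      have "x - v \<in> span B"
        using x by (auto simp: fundamental_parallelepiped_def intro!: span_sum span_mul intro: span_base)
      moreover have "v \<in> span B"
        using lattice_basis_span[OF lb] span_base[OF vw(1)] by simp
      ultimately have "x \<in> span B"
        using span_add[of "x - v" B v] by simp
      then show False
        using lattice_basis_tiling[OF lb, of x] vw x by auto
    qed
  qed (use meas lattice_basis_countable[OF lb] in \<open>auto simp: s\<close>)
  finally show ?thesis .
qed

text \<open>
  Cut each of the two parallelepipeds along the tiling by the other one. Translating by \<open>- v\<close> matches
  the piece with index \<open>v\<close> of one with the piece with index \<open>- v\<close> of the other.
\<close>

lemma fundamental_parallelepiped_measure_unique:
  assumes B: "lattice_basis \<Lambda> B" and C: "lattice_basis \<Lambda> C" and h: "haar_on (span \<Lambda>) \<mu>"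
  shows "emeasure \<mu> (fundamental_parallelepiped B) = emeasure \<mu> (fundamental_parallelepiped C)"
proof -
  let ?P = "fundamental_parallelepiped B" and ?Q = "fundamental_parallelepiped C"
  have s [measurable_cong]: "sets \<mu> = sets borel"
    using h by (auto simp: haar_on_def)
  have m [measurable]: "?P \<in> sets borel" "?Q \<in> sets borel"
    using B C by (auto simp: lattice_basis_def intro: fundamental_parallelepiped_borel)
  have meas: "{x. x - v \<in> ?P} \<in> sets borel" "{x. x - v \<in> ?Q} \<in> sets borel" for v
    using measurable_sets[of "\<lambda>x. x - v" borel borel ?P] measurable_sets[of "\<lambda>x. x - v" borel borel ?Q]
    by (simp_all add: vimage_def)
  have tr: "emeasure \<mu> (?Q \<inter> {x. x - v \<in> ?P}) = emeasure \<mu> (?P \<inter> {x. x - - v \<in> ?Q})" if "v \<in> \<Lambda>" for v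
  proof -
    have "distr \<mu> borel ((+) v) = \<mu>"
      using h that by (auto simp: haar_on_def span_base)
    then have "emeasure \<mu> (?Q \<inter> {x. x - v \<in> ?P}) = emeasure (distr \<mu> borel ((+) v)) (?Q \<inter> {x. x - v \<in> ?P})"
      by simp
    also have "\<dots> = emeasure \<mu> ((+) v -` (?Q \<inter> {x. x - v \<in> ?P}) \<inter> space \<mu>)"
      using meas by (intro emeasure_distr) measurable
    also have "(+) v -` (?Q \<inter> {x. x - v \<in> ?P}) \<inter> space \<mu> = ?P \<inter> {x. x - - v \<in> ?Q}"
      using sets_eq_imp_space_eq[OF s] by (auto simp: add.commute)
    finally show ?thesis .
  qed
  have zero: "0 \<in> \<Lambda>"
    using B unfolding lattice_basis_def by (auto intro!: image_eqI[of _ _ "\<lambda>_. 0"])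
  have bij: "bij_betw uminus \<Lambda> \<Lambda>"
    using lattice_basis_diff[OF B zero] by (intro bij_betwI[of _ _ _ uminus]) auto
  have "emeasure \<mu> ?Q = (\<integral>\<^sup>+v. emeasure \<mu> (?Q \<inter> {x. x - v \<in> ?P}) \<partial>count_space \<Lambda>)"
    using h m by (intro emeasure_lattice_tiling[OF B]) (simp_all add: lattice_basis_span[OF B])
  also have "\<dots> = (\<integral>\<^sup>+v. emeasure \<mu> (?P \<inter> {x. x - - v \<in> ?Q}) \<partial>count_space \<Lambda>)"
    by (intro nn_integral_cong tr) simp
  also have "\<dots> = (\<integral>\<^sup>+v. emeasure \<mu> (?P \<inter> {x. x - v \<in> ?Q}) \<partial>count_space \<Lambda>)"
    by (rule nn_integral_bij_count_space[OF bij])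
  also have "\<dots> = emeasure \<mu> ?P"
    using h m by (intro emeasure_lattice_tiling[OF C, symmetric]) (simp_all add: lattice_basis_span[OF C])
  finally show ?thesis ..
qed

lemma covolume_eq:
  assumes B: "lattice_basis \<Lambda> B" and V: "span \<Lambda> = V"
  shows "covolume V \<Lambda> = measure (subspace_lborel V) (fundamental_parallelepiped B)"
proof -
  have C: "lattice_basis \<Lambda> (SOME B. lattice_basis \<Lambda> B)"
    using B by (rule someI)
  have "haar_on (span \<Lambda>) (subspace_lborel V)"
    using V haar_on_subspace_lborel subspace_span by metis
  from fundamental_parallelepiped_measure_unique[OF C B this]
  show ?thesis unfolding covolume_def measure_def by simp
qed

section \<open>Linear images\<close>

lemma haar_on_linear_image:
  assumes V: "subspace V" and A: "linear A" "inj A" and h: "haar_on V \<mu>"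
  shows "haar_on (A ` V) (distr \<mu> borel A)"
  unfolding haar_on_def
proof (intro conjI allI ballI)
  have s [measurable_cong]: "sets \<mu> = sets borel"
    using h by (auto simp: haar_on_def)
  have [measurable]: "A \<in> borel_measurable borel"
    by (rule linear_borel_measurable[OF A(1)])
  show "sets (distr \<mu> borel A) = sets borel" by simp
  fix R :: real
  obtain K where K: "K > 0" "\<And>x. K * norm x \<le> norm (A x)"
    using linear_inj_bounded_below_pos[OF A] by blast
  have "emeasure (distr \<mu> borel A) (cball 0 R) = emeasure \<mu> (A -` cball 0 R \<inter> space \<mu>)"
    by (rule emeasure_distr) measurable
  also have "\<dots> \<le> emeasure \<mu> (cball 0 (R / K))"
  proof (rule emeasure_mono)
    show "A -` cball 0 R \<inter> space \<mu> \<subseteq> cball 0 (R / K)"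
    proof
      fix x assume "x \<in> A -` cball 0 R \<inter> space \<mu>"
      then have "K * norm x \<le> R" using K(2)[of x] by simp
      then show "x \<in> cball 0 (R / K)" using K(1) by (simp add: field_simps)
    qed
  qed (simp add: s)
  also have "\<dots> < \<infinity>" using h by (auto simp: haar_on_def)
  finally show "emeasure (distr \<mu> borel A) (cball 0 R) < \<infinity>" .
next
  have s [measurable_cong]: "sets \<mu> = sets borel" and t: "\<And>v. v \<in> V \<Longrightarrow> distr \<mu> borel ((+) v) = \<mu>"
    using h by (auto simp: haar_on_def)
  have [measurable]: "A \<in> borel_measurable borel"
    by (rule linear_borel_measurable[OF A(1)])
  fix w assume "w \<in> A ` V"
  then obtain v where v: "v \<in> V" "w = A v" by auto
  have "distr (distr \<mu> borel A) borel ((+) w) = distr \<mu> borel ((+) w \<circ> A)"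
    by (rule distr_distr) measurable
  also have "(+) w \<circ> A = A \<circ> (+) v"
    by (auto simp: v linear_add[OF A(1)])
  also have "distr \<mu> borel \<dots> = distr (distr \<mu> borel ((+) v)) borel A"
    by (rule distr_distr[symmetric]) measurable
  finally show "distr (distr \<mu> borel A) borel ((+) w) = distr \<mu> borel A"
    by (simp add: t[OF v(1)])
next
  have s [measurable_cong]: "sets \<mu> = sets borel" and AE: "AE x in \<mu>. x \<in> V"
    using h by (auto simp: haar_on_def)
  have m [measurable]: "A \<in> borel_measurable borel"
    by (rule linear_borel_measurable[OF A(1)])
  have "A ` V \<in> sets borel"
    using V A(1) by (simp add: borel_closed closed_subspace linear_subspace_image)
  then show "AE x in distr \<mu> borel A. x \<in> A ` V"
    using AE by (subst AE_distr_iff) auto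
qed

lemma fundamental_parallelepiped_linear_image:
  assumes A: "linear A" "inj A"
  shows "fundamental_parallelepiped (A ` B) = A ` fundamental_parallelepiped B"
proof -
  have i: "inj_on A B" using A(2) by (rule inj_on_subset) simp
  have *: "(\<Sum>b\<in>A ` B. t b *\<^sub>R b) = A (\<Sum>b\<in>B. t (A b) *\<^sub>R b)" for t
    by (simp add: sum.reindex[OF i] linear_sum[OF A(1)] linear_scale[OF A(1)])
  show ?thesis
  proof safe
    fix x assume "x \<in> fundamental_parallelepiped (A ` B)"
    then show "x \<in> A ` fundamental_parallelepiped B"
      unfolding fundamental_parallelepiped_def by (force simp: *)
  next
    fix x assume "x \<in> fundamental_parallelepiped B"
    then obtain t where t: "x = (\<Sum>b\<in>B. t b *\<^sub>R b)" "\<forall>b\<in>B. 0 \<le> t b \<and> t b < 1"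
      by (auto simp: fundamental_parallelepiped_def)
    show "A x \<in> fundamental_parallelepiped (A ` B)"
      unfolding fundamental_parallelepiped_def
      by (rule CollectI, rule exI[of _ "t \<circ> inv_into UNIV A"])
         (use t A(2) in \<open>simp add: * o_def\<close>)
  qed
qed

lemma lattice_basis_linear_image:
  assumes A: "linear A" "inj A" and B: "lattice_basis \<Lambda> B"
  shows "lattice_basis (A ` \<Lambda>) (A ` B)"
proof -
  have i: "inj_on A B" using A(2) by (rule inj_on_subset) simp
  have *: "(\<Sum>b\<in>A ` B. of_int (c b) *\<^sub>R b) = A (\<Sum>b\<in>B. of_int (c (A b)) *\<^sub>R b)" for c :: "'b \<Rightarrow> int"
    by (simp add: sum.reindex[OF i] linear_sum[OF A(1)] linear_scale[OF A(1)])
  have L: "\<Lambda> = range (\<lambda>c :: 'a \<Rightarrow> int. \<Sum>b\<in>B. of_int (c b) *\<^sub>R b)" and ind: "independent B"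
    using B by (auto simp: lattice_basis_def)
  have "independent (A ` B)"
    using linear_independent_injective_image[OF A(1) ind] A(2) inj_on_subset by blast
  moreover have "A ` \<Lambda> = range (\<lambda>c :: 'b \<Rightarrow> int. \<Sum>b\<in>A ` B. of_int (c b) *\<^sub>R b)"
  proof safe
    fix v assume "v \<in> \<Lambda>"
    then obtain c :: "'a \<Rightarrow> int" where c: "v = (\<Sum>b\<in>B. of_int (c b) *\<^sub>R b)" by (auto simp: L)
    have "A v = (\<Sum>b\<in>A ` B. of_int ((c \<circ> inv_into UNIV A) b) *\<^sub>R b)"
      unfolding * c using A(2) by simp
    then show "A v \<in> range (\<lambda>c :: 'b \<Rightarrow> int. \<Sum>b\<in>A ` B. of_int (c b) *\<^sub>R b)"
      by (rule range_eqI[of _ _ "c \<circ> inv_into UNIV A"])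
  next
    fix c :: "'b \<Rightarrow> int"
    show "(\<Sum>b\<in>A ` B. of_int (c b) *\<^sub>R b) \<in> A ` \<Lambda>"
      unfolding * L by (rule imageI, rule range_eqI[of _ _ "c \<circ> A"]) simp
  qed
  ultimately show ?thesis by (simp add: lattice_basis_def)
qed

lemma fundamental_parallelepiped_orthonormal:
  assumes U: "orthonormal U"
  shows "measure (subspace_lborel (span U)) (fundamental_parallelepiped U) = 1"
proof -
  have fU: "finite U" using U by (rule orthonormal_finite)
  have "emeasure (subspace_lborel (span U)) (fundamental_parallelepiped U) =
    emeasure (\<Pi>\<^sub>M u\<in>U. lborel) {f \<in> extensional U. (\<Sum>u\<in>U. f u *\<^sub>R u) \<in> fundamental_parallelepiped U}"
    using subspace_lborel_eq[OF U refl] fundamental_parallelepiped_borel[OF orthonormal_independent[OF U]]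
    by (simp add: emeasure_coordinate_measure)
  also have "{f \<in> extensional U. (\<Sum>u\<in>U. f u *\<^sub>R u) \<in> fundamental_parallelepiped U} = Pi\<^sub>E U (\<lambda>_. {0..<1})"
  proof safe
    fix f u assume f: "(\<Sum>u\<in>U. f u *\<^sub>R u) \<in> fundamental_parallelepiped U" and "u \<in> U"
    then obtain t where t: "(\<Sum>u\<in>U. f u *\<^sub>R u) = (\<Sum>u\<in>U. t u *\<^sub>R u)" "\<forall>u\<in>U. 0 \<le> t u \<and> t u < 1"
      by (auto simp: fundamental_parallelepiped_def)
    have "f u = t u"
      using orthonormal_sum_inner[OF U \<open>u \<in> U\<close>, of f] orthonormal_sum_inner[OF U \<open>u \<in> U\<close>, of t] t(1) by simp
    then show "f u \<in> {0..<1}" using t(2) \<open>u \<in> U\<close> by simp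
  next
    fix f assume "f \<in> Pi\<^sub>E U (\<lambda>_. {0..<1::real})"
    then show "(\<Sum>u\<in>U. f u *\<^sub>R u) \<in> fundamental_parallelepiped U"
      unfolding fundamental_parallelepiped_def by (auto simp: PiE_iff)
  qed (auto simp: PiE_iff extensional_def)
  also have "emeasure (\<Pi>\<^sub>M u\<in>U. lborel) \<dots> = (\<Prod>u\<in>U. emeasure lborel {0..<1::real})"
    using fU by (intro lborel_product.emeasure_PiM) auto
  finally show ?thesis by (simp add: measure_def)
qed

text \<open>
  A linear map scales all volumes in a subspace by the same factor, by uniqueness of Haar measure; the
  factor is the volume of the image of a unit cube.
\<close>

lemma fundamental_parallelepiped_measure_linear:
  assumes A: "linear A" "inj A" and U: "orthonormal U" and B: "independent B" "span B = span U"
  shows "measure (subspace_lborel (A ` span U)) (fundamental_parallelepiped (A ` B)) =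
    measure (subspace_lborel (span U)) (fundamental_parallelepiped B) *
    measure (subspace_lborel (A ` span U)) (fundamental_parallelepiped (A ` U))"
proof -
  let ?V = "span U" let ?\<mu> = "subspace_lborel (A ` ?V)" let ?\<nu> = "distr (subspace_lborel ?V) borel A"
  have VW: "subspace ?V" "subspace (A ` ?V)" using A(1) by (simp_all add: linear_subspace_image)
  have h: "haar_on ?V (subspace_lborel ?V)" "haar_on (A ` ?V) ?\<mu>" "haar_on (A ` ?V) ?\<nu>"
    using VW A by (auto intro: haar_on_subspace_lborel haar_on_linear_image)
  have s [measurable_cong]: "sets (subspace_lborel ?V) = sets borel" using h(1) by (simp add: haar_on_def)
  have [measurable]: "A \<in> borel_measurable borel"
    by (rule linear_borel_measurable[OF A(1)])
  have U': "independent U" using U by (rule orthonormal_independent)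
  have ind: "independent (A ` U)" "independent (A ` B)"
    using linear_independent_injective_image[OF A(1)] U' B(1) inj_on_subset[OF A(2) subset_UNIV] by blast+
  have nu: "emeasure ?\<nu> (fundamental_parallelepiped (A ` C)) = emeasure (subspace_lborel ?V) (fundamental_parallelepiped C)"
    if "independent C" for C
  proof -
    have "independent (A ` C)"
      using linear_independent_injective_image[OF A(1) that] inj_on_subset[OF A(2) subset_UNIV] by blast
    then have "emeasure ?\<nu> (fundamental_parallelepiped (A ` C)) =
      emeasure (subspace_lborel ?V) (A -` (fundamental_parallelepiped (A ` C)) \<inter> space (subspace_lborel ?V))"
      using fundamental_parallelepiped_borel by (intro emeasure_distr) simp_all
    also have "A -` (fundamental_parallelepiped (A ` C)) \<inter> space (subspace_lborel ?V) = fundamental_parallelepiped C"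
      using sets_eq_imp_space_eq[OF s] A
      by (simp add: fundamental_parallelepiped_linear_image inj_vimage_image_eq)
    finally show ?thesis .
  qed
  have one: "emeasure (subspace_lborel ?V) (fundamental_parallelepiped U) = 1"
    using fundamental_parallelepiped_orthonormal[OF U] fundamental_parallelepiped_finite_measure[OF VW(1) U'] by simp
  have "emeasure ?\<mu> (fundamental_parallelepiped (A ` B)) * emeasure ?\<nu> (fundamental_parallelepiped (A ` U))
     = emeasure ?\<nu> (fundamental_parallelepiped (A ` B)) * emeasure ?\<mu> (fundamental_parallelepiped (A ` U))"
    using h VW ind fundamental_parallelepiped_borel nu[OF U'] one
    by (intro haar_on_proportional[of "A ` ?V" _ _ _ _ "fundamental_parallelepiped (A ` U)"]) auto
  then have "emeasure ?\<mu> (fundamental_parallelepiped (A ` B)) =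
     emeasure (subspace_lborel ?V) (fundamental_parallelepiped B) * emeasure ?\<mu> (fundamental_parallelepiped (A ` U))"
    using nu[OF U'] nu[OF B(1)] one by simp
  then show ?thesis
    by (simp add: measure_def enn2real_mult)
qed

lemma covolume_linear_image:
  assumes A: "linear A" "inj A" and U: "orthonormal U" and B: "lattice_basis \<Lambda> B" and "span \<Lambda> = span U"
  shows "covolume (A ` span U) (A ` \<Lambda>) = covolume (span U) \<Lambda> *
    measure (subspace_lborel (A ` span U)) (fundamental_parallelepiped (A ` U))"
proof -
  have "covolume (A ` span U) (A ` \<Lambda>) = measure (subspace_lborel (A ` span U)) (fundamental_parallelepiped (A ` B))"
    using assms by (intro covolume_eq lattice_basis_linear_image) (auto simp: linear_span_image)
  also have "\<dots> = measure (subspace_lborel (span U)) (fundamental_parallelepiped B) *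
    measure (subspace_lborel (A ` span U)) (fundamental_parallelepiped (A ` U))"
  proof (rule fundamental_parallelepiped_measure_linear[OF A U])
    show "independent B" using B by (simp add: lattice_basis_def)
    show "span B = span U" using lattice_basis_span[OF B] assms(5) by simp
  qed
  also have "measure (subspace_lborel (span U)) (fundamental_parallelepiped B) = covolume (span U) \<Lambda>"
    using assms by (intro covolume_eq[symmetric]) auto
  finally show ?thesis .
qed

section \<open>Triangular bases\<close>

text \<open>
  The orthonormal vectors \<open>e\<close> are the normalized Gram--Schmidt vectors of \<open>b\<close>, and \<open>b i \<bullet> e i\<close> is the
  \<open>i\<close>-th Gram--Schmidt length: \<open>b = R e\<close> is a QR decomposition with positive diagonal.
\<close>

definition triangular_basis :: "nat \<Rightarrow> (nat \<Rightarrow> 'a::euclidean_space) \<Rightarrow> (nat \<Rightarrow> 'a) \<Rightarrow> bool" where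
  "triangular_basis k b e \<longleftrightarrow>
     (\<forall>i<k. \<forall>j<k. e i \<bullet> e j = (if i = j then 1 else 0)) \<and>
     (\<forall>i<k. b i \<in> span (e ` {..i})) \<and> (\<forall>i<k. 0 < b i \<bullet> e i)"

definition int_combinations :: "nat \<Rightarrow> (nat \<Rightarrow> 'a::euclidean_space) \<Rightarrow> 'a set" where
  "int_combinations k b = range (\<lambda>z :: nat \<Rightarrow> int. \<Sum>i<k. of_int (z i) *\<^sub>R b i)"

lemma triangular_basis_inner:
  assumes "triangular_basis k b e" "i < j" "j < k"
  shows "b i \<bullet> e j = 0"
proof -
  have "b i \<in> span (e ` {..i})" using assms by (auto simp: triangular_basis_def)
  moreover have "span (e ` {..i}) \<subseteq> {x. x \<bullet> e j = 0}"
    using assms by (intro span_minimal)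
      (auto simp: triangular_basis_def subspace_def inner_add_left)
  ultimately show ?thesis by auto
qed

lemma triangular_basis_take: "triangular_basis m b e \<Longrightarrow> k \<le> m \<Longrightarrow> triangular_basis k b e"
  by (simp add: triangular_basis_def)

lemma triangular_basis_inj_e:
  assumes "triangular_basis k b e"
  shows "inj_on e {..<k}"
proof (rule inj_onI)
  fix i j assume ij: "i \<in> {..<k}" "j \<in> {..<k}" and eq: "e i = e j"
  have "e i \<bullet> e i = 1" "e i \<bullet> e j = (if i = j then 1 else 0)"
    using assms ij by (simp_all add: triangular_basis_def)
  then show "i = j" using eq by (simp split: if_splits)
qed

lemma triangular_basis_orthonormal:
  assumes "triangular_basis k b e"
  shows "orthonormal (e ` {..<k})"
  using assms
  by (auto simp: orthonormal_basis_of_def pairwise_def orthogonal_def triangular_basis_def norm_eq_1)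

lemma triangular_basis_top_coefficient:
  assumes t: "triangular_basis k b e" and "j < k" and z: "\<And>i. j < i \<Longrightarrow> i < k \<Longrightarrow> z i = 0"
  shows "(\<Sum>i<k. z i *\<^sub>R b i) \<bullet> e j = z j * (b j \<bullet> e j)"
proof -
  have "(\<Sum>i<k. z i *\<^sub>R b i) \<bullet> e j = (\<Sum>i<k. if i = j then z j * (b j \<bullet> e j) else 0)"
    unfolding inner_sum_left
  proof (rule sum.cong[OF refl])
    fix i assume "i \<in> {..<k}"
    then show "z i *\<^sub>R b i \<bullet> e j = (if i = j then z j * (b j \<bullet> e j) else 0)"
      using z[of i] triangular_basis_inner[OF t, of i j] \<open>j < k\<close>
      by (cases i j rule: linorder_cases) auto
  qed
  then show ?thesis using \<open>j < k\<close> by simp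
qed

lemma largest_nonzero_coefficient:
  fixes z :: "nat \<Rightarrow> 'b::zero"
  assumes "i < k" "z i \<noteq> 0"
  obtains j where "j < k" "z j \<noteq> 0" "\<And>i. j < i \<Longrightarrow> i < k \<Longrightarrow> z i = 0"
proof -
  let ?S = "{i. i < k \<and> z i \<noteq> 0}"
  have S: "finite ?S" "?S \<noteq> {}" using assms by auto
  have "Max ?S \<in> ?S" using S by (rule Max_in)
  moreover have "z i = 0" if "Max ?S < i" "i < k" for i
    using Max_ge[OF S(1), of i] that by fastforce
  ultimately show ?thesis by (intro that[of "Max ?S"]) blast+
qed

lemma triangular_basis_sum_eq_0:
  assumes t: "triangular_basis k b e" and 0: "(\<Sum>i<k. z i *\<^sub>R b i) = 0" and "i < k"
  shows "z i = 0"
proof (rule ccontr)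
  assume "z i \<noteq> 0"
  then obtain j where j: "j < k" "z j \<noteq> 0" "\<And>i. j < i \<Longrightarrow> i < k \<Longrightarrow> z i = 0"
    using largest_nonzero_coefficient[of i k z] \<open>i < k\<close> by metis
  have "z j * (b j \<bullet> e j) = 0"
    using triangular_basis_top_coefficient[OF t j(1), of z] j(3) 0 by simp
  moreover have "0 < b j \<bullet> e j" using t j(1) by (simp add: triangular_basis_def)
  ultimately show False using j(2) by simp
qed

lemma triangular_basis_inj:
  assumes t: "triangular_basis k b e"
  shows "inj_on b {..<k}"
proof (rule inj_onI)
  fix i j assume ij: "i \<in> {..<k}" "j \<in> {..<k}" "b i = b j"
  have "(\<Sum>l<k. ((if l = i then 1 else 0) - (if l = j then 1 else 0)) *\<^sub>R b l) =
    (\<Sum>l<k. if l = i then b i else 0) - (\<Sum>l<k. if l = j then b j else 0)"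
    unfolding sum_subtractf[symmetric] by (intro sum.cong) auto
  also have "\<dots> = 0" using ij by simp
  finally have "(if i = i then 1 else 0) - (if i = j then 1 else (0::real)) = 0"
    by (rule triangular_basis_sum_eq_0[OF t]) (use ij in simp)
  then show "i = j" by (simp split: if_splits)
qed

lemma triangular_basis_independent:
  assumes t: "triangular_basis k b e"
  shows "independent (b ` {..<k})"
proof (rule independent_if_scalars_zero)
  fix f x assume s: "(\<Sum>x\<in>b ` {..<k}. f x *\<^sub>R x) = 0" and "x \<in> b ` {..<k}"
  then obtain i where i: "i < k" "x = b i" by auto
  have "(\<Sum>i<k. f (b i) *\<^sub>R b i) = 0"
    using s by (simp add: sum.reindex[OF triangular_basis_inj[OF t]])
  from triangular_basis_sum_eq_0[OF t this i(1)] show "f x = 0" by (simp add: i)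
qed simp

lemma triangular_basis_span:
  assumes t: "triangular_basis k b e"
  shows "span (b ` {..<k}) = span (e ` {..<k})"
proof (rule subspace_dim_equal)
  have "b i \<in> span (e ` {..<k})" if "i < k" for i
  proof -
    have "b i \<in> span (e ` {..i})" using t that by (simp add: triangular_basis_def)
    then show ?thesis by (rule rev_subsetD) (intro span_mono image_mono, use that in auto)
  qed
  then show "span (b ` {..<k}) \<subseteq> span (e ` {..<k})"
    by (intro span_minimal) auto
  have "dim (span (b ` {..<k})) = k"
    using dim_span_eq_card_independent[OF triangular_basis_independent[OF t]]
      card_image[OF triangular_basis_inj[OF t]] by simp
  moreover have "dim (span (e ` {..<k})) = k"
    using orthonormal_card_dim[OF triangular_basis_orthonormal[OF t]]
      card_image[OF triangular_basis_inj_e[OF t]] by simp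
  ultimately show "dim (span (e ` {..<k})) \<le> dim (span (b ` {..<k}))" by simp
qed auto

lemma int_combinations_lattice_basis:
  assumes t: "triangular_basis k b e"
  shows "lattice_basis (int_combinations k b) (b ` {..<k})"
proof -
  have inj: "inj_on b {..<k}" using t by (rule triangular_basis_inj)
  have "int_combinations k b = range (\<lambda>c :: 'a \<Rightarrow> int. \<Sum>v\<in>b ` {..<k}. of_int (c v) *\<^sub>R v)"
  proof safe
    fix v assume "v \<in> int_combinations k b"
    then obtain z :: "nat \<Rightarrow> int" where z: "v = (\<Sum>i<k. of_int (z i) *\<^sub>R b i)"
      by (auto simp: int_combinations_def)
    show "v \<in> range (\<lambda>c :: 'a \<Rightarrow> int. \<Sum>v\<in>b ` {..<k}. of_int (c v) *\<^sub>R v)"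
      by (rule range_eqI[of _ _ "z \<circ> the_inv_into {..<k} b"])
        (simp add: z sum.reindex[OF inj] the_inv_into_f_f[OF inj])
  next
    fix c :: "'a \<Rightarrow> int"
    show "(\<Sum>v\<in>b ` {..<k}. of_int (c v) *\<^sub>R v) \<in> int_combinations k b"
      unfolding int_combinations_def
      by (rule range_eqI[of _ _ "c \<circ> b"]) (simp add: sum.reindex[OF inj])
  qed
  then show ?thesis
    using triangular_basis_independent[OF t] by (simp add: lattice_basis_def)
qed

lemma int_combinations_span:
  assumes "triangular_basis k b e"
  shows "span (int_combinations k b) = span (e ` {..<k})"
  using lattice_basis_span[OF int_combinations_lattice_basis[OF assms]] triangular_basis_span[OF assms]
  by simp

section \<open>Volume of a triangular parallelepiped\<close>

text \<open>
  The parallelepiped in orthonormal coordinates; \<open>m j i\<close> is the \<open>i\<close>-th coordinate of its \<open>j\<close>-th edge.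
\<close>

definition skew_box :: "nat \<Rightarrow> (nat \<Rightarrow> nat \<Rightarrow> real) \<Rightarrow> (nat \<Rightarrow> real) set" where
  "skew_box k m = {f \<in> extensional {..<k}.
     \<exists>t. (\<forall>j<k. 0 \<le> t j \<and> t j < 1) \<and> (\<forall>i<k. f i = (\<Sum>j<k. t j * m j i))}"

text \<open>
  Only the last edge has a component in the last direction. So the last coordinate of a point
  determines the multiple of that edge, and subtracting this multiple leaves a point of the
  box spanned by the other edges.
\<close>

lemma skew_box_Suc:
  assumes tri: "\<And>j. j < k \<Longrightarrow> m j k = 0" and pos: "m k k > 0"
    and f: "f \<in> extensional {..<Suc k}"
  shows "f \<in> skew_box (Suc k) m \<longleftrightarrow> f k \<in> {0..<m k k} \<and>
    (\<lambda>i\<in>{..<k}. - (f k / m k k * m k i) + f i) \<in> skew_box k m"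
    (is "?L \<longleftrightarrow> ?R")
proof
  assume ?L
  then obtain t where t: "\<And>j. j < Suc k \<Longrightarrow> 0 \<le> t j \<and> t j < 1"
      "\<And>i. i < Suc k \<Longrightarrow> f i = (\<Sum>j<Suc k. t j * m j i)"
    by (auto simp: skew_box_def)
  have fk: "f k = t k * m k k" using t(2)[of k] tri by simp
  then have "f k / m k k = t k" using pos by simp
  moreover have "0 \<le> f k" "f k < m k k" using t(1)[of k] fk pos by auto
  ultimately show ?R
    using t unfolding skew_box_def by (auto intro!: exI[of _ t])
next
  assume R: ?R
  then obtain t where t: "\<And>j. j < k \<Longrightarrow> 0 \<le> t j \<and> t j < 1"
      "\<And>i. i < k \<Longrightarrow> - (f k / m k k * m k i) + f i = (\<Sum>j<k. t j * m j i)"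
    unfolding skew_box_def by auto
  let ?t = "t(k := f k / m k k)"
  have "0 \<le> ?t j \<and> ?t j < 1" if "j < Suc k" for j
    using R t(1)[of j] that pos by (cases "j = k") auto
  moreover have "f i = (\<Sum>j<Suc k. ?t j * m j i)" if "i < Suc k" for i
  proof (cases "i = k")
    case True
    then show ?thesis using pos tri by simp
  next
    case False
    then show ?thesis using t(2)[of i] that by simp
  qed
  ultimately show ?L using f unfolding skew_box_def by blast
qed

text \<open>
  Fubini in the last coordinate: every slice with last coordinate in \<open>[0, m k k)\<close> is a translate
  of the box of one dimension less, and the other slices are empty.
\<close>

lemma skew_box_volume:
  assumes "\<And>i j. j < i \<Longrightarrow> i < k \<Longrightarrow> m j i = 0" "\<And>i. i < k \<Longrightarrow> m i i > 0"
  shows "skew_box k m \<in> sets (\<Pi>\<^sub>M i\<in>{..<k}. lborel) \<and>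
    emeasure (\<Pi>\<^sub>M i\<in>{..<k}. lborel) (skew_box k m) = ennreal (\<Prod>i<k. m i i)"
  using assms
proof (induction k)
  case 0
  have "skew_box 0 m = {\<lambda>_. undefined}"
    by (auto simp: skew_box_def extensional_def)
  then show ?case
    by (simp add: PiM_empty)
next
  case (Suc k)
  let ?P = "\<Pi>\<^sub>M i\<in>{..<k}. (lborel :: real measure)"
  let ?P' = "\<Pi>\<^sub>M i\<in>{..<Suc k}. (lborel :: real measure)"
  have IH [measurable]: "skew_box k m \<in> sets ?P"
    and IHv: "emeasure ?P (skew_box k m) = ennreal (\<Prod>i<k. m i i)"
    using Suc.IH Suc.prems by auto
  have tri: "\<And>j. j < k \<Longrightarrow> m j k = 0" and pos: "m k k > 0"
    using Suc.prems by auto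
  let ?g = "\<lambda>f. \<lambda>i\<in>{..<k}. - (f k / m k k * m k i) + f i"
  have [measurable]: "?g \<in> ?P' \<rightarrow>\<^sub>M ?P"
    by (intro measurable_restrict) (auto intro!: measurable_component_singleton borel_measurable_add borel_measurable_times borel_measurable_divide borel_measurable_uminus)
  have [measurable]: "(\<lambda>f. f k) \<in> ?P' \<rightarrow>\<^sub>M borel"
    using measurable_component_singleton[of k "{..<Suc k}" "\<lambda>_. lborel"] by simp
  have "skew_box (Suc k) m = {f \<in> space ?P'. f k \<in> {0..<m k k} \<and> ?g f \<in> skew_box k m}"
  proof -
    have "skew_box (Suc k) m \<subseteq> space ?P'"
      by (auto simp: skew_box_def space_PiM PiE_def)
    then show ?thesis
      using skew_box_Suc[where m = m and k = k, OF tri pos] by (auto simp: space_PiM PiE_def)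
  qed
  also have "\<dots> \<in> sets ?P'"
    by measurable
  finally have sets: "skew_box (Suc k) m \<in> sets ?P'" .
  have ins: "{..<Suc k} = insert k {..<k}" by auto
  have "emeasure ?P' (skew_box (Suc k) m) = (\<integral>\<^sup>+f. indicator (skew_box (Suc k) m) f \<partial>?P')"
    using sets by simp
  also have "\<dots> = (\<integral>\<^sup>+y. (\<integral>\<^sup>+x. indicator (skew_box (Suc k) m) (x(k := y)) \<partial>?P) \<partial>lborel)"
    using sets unfolding ins
    by (intro lborel_product.product_nn_integral_insert_rev) auto
  also have "\<dots> = (\<integral>\<^sup>+y. emeasure ?P (skew_box k m) * indicator {0..<m k k} y \<partial>lborel)"
  proof (rule nn_integral_cong)
    fix y :: real
    let ?t = "\<lambda>f. \<lambda>i\<in>{..<k}. - (y / m k k * m k i) + f i"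
    have tm: "?t \<in> ?P \<rightarrow>\<^sub>M ?P" by measurable
    have "(\<integral>\<^sup>+x. indicator (skew_box (Suc k) m) (x(k := y)) \<partial>?P)
       = (\<integral>\<^sup>+x. indicator (skew_box k m) (?t x) * indicator {0..<m k k} y \<partial>?P)"
    proof (rule nn_integral_cong)
      fix x assume "x \<in> space ?P"
      then have e: "x(k := y) \<in> extensional {..<Suc k}"
        by (auto simp: space_PiM PiE_def extensional_def)
      have eq: "?g (x(k := y)) = ?t x" by (auto intro!: restrict_ext)
      show "indicator (skew_box (Suc k) m) (x(k := y)) =
        (indicator (skew_box k m) (?t x) * indicator {0..<m k k} y :: ennreal)"
        using skew_box_Suc[where m = m and k = k, OF tri pos e] unfolding eq
        by (auto simp: indicator_def)
    qed
    also have "\<dots> = (\<integral>\<^sup>+x. indicator (skew_box k m) (?t x) \<partial>?P) * indicator {0..<m k k} y"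
      using tm by (intro nn_integral_multc) measurable
    also have "(\<integral>\<^sup>+x. indicator (skew_box k m) (?t x) \<partial>?P) = (\<integral>\<^sup>+x. indicator (skew_box k m) x \<partial>distr ?P ?P ?t)"
      using tm by (subst nn_integral_distr) auto
    also have "\<dots> = emeasure ?P (skew_box k m)"
      by (subst PiM_lborel_translate) simp_all
    finally show "(\<integral>\<^sup>+x. indicator (skew_box (Suc k) m) (x(k := y)) \<partial>?P)
      = emeasure ?P (skew_box k m) * indicator {0..<m k k} y" .
  qed
  also have "\<dots> = emeasure ?P (skew_box k m) * ennreal (m k k)"
    using pos by (simp add: nn_integral_cmult)
  also have "\<dots> = ennreal (\<Prod>i<Suc k. m i i)"
  proof -
    have "0 \<le> (\<Prod>i<k. m i i)" using Suc.prems(2) by (intro prod_nonneg) (auto intro: less_imp_le)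
    then show ?thesis using pos unfolding IHv by (simp add: ennreal_mult)
  qed
  finally show ?case using sets by simp
qed

lemma fundamental_parallelepiped_triangular:
  assumes t: "triangular_basis k b e"
  shows "measure (subspace_lborel (span (e ` {..<k}))) (fundamental_parallelepiped (b ` {..<k})) = (\<Prod>i<k. b i \<bullet> e i)"
proof -
  let ?E = "e ` {..<k}" and ?P = "fundamental_parallelepiped (b ` {..<k})"
  have U: "orthonormal ?E" using t by (rule triangular_basis_orthonormal)
  have ie: "inj_on e {..<k}" using t by (rule triangular_basis_inj_e)
  have ib: "inj_on b {..<k}" using t by (rule triangular_basis_inj)
  have pos: "\<And>i. i < k \<Longrightarrow> b i \<bullet> e i > 0" using t by (simp add: triangular_basis_def)
  define m where "m = (\<lambda>j i. b j \<bullet> e i)"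
  let ?g = "\<lambda>f. \<lambda>i\<in>{..<k}. f (e i)"
  have box: "skew_box k m \<in> sets (\<Pi>\<^sub>M i\<in>{..<k}. lborel)"
      "emeasure (\<Pi>\<^sub>M i\<in>{..<k}. lborel) (skew_box k m) = ennreal (\<Prod>i<k. m i i)"
    using skew_box_volume[of k m] triangular_basis_inner[OF t] pos by (auto simp: m_def)
  have "(\<Sum>u\<in>?E. f u *\<^sub>R u) \<in> ?P \<longleftrightarrow> ?g f \<in> skew_box k m" for f
  proof
    assume "(\<Sum>u\<in>?E. f u *\<^sub>R u) \<in> ?P"
    then obtain s where s: "(\<Sum>u\<in>?E. f u *\<^sub>R u) = (\<Sum>v\<in>b ` {..<k}. s v *\<^sub>R v)"
      "\<forall>v\<in>b ` {..<k}. 0 \<le> s v \<and> s v < 1"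
      unfolding fundamental_parallelepiped_def by auto
    have "f (e i) = (\<Sum>j<k. s (b j) * m j i)" if "i < k" for i
    proof -
      have "f (e i) = (\<Sum>u\<in>?E. f u *\<^sub>R u) \<bullet> e i"
        using that by (intro orthonormal_sum_inner[OF U, symmetric]) auto
      also have "\<dots> = (\<Sum>j<k. s (b j) * m j i)"
        unfolding s(1) sum.reindex[OF ib] by (simp add: inner_sum_left m_def)
      finally show ?thesis .
    qed
    then show "?g f \<in> skew_box k m"
      unfolding skew_box_def using s(2) by (auto intro!: exI[of _ "\<lambda>j. s (b j)"])
  next
    assume "?g f \<in> skew_box k m"
    then obtain s where s: "\<And>j. j < k \<Longrightarrow> 0 \<le> s j \<and> s j < 1" "\<And>i. i < k \<Longrightarrow> f (e i) = (\<Sum>j<k. s j * m j i)"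
      unfolding skew_box_def by auto
    define v where "v = (\<Sum>j<k. s j *\<^sub>R b j)"
    have "v \<in> span ?E"
      unfolding v_def triangular_basis_span[OF t, symmetric] by (intro span_sum span_mul span_base) auto
    then obtain h where h: "v = (\<Sum>u\<in>?E. h u *\<^sub>R u)"
      by (auto simp: span_finite)
    have "h u = f u" if "u \<in> ?E" for u
    proof -
      obtain i where i: "i < k" "u = e i" using \<open>u \<in> ?E\<close> by auto
      have "h u = v \<bullet> u" unfolding h using that by (rule orthonormal_sum_inner[OF U, symmetric])
      also have "\<dots> = f u" using s(2)[OF i(1)] by (simp add: v_def i inner_sum_left m_def)
      finally show ?thesis .
    qed
    then have "(\<Sum>u\<in>?E. f u *\<^sub>R u) = v" unfolding h by (intro sum.cong) auto
    also have "v \<in> ?P"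
      unfolding fundamental_parallelepiped_def v_def
      by (rule CollectI, rule exI[of _ "s \<circ> the_inv_into {..<k} b"])
         (use s(1) in \<open>auto simp: sum.reindex[OF ib] the_inv_into_f_f[OF ib]\<close>)
    finally show "(\<Sum>u\<in>?E. f u *\<^sub>R u) \<in> ?P" .
  qed
  note iff = this
  have gm: "?g \<in> (\<Pi>\<^sub>M u\<in>?E. (lborel::real measure)) \<rightarrow>\<^sub>M (\<Pi>\<^sub>M i\<in>{..<k}. (lborel::real measure))"
    by (intro measurable_restrict) auto
  have "emeasure (subspace_lborel (span ?E)) ?P =
    emeasure (\<Pi>\<^sub>M u\<in>?E. lborel) {f \<in> extensional ?E. (\<Sum>u\<in>?E. f u *\<^sub>R u) \<in> ?P}"
    using fundamental_parallelepiped_borel[OF triangular_basis_independent[OF t]]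
    by (simp only: subspace_lborel_eq[OF U refl] emeasure_coordinate_measure)
  also have "{f \<in> extensional ?E. (\<Sum>u\<in>?E. f u *\<^sub>R u) \<in> ?P} = ?g -` skew_box k m \<inter> space (\<Pi>\<^sub>M u\<in>?E. lborel)"
    by (auto simp: iff space_PiM PiE_def)
  also have "emeasure (\<Pi>\<^sub>M u\<in>?E. lborel) \<dots> = emeasure (distr (\<Pi>\<^sub>M u\<in>?E. lborel) (\<Pi>\<^sub>M i\<in>{..<k}. lborel) ?g) (skew_box k m)"
    using gm box(1) by (rule emeasure_distr[symmetric])
  also have "\<dots> = ennreal (\<Prod>i<k. m i i)"
    using ie box(2) by (subst PiM_lborel_reindex) (auto simp: bij_betw_def)
  finally have "emeasure (subspace_lborel (span ?E)) ?P = ennreal (\<Prod>i<k. m i i)" .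
  moreover have "0 \<le> (\<Prod>i<k. m i i)"
    using pos by (intro prod_nonneg) (auto simp: m_def intro: less_imp_le)
  ultimately show ?thesis unfolding measure_def by (simp add: m_def)
qed

lemma covolume_triangular:
  assumes "triangular_basis k b e"
  shows "covolume (span (e ` {..<k})) (int_combinations k b) = (\<Prod>i<k. b i \<bullet> e i)"
  using covolume_eq[OF int_combinations_lattice_basis[OF assms] int_combinations_span[OF assms]]
    fundamental_parallelepiped_triangular[OF assms] by simp

section \<open>Reduced bases of discrete subgroups\<close>

lemma subgroup_int_scaleR:
  fixes \<Lambda> :: "'a::real_vector set"
  assumes 0: "0 \<in> \<Lambda>" and d: "\<And>x y. x \<in> \<Lambda> \<Longrightarrow> y \<in> \<Lambda> \<Longrightarrow> x - y \<in> \<Lambda>" and x: "x \<in> \<Lambda>"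
  shows "of_int m *\<^sub>R x \<in> \<Lambda>"
proof -
  have minus: "- y \<in> \<Lambda>" if "y \<in> \<Lambda>" for y using d[OF 0 that] by simp
  have n: "of_nat n *\<^sub>R x \<in> \<Lambda>" for n
  proof (induction n)
    case (Suc n)
    from d[OF this minus[OF x]] show ?case by (simp add: scaleR_add_left add.commute)
  qed (simp add: 0)
  show ?thesis
  proof (cases m)
    case (nonneg n)
    then show ?thesis using n[of n] by simp
  next
    case (neg n)
    then show ?thesis using minus[OF n[of "Suc n"]]
      by (simp add: scaleR_minus_left[symmetric] del: scaleR_minus_left)
  qed
qed

lemma subgroup_int_combination:
  fixes \<Lambda> :: "'a::real_vector set"
  assumes 0: "0 \<in> \<Lambda>" and d: "\<And>x y. x \<in> \<Lambda> \<Longrightarrow> y \<in> \<Lambda> \<Longrightarrow> x - y \<in> \<Lambda>"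
    and b: "\<And>i. i \<in> I \<Longrightarrow> b i \<in> \<Lambda>"
  shows "(\<Sum>i\<in>I. of_int (z i) *\<^sub>R b i) \<in> \<Lambda>"
  using b
proof (induction I rule: infinite_finite_induct)
  case (insert i I)
  have "- (of_int (z i) *\<^sub>R b i) \<in> \<Lambda>"
    using d[OF 0 subgroup_int_scaleR[OF 0 d]] insert.prems by simp
  from d[OF insert.IH this] insert show ?case by (simp add: add.commute)
qed (simp_all add: 0)

lemma int_combinations_base:
  assumes "i < k"
  shows "b i \<in> int_combinations k b"
proof -
  have "(\<Sum>j<k. of_int (if j = i then 1 else 0) *\<^sub>R b j) = (\<Sum>j<k. if j = i then b i else 0)"
    by (intro sum.cong) auto
  then show ?thesis
    unfolding int_combinations_def using assms
    by (intro range_eqI[of _ _ "\<lambda>j. if j = i then 1 else 0"]) simp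
qed

definition discrete_subgroup :: "'a::euclidean_space set \<Rightarrow> bool" where
  "discrete_subgroup \<Lambda> \<longleftrightarrow> 0 \<in> \<Lambda> \<and> (\<forall>x\<in>\<Lambda>. \<forall>y\<in>\<Lambda>. x - y \<in> \<Lambda>) \<and> (\<forall>R. finite {v \<in> \<Lambda>. norm v \<le> R})"

text \<open>
  The quotient of consecutive Gram--Schmidt lengths is bounded as in the theory of Hermite, Korkin and
  Zolotarev, whose constant \<open>2 / \<surd>3\<close> is rounded up to \<open>2\<close>.
\<close>

definition reduced_basis :: "'a::euclidean_space set \<Rightarrow> nat \<Rightarrow> (nat \<Rightarrow> 'a) \<Rightarrow> (nat \<Rightarrow> 'a) \<Rightarrow> bool" where
  "reduced_basis \<Lambda> k b e \<longleftrightarrow> triangular_basis k b e \<and> \<Lambda> = int_combinations k b \<and>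
    (\<forall>i. Suc i < k \<longrightarrow> b i \<bullet> e i \<le> 2 * (b (Suc i) \<bullet> e (Suc i)))"

text \<open>
  Start with a shortest nonzero vector \<open>b0\<close> and project along it. The projected group is again discrete,
  because each of its elements has a lift whose component along \<open>b0\<close> is at most \<open>|b0| / 2\<close>; so a
  reduced basis of it exists by induction, and such lifts of its members, together with \<open>b0\<close>, form the
  basis. The first two lengths are comparable since the lift of the second vector is not shorter than
  \<open>b0\<close> and owes at most \<open>|b0| / 2\<close> to the direction of \<open>b0\<close>. For a discrete subgroup this provides
  the existence of a lattice basis at the same time.
\<close>

lemma reduced_basis_exists:
  fixes \<Lambda> :: "'a::euclidean_space set"
  assumes "discrete_subgroup \<Lambda>" and "dim \<Lambda> = k"
  shows "\<exists>b e. reduced_basis \<Lambda> k b e"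
  using assms
proof (induction k arbitrary: \<Lambda>)
  case 0
  then have "\<Lambda> = {0}"
    by (auto simp: discrete_subgroup_def)
  then show ?case
    by (auto simp: reduced_basis_def triangular_basis_def int_combinations_def)
next
  case (Suc k)
  have zero: "0 \<in> \<Lambda>" and diff: "\<And>x y. x \<in> \<Lambda> \<Longrightarrow> y \<in> \<Lambda> \<Longrightarrow> x - y \<in> \<Lambda>"
    and disc: "\<And>R. finite {v \<in> \<Lambda>. norm v \<le> R}"
    using Suc.prems(1) by (auto simp: discrete_subgroup_def)
  obtain v0 where v0: "v0 \<in> \<Lambda>" "v0 \<noteq> 0"
    using Suc.prems(2) dim_eq_0[of \<Lambda>] by auto
  let ?S = "{v \<in> \<Lambda>. v \<noteq> 0 \<and> norm v \<le> norm v0}"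
  have "finite ?S" by (rule finite_subset[OF _ disc[of "norm v0"]]) auto
  moreover have "?S \<noteq> {}" using v0 by auto
  ultimately obtain b0 where b0S: "b0 \<in> ?S" and b0m: "\<And>v. v \<in> ?S \<Longrightarrow> norm b0 \<le> norm v"
    using ex_min_if_finite[of "norm ` ?S"] by (auto simp: not_less)
  have b0: "b0 \<in> \<Lambda>" "b0 \<noteq> 0" using b0S by auto
  have short: "norm b0 \<le> norm v" if "v \<in> \<Lambda>" "v \<noteq> 0" for v
    using b0m[of v] b0S that by (cases "norm v \<le> norm v0") auto
  let ?l = "norm b0"
  have l: "?l > 0" using b0 by simp
  define e0 where "e0 = b0 /\<^sub>R ?l"
  have e0: "e0 \<bullet> e0 = 1" "b0 = ?l *\<^sub>R e0" "b0 \<bullet> e0 = ?l"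
    using l by (auto simp: e0_def dot_square_norm power2_eq_square)
  define \<pi> where "\<pi> = (\<lambda>v. v - (v \<bullet> e0) *\<^sub>R e0)"
  have lin: "linear \<pi>"
    by (auto simp: \<pi>_def inner_add_left algebra_simps intro!: linearI)
  have \<pi>0: "\<pi> v \<bullet> e0 = 0" for v by (simp add: \<pi>_def inner_diff_left e0)
  have \<pi>b0: "\<pi> b0 = 0" using e0 by (simp add: \<pi>_def)
  have decomp: "v = \<pi> v + (v \<bullet> e0) *\<^sub>R e0" for v by (simp add: \<pi>_def)
  \<comment> \<open>Any lift can be moved by an integer multiple of \<open>b0\<close>, which changes its component by a multiple of \<open>|b0|\<close>.\<close>
  have lift: "\<exists>v\<in>\<Lambda>. \<pi> v = w \<and> \<bar>v \<bullet> e0\<bar> \<le> ?l / 2" if w: "w \<in> \<pi> ` \<Lambda>" for w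
  proof -
    obtain v where v: "v \<in> \<Lambda>" "\<pi> v = w" using w by auto
    define m where "m = round ((v \<bullet> e0) / ?l)"
    have "v - of_int m *\<^sub>R b0 \<in> \<Lambda>"
      using v(1) b0(1) by (intro diff subgroup_int_scaleR[OF zero diff])
    moreover have "\<pi> (v - of_int m *\<^sub>R b0) = w"
      using v \<pi>b0 by (simp add: linear_diff[OF lin] linear_scale[OF lin])
    moreover have "(v - of_int m *\<^sub>R b0) \<bullet> e0 = ((v \<bullet> e0) / ?l - of_int m) * ?l"
      using l e0 by (simp add: inner_diff_left field_simps)
    moreover have "\<bar>(v \<bullet> e0) / ?l - of_int m\<bar> \<le> 1 / 2"
      unfolding m_def using of_int_round_abs_le[of "(v \<bullet> e0) / ?l"] by (simp add: abs_minus_commute)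
    ultimately show ?thesis
      using l by (intro bexI[of _ "v - of_int m *\<^sub>R b0"]) (auto simp: abs_mult)
  qed
  have "discrete_subgroup (\<pi> ` \<Lambda>)"
    unfolding discrete_subgroup_def
  proof (intro conjI ballI allI)
    show "0 \<in> \<pi> ` \<Lambda>" using zero linear_0[OF lin] by force
    show "x - y \<in> \<pi> ` \<Lambda>" if "x \<in> \<pi> ` \<Lambda>" "y \<in> \<pi> ` \<Lambda>" for x y
      using that diff by (auto simp: linear_diff[OF lin, symmetric])
    show "finite {v \<in> \<pi> ` \<Lambda>. norm v \<le> R}" for R
    proof (rule finite_subset)
      show "{v \<in> \<pi> ` \<Lambda>. norm v \<le> R} \<subseteq> \<pi> ` {v \<in> \<Lambda>. norm v \<le> R + ?l}"
      proof safe
        fix u assume "u \<in> \<Lambda>" "norm (\<pi> u) \<le> R"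
        then obtain v where v: "v \<in> \<Lambda>" "\<pi> v = \<pi> u" "\<bar>v \<bullet> e0\<bar> \<le> ?l / 2"
          using lift[of "\<pi> u"] by auto
        have "norm v \<le> norm (\<pi> v) + norm ((v \<bullet> e0) *\<^sub>R e0)"
          using norm_triangle_ineq[of "\<pi> v" "(v \<bullet> e0) *\<^sub>R e0"] decomp[of v] by simp
        also have "norm ((v \<bullet> e0) *\<^sub>R e0) \<le> ?l"
          using v(3) l e0(1) by (simp add: norm_eq_1[symmetric])
        finally have "norm v \<le> R + ?l" using v(2) \<open>norm (\<pi> u) \<le> R\<close> by simp
        then show "\<pi> u \<in> \<pi> ` {v \<in> \<Lambda>. norm v \<le> R + ?l}" using v
          by (intro image_eqI[of _ _ v]) simp_all
      qed
      show "finite (\<pi> ` {v \<in> \<Lambda>. norm v \<le> R + ?l})" using disc by blast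
    qed
  qed
  moreover have "dim (\<pi> ` \<Lambda>) = k"
  proof -
    have "span (\<pi> ` \<Lambda>) \<subseteq> {x. x \<bullet> e0 = 0}"
      by (rule span_minimal) (auto simp: \<pi>0 subspace_def inner_add_left)
    then have "e0 \<notin> span (\<pi> ` \<Lambda>)" using e0(1) by auto
    then have "dim (insert e0 (\<pi> ` \<Lambda>)) = dim (\<pi> ` \<Lambda>) + 1" by (simp add: dim_insert)
    moreover have "span (insert e0 (\<pi> ` \<Lambda>)) = span \<Lambda>"
    proof
      have "e0 \<in> span \<Lambda>" using b0(1) unfolding e0_def by (intro span_mul span_base)
      moreover have "\<pi> v \<in> span \<Lambda>" if "v \<in> \<Lambda>" for v
        unfolding \<pi>_def using that calculation by (intro span_diff span_mul) (rule span_base)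
      ultimately show "span (insert e0 (\<pi> ` \<Lambda>)) \<subseteq> span \<Lambda>"
        by (intro span_minimal) auto
      have "v \<in> span (insert e0 (\<pi> ` \<Lambda>))" if "v \<in> \<Lambda>" for v
        by (subst decomp, intro span_add span_mul span_base) (use that in auto)
      then show "span \<Lambda> \<subseteq> span (insert e0 (\<pi> ` \<Lambda>))"
        by (intro span_minimal) auto
    qed
    ultimately show ?thesis
      using Suc.prems(2) by (metis Suc_eq_plus1 dim_span nat.inject)
  qed
  ultimately obtain c e where "reduced_basis (\<pi> ` \<Lambda>) k c e" using Suc.IH by blast
  then have ce: "triangular_basis k c e" and gen: "\<pi> ` \<Lambda> = int_combinations k c"
    and red: "\<And>i. Suc i < k \<Longrightarrow> c i \<bullet> e i \<le> 2 * (c (Suc i) \<bullet> e (Suc i))"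
    by (simp_all add: reduced_basis_def)
  have cL: "c i \<in> \<pi> ` \<Lambda>" if "i < k" for i
    unfolding gen using that by (rule int_combinations_base)
  then have "\<forall>i. \<exists>v. i < k \<longrightarrow> v \<in> \<Lambda> \<and> \<pi> v = c i \<and> \<bar>v \<bullet> e0\<bar> \<le> ?l / 2"
    using lift by blast
  then obtain b' where b': "\<And>i. i < k \<Longrightarrow> b' i \<in> \<Lambda>" "\<And>i. i < k \<Longrightarrow> \<pi> (b' i) = c i"
      "\<And>i. i < k \<Longrightarrow> \<bar>b' i \<bullet> e0\<bar> \<le> ?l / 2"
    by metis
  have ee0: "e i \<bullet> e0 = 0" "e0 \<bullet> e i = 0" if "i < k" for i
  proof -
    have "e i \<in> span (c ` {..<k})"
      unfolding triangular_basis_span[OF ce] using that by (intro span_base) auto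
    moreover have "span (c ` {..<k}) \<subseteq> {x. x \<bullet> e0 = 0}"
      using b'(2) \<pi>0 by (intro span_minimal) (auto simp: subspace_def inner_add_left, metis)
    ultimately show "e i \<bullet> e0 = 0" by auto
    then show "e0 \<bullet> e i = 0" by (simp add: inner_commute)
  qed
  have b'e: "b' i \<bullet> e i = c i \<bullet> e i" if "i < k" for i
    using decomp[of "b' i"] b'(2)[OF that] ee0(2)[OF that]
    by (metis add.right_neutral inner_add_left inner_scaleR_left mult_zero_right)
  define b where "b = case_nat b0 b'"
  define f where "f = case_nat e0 e"
  have bf [simp]: "b 0 = b0" "f 0 = e0" "b (Suc i) = b' i" "f (Suc i) = e i" for i
    by (simp_all add: b_def f_def)
  have "triangular_basis (Suc k) b f"
    unfolding triangular_basis_def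
  proof (intro conjI allI impI)
    fix i j assume "i < Suc k" "j < Suc k"
    then show "f i \<bullet> f j = (if i = j then 1 else 0)"
      using ce e0(1) ee0 by (cases i; cases j) (auto simp: triangular_basis_def)
  next
    fix i assume i: "i < Suc k"
    show "0 < b i \<bullet> f i"
      using ce l i by (cases i) (auto simp: e0(3) b'e triangular_basis_def)
    show "b i \<in> span (f ` {..i})"
    proof (cases i)
      case 0
      have "e0 \<in> span (f ` {..i})" using 0 by (intro span_base) simp
      then have "?l *\<^sub>R e0 \<in> span (f ` {..i})" by (rule span_mul)
      then show ?thesis using 0 e0(2) by simp
    next
      case (Suc i')
      have "c i' \<in> span (e ` {..i'})" using ce i Suc by (simp add: triangular_basis_def)
      moreover have "e ` {..i'} \<subseteq> f ` {..i}"
      proof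
        fix x assume "x \<in> e ` {..i'}"
        then obtain j where "j \<le> i'" "x = f (Suc j)" by auto
        then show "x \<in> f ` {..i}" using Suc by (intro image_eqI[of _ _ "Suc j"]) simp_all
      qed
      ultimately have "c i' \<in> span (f ` {..i})" using span_mono by blast
      moreover have "e0 \<in> span (f ` {..i})" by (intro span_base image_eqI[of _ _ 0]) auto
      ultimately have "c i' + (b' i' \<bullet> e0) *\<^sub>R e0 \<in> span (f ` {..i})"
        by (intro span_add span_mul)
      moreover have "b i = c i' + (b' i' \<bullet> e0) *\<^sub>R e0"
        using decomp[of "b' i'"] b'(2)[of i'] i Suc by simp
      ultimately show ?thesis by simp
    qed
  qed
  moreover have "\<Lambda> = int_combinations (Suc k) b"
  proof
    show "int_combinations (Suc k) b \<subseteq> \<Lambda>"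
    proof -
      have "b i \<in> \<Lambda>" if "i \<in> {..<Suc k}" for i using that b0(1) b'(1) by (cases i) auto
      then show ?thesis
        unfolding int_combinations_def using subgroup_int_combination[OF zero diff] by blast
    qed
    show "\<Lambda> \<subseteq> int_combinations (Suc k) b"
    proof
      fix v assume v: "v \<in> \<Lambda>"
      then have "\<pi> v \<in> int_combinations k c" using gen by blast
      then obtain z :: "nat \<Rightarrow> int" where z: "\<pi> v = (\<Sum>i<k. of_int (z i) *\<^sub>R c i)"
        by (auto simp: int_combinations_def)
      define u where "u = v - (\<Sum>i<k. of_int (z i) *\<^sub>R b' i)"
      have "(\<Sum>i<k. of_int (z i) *\<^sub>R b' i) \<in> \<Lambda>"
        by (rule subgroup_int_combination[OF zero diff]) (use b'(1) in auto)
      then have u: "u \<in> \<Lambda>" unfolding u_def using v by (intro diff)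
      have "\<pi> u = 0"
        unfolding u_def by (simp add: linear_diff[OF lin] linear_sum[OF lin] linear_scale[OF lin] z b'(2))
      then have "u = (u \<bullet> e0) *\<^sub>R e0" using decomp[of u] by simp
      also have "\<dots> = ((u \<bullet> e0) / ?l) *\<^sub>R b0" using l by (subst e0(2)) simp
      finally have us: "u = ((u \<bullet> e0) / ?l) *\<^sub>R b0" .
      \<comment> \<open>The multiple is an integer: otherwise its fractional part would give a vector shorter than \<open>b0\<close>.\<close>
      define s where "s = (u \<bullet> e0) / ?l"
      have "u - of_int \<lfloor>s\<rfloor> *\<^sub>R b0 \<in> \<Lambda>"
        using u b0(1) by (intro diff subgroup_int_scaleR[OF zero diff])
      moreover have r: "u - of_int \<lfloor>s\<rfloor> *\<^sub>R b0 = frac s *\<^sub>R b0"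
        using us by (simp add: s_def frac_def scaleR_diff_left)
      moreover have "norm (frac s *\<^sub>R b0) < ?l"
        using l frac_lt_1[of s] frac_ge_0[of s] by simp
      ultimately have "u - of_int \<lfloor>s\<rfloor> *\<^sub>R b0 = 0"
        using short by (metis not_less)
      then have "v = of_int \<lfloor>s\<rfloor> *\<^sub>R b0 + (\<Sum>i<k. of_int (z i) *\<^sub>R b' i)"
        by (simp add: u_def algebra_simps)
      also have "\<dots> = (\<Sum>i<Suc k. of_int (case_nat \<lfloor>s\<rfloor> z i) *\<^sub>R b i)"
        by (simp add: sum.lessThan_Suc_shift del: sum.lessThan_Suc)
      finally show "v \<in> int_combinations (Suc k) b"
        unfolding int_combinations_def by (rule range_eqI[of _ _ "case_nat \<lfloor>s\<rfloor> z"])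
    qed
  qed
  moreover have "b i \<bullet> f i \<le> 2 * (b (Suc i) \<bullet> f (Suc i))" if i: "Suc i < Suc k" for i
  proof (cases i)
    case 0
    have k: "0 < k" using i by simp
    let ?r = "c 0 \<bullet> e 0"
    have "c 0 \<in> span {e 0}" and r: "?r > 0" and ee: "e 0 \<bullet> e 0 = 1"
      using ce k by (auto simp: triangular_basis_def)
    then obtain q where q: "c 0 = q *\<^sub>R e 0" by (auto simp: span_singleton)
    then have "c 0 = ?r *\<^sub>R e 0" using ee by simp
    then have d: "b' 0 = ?r *\<^sub>R e 0 + (b' 0 \<bullet> e0) *\<^sub>R e0"
      using decomp[of "b' 0"] b'(2)[OF k] by simp
    have "b' 0 \<noteq> 0" using b'e[OF k] r by auto
    then have "?l\<^sup>2 \<le> (norm (b' 0))\<^sup>2"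
      using short[OF b'(1)[OF k]] by (simp add: power_mono)
    also have "\<dots> = ?r\<^sup>2 + (b' 0 \<bullet> e0)\<^sup>2"
    proof -
      define s where "s = b' 0 \<bullet> e0"
      have "b' 0 = ?r *\<^sub>R e 0 + s *\<^sub>R e0" using d by (simp add: s_def)
      then have "(norm (b' 0))\<^sup>2 = (norm (?r *\<^sub>R e 0 + s *\<^sub>R e0))\<^sup>2" by simp
      also have "\<dots> = ?r\<^sup>2 + s\<^sup>2"
        unfolding power2_norm_eq_inner
        by (simp add: inner_add_left inner_add_right ee e0(1) ee0[OF k] power2_eq_square)
      finally show ?thesis by (simp add: s_def)
    qed
    also have "(b' 0 \<bullet> e0)\<^sup>2 \<le> (?l / 2)\<^sup>2"
      using b'(3)[OF k] by (intro power2_le_iff_abs_le[THEN iffD2]) (use l in auto)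
    finally have "?l\<^sup>2 \<le> (2 * ?r)\<^sup>2"
      by (simp add: power2_eq_square) (use zero_le_square[of ?l] in linarith)
    then have "?l \<le> 2 * ?r" by (rule power2_le_imp_le) (use r in linarith)
    then have "b 0 \<bullet> f 0 \<le> 2 * (b (Suc 0) \<bullet> f (Suc 0))"
      unfolding bf e0(3) b'e[OF k] .
    then show ?thesis unfolding 0 .
  next
    case (Suc i')
    then show ?thesis using red[of i'] i by (simp add: b'e)
  qed
  ultimately show ?case unfolding reduced_basis_def by blast
qed

section \<open>Integer points\<close>

lemma integer_points_iff_Basis:
  "v \<in> integer_points \<longleftrightarrow> (\<forall>b\<in>Basis. v \<bullet> b \<in> \<int>)" for v :: "(real ^ 'n) \<times> real"
  by (cases v) (auto simp: integer_points_def Basis_prod_def Basis_vec_def inner_axis)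

lemma orthonormal_Basis: "orthonormal (Basis :: 'a::euclidean_space set)"
  by (auto simp: orthonormal_basis_of_def pairwise_def orthogonal_def inner_Basis)

lemma integer_points_lattice_basis: "lattice_basis (integer_points :: ((real ^ 'n) \<times> real) set) Basis"
proof -
  have "integer_points = range (\<lambda>c :: (real ^ 'n) \<times> real \<Rightarrow> int. \<Sum>b\<in>Basis. of_int (c b) *\<^sub>R b)"
  proof safe
    fix p q assume v: "(p :: real ^ 'n, q) \<in> integer_points"
    let ?v = "(p, q)"
    have "of_int \<lfloor>?v \<bullet> b\<rfloor> = ?v \<bullet> b" if "b \<in> Basis" for b
      using v that by (simp only: integer_points_iff_Basis) (metis Ints_cases floor_of_int)
    then have "(\<Sum>b\<in>Basis. of_int \<lfloor>?v \<bullet> b\<rfloor> *\<^sub>R b) = (\<Sum>b\<in>Basis. (?v \<bullet> b) *\<^sub>R b)"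
      by (intro sum.cong) auto
    then have "?v = (\<Sum>b\<in>Basis. of_int \<lfloor>?v \<bullet> b\<rfloor> *\<^sub>R b)"
      by (simp only: euclidean_representation)
    then show "?v \<in> range (\<lambda>c :: (real ^ 'n) \<times> real \<Rightarrow> int. \<Sum>b\<in>Basis. of_int (c b) *\<^sub>R b)"
      by (rule range_eqI[of _ _ "\<lambda>b. \<lfloor>?v \<bullet> b\<rfloor>"])
  qed (simp only: integer_points_iff_Basis, simp)
  then show ?thesis
    by (simp add: lattice_basis_def independent_Basis)
qed

lemma integer_points_0: "0 \<in> integer_points"
  by (simp add: integer_points_iff_Basis)

lemma integer_points_diff: "x \<in> integer_points \<Longrightarrow> y \<in> integer_points \<Longrightarrow> x - y \<in> integer_points"
  by (simp add: integer_points_iff_Basis inner_diff_left)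

lemma integer_points_norm_ge_1:
  assumes "v \<in> integer_points" "v \<noteq> 0"
  shows "1 \<le> norm v"
proof -
  obtain b where b: "b \<in> Basis" "v \<bullet> b \<noteq> 0"
    using assms(2) euclidean_all_zero_iff by blast
  then have "1 \<le> \<bar>v \<bullet> b\<bar>"
    using assms(1) by (auto simp: integer_points_iff_Basis intro: Ints_nonzero_abs_ge1)
  also have "\<dots> \<le> norm v" by (rule Basis_le_norm[OF b(1)])
  finally show ?thesis .
qed

lemma integer_points_discrete: "finite {v \<in> integer_points. norm v \<le> R}"
proof (rule finite_subset)
  let ?S = "{a \<in> \<int>. - R \<le> a \<and> a \<le> R}"
  let ?F = "\<lambda>f. \<Sum>b\<in>Basis. f b *\<^sub>R b"
  show "{v \<in> integer_points. norm v \<le> R} \<subseteq> ?F ` (Pi\<^sub>E Basis (\<lambda>_. ?S))"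
  proof
    fix v assume "v \<in> {v \<in> integer_points. norm v \<le> R}"
    then have v: "\<And>b. b \<in> Basis \<Longrightarrow> v \<bullet> b \<in> \<int>" "norm v \<le> R"
      by (auto simp: integer_points_iff_Basis)
    have "v \<bullet> b \<in> ?S" if "b \<in> Basis" for b
      using v Basis_le_norm[OF that, of v] that by auto
    then show "v \<in> ?F ` (Pi\<^sub>E Basis (\<lambda>_. ?S))"
      by (intro image_eqI[of _ _ "\<lambda>b\<in>Basis. v \<bullet> b"]) (auto simp: euclidean_representation)
  qed
  show "finite (?F ` (Pi\<^sub>E Basis (\<lambda>_. ?S)))"
    by (intro finite_imageI finite_PiE finite_int_segment) auto
qed

section \<open>Nearest points of an affine subspace\<close>

lemma homogenization_subspace: "subspace (homogenization L)"
  by (simp add: homogenization_eq_span)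

lemma homogenization_mem: "y \<in> L \<Longrightarrow> (y, 1) \<in> homogenization L"
  by (simp add: homogenization_eq_span span_base)

lemma homogenization_dim:
  "int (dim (homogenization L)) = aff_dim L + 1" for L :: "(real ^ 'n) set"
  using homogenization_unique_span[of "homogenization L" L] by (simp add: homogenization_eq_span)

text \<open>
  The last property is orthogonality of \<open>x - y\<close> to the directions of \<open>L\<close>, put in a form that makes
  sense for all of the homogenization: for \<open>v = (z, 1)\<close> with \<open>z \<in> L\<close> it says \<open>(z - y) \<bullet> (x - y) = 0\<close>.
\<close>

lemma nearest_point_exists:
  fixes L :: "(real ^ 'n) set"
  assumes L: "affine L" "L \<noteq> {}"
  obtains y where "y \<in> L" "\<And>z. z \<in> L \<Longrightarrow> norm (x - y) \<le> norm (x - z)"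
    "\<And>v. v \<in> homogenization L \<Longrightarrow> (fst v - snd v *\<^sub>R y) \<bullet> (x - y) = 0"
proof -
  let ?y = "closest_point L x"
  have cl: "closed L" using L by (simp add: affine_closed)
  have cv: "convex L" using L by (simp add: affine_imp_convex)
  have y: "?y \<in> L" using closest_point_in_set cl L by blast
  have min: "norm (x - ?y) \<le> norm (x - z)" if "z \<in> L" for z
    using closest_point_le[OF cl that, of x] by (simp add: dist_norm)
  have orth: "(z - ?y) \<bullet> (x - ?y) = 0" if z: "z \<in> L" for z
  proof -
    have "2 *\<^sub>R ?y + (-1) *\<^sub>R z \<in> L"
      by (rule mem_affine[OF L(1) y z]) simp
    from closest_point_dot[OF cv cl this, of x] closest_point_dot[OF cv cl z, of x]
    show ?thesis by (simp add: algebra_simps inner_commute)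
  qed
  have "homogenization L \<subseteq> {v. (fst v - snd v *\<^sub>R ?y) \<bullet> (x - ?y) = 0}"
    unfolding homogenization_eq_span
  proof (rule span_minimal)
    show "(\<lambda>y. (y, 1)) ` L \<subseteq> {v. (fst v - snd v *\<^sub>R ?y) \<bullet> (x - ?y) = 0}"
      using orth by auto
    show "subspace {v. (fst v - snd v *\<^sub>R ?y) \<bullet> (x - ?y) = 0}"
    proof -
      have "(fst v - snd v *\<^sub>R ?y) \<bullet> u = (u, - (?y \<bullet> u)) \<bullet> v" for u and v :: "(real ^ 'n) \<times> real"
        by (simp add: inner_diff_left inner_commute[of u] inner_prod_def)
      then have "{v. (fst v - snd v *\<^sub>R ?y) \<bullet> (x - ?y) = 0} = {v. (x - ?y, - (?y \<bullet> (x - ?y))) \<bullet> v = 0}"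
        by simp
      then show ?thesis by (simp add: subspace_hyperplane)
    qed
  qed
  then show ?thesis using y min by (intro that) auto
qed

lemma sup_dist_bounds:
  fixes L :: "(real ^ 'n) set"
  assumes y: "y \<in> L" and min: "\<And>z. z \<in> L \<Longrightarrow> norm (x - y) \<le> norm (x - z)"
  shows "sup_dist x L \<le> norm (x - y)" "norm (x - y) \<le> sqrt CARD('n) * sup_dist x L"
proof -
  have bdd: "bdd_below ((\<lambda>y. infnorm (x - y)) ` L)"
    by (rule bdd_belowI[of _ 0]) (auto simp: infnorm_pos_le)
  have "sup_dist x L \<le> infnorm (x - y)"
    unfolding sup_dist_def by (rule cINF_lower[OF bdd y])
  also have "\<dots> \<le> norm (x - y)" by (rule infnorm_le_norm)
  finally show "sup_dist x L \<le> norm (x - y)" .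
  have n: "sqrt CARD('n) > 0" by simp
  have "norm (x - y) / sqrt CARD('n) \<le> sup_dist x L"
    unfolding sup_dist_def
  proof (rule cINF_greatest)
    fix z assume "z \<in> L"
    have "norm (x - y) \<le> norm (x - z)" by (rule min[OF \<open>z \<in> L\<close>])
    also have "\<dots> \<le> sqrt CARD('n) * infnorm (x - z)"
      using norm_le_infnorm[of "x - z"] by simp
    finally show "norm (x - y) / sqrt CARD('n) \<le> infnorm (x - z)"
      using n by (simp add: divide_le_eq mult.commute)
  qed (use y in auto)
  then show "norm (x - y) \<le> sqrt CARD('n) * sup_dist x L"
    using n by (simp add: divide_le_eq mult.commute)
qed

section \<open>The diagonal flow\<close>

text \<open>
  The diagonal flow of the Dani correspondence, composed with the shear that sends \<open>(x, 1)\<close> to \<open>(0, 1)\<close>.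
\<close>

definition dani_flow :: "real ^ 'n \<Rightarrow> real \<Rightarrow> (real ^ 'n) \<times> real \<Rightarrow> (real ^ 'n) \<times> real" where
  "dani_flow x T v = (T *\<^sub>R (fst v - snd v *\<^sub>R x), snd v / T ^ CARD('n))"

lemma dani_flow_linear: "linear (dani_flow x T)"
  by (rule linearI) (simp_all add: dani_flow_def algebra_simps add_divide_distrib)

lemma dani_flow_inj:
  fixes x :: "real ^ 'n"
  assumes "T > 0" shows "inj (dani_flow x T)"
  unfolding linear_injective_0[OF dani_flow_linear]
  using assms by (auto simp: dani_flow_def zero_prod_def)

text \<open>
  Let \<open>y\<close> and \<open>y0\<close> be the points of \<open>L\<close> nearest to \<open>x\<close> and to the origin. The horizontal vectors of
  the homogenization are its vectors orthogonal to \<open>(y0, 1)\<close>; complete an orthonormal basis \<open>E\<close> of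
  them by the unit vector \<open>u0\<close> in the direction of \<open>(y0, 1)\<close>. The flow multiplies the members of \<open>E\<close>
  by \<open>T\<close>. Moreover \<open>(y0, 1)\<close> and \<open>(y, 1)\<close> differ by a horizontal vector, and the image of \<open>(y, 1)\<close> is
  orthogonal to the horizontal vectors because \<open>x - y\<close> is. So the image of the unit cube is a
  parallelepiped with a triangular basis, whose diagonal is \<open>T\<close> (\<open>d\<close> times) and
  \<open>|A (y, 1)| / |(y0, 1)|\<close>.
\<close>

lemma dani_flow_volume:
  fixes x :: "real ^ 'n" and L :: "(real ^ 'n) set"
  assumes L: "affine L" "aff_dim L = int d" and T: "T > 0"
  obtains U y y0 where "orthonormal U" "span U = homogenization L"
    "y \<in> L" "\<And>z. z \<in> L \<Longrightarrow> norm (x - y) \<le> norm (x - z)"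
    "y0 \<in> L" "\<And>z. z \<in> L \<Longrightarrow> norm y0 \<le> norm z"
    "measure (subspace_lborel (dani_flow x T ` homogenization L)) (fundamental_parallelepiped (dani_flow x T ` U))
     = T ^ d * (norm (dani_flow x T (y, 1)) / norm (y0, 1 :: real))"
proof -
  let ?V = "homogenization L" and ?A = "dani_flow x T"
  note lin = dani_flow_linear[of x T]
  have ne: "L \<noteq> {}" using L(2) by auto
  obtain y where y: "y \<in> L" "\<And>z. z \<in> L \<Longrightarrow> norm (x - y) \<le> norm (x - z)"
    and yo: "\<And>v. v \<in> ?V \<Longrightarrow> (fst v - snd v *\<^sub>R y) \<bullet> (x - y) = 0"
    using nearest_point_exists[OF L(1) ne, of x] by metis
  obtain y0 where y0: "y0 \<in> L" "\<And>z. z \<in> L \<Longrightarrow> norm (0 - y0) \<le> norm (0 - z)"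
    and y0o: "\<And>v. v \<in> ?V \<Longrightarrow> (fst v - snd v *\<^sub>R y0) \<bullet> (0 - y0) = 0"
    using nearest_point_exists[OF L(1) ne, of 0] by metis
  define w where "w = (y, 1 :: real)"
  define w0 where "w0 = (y0, 1 :: real)"
  have wV: "w \<in> ?V" "w0 \<in> ?V" using y(1) y0(1) by (simp_all add: w_def w0_def homogenization_mem)
  define V' where "V' = {v \<in> ?V. v \<bullet> w0 = 0}"
  have nw0: "norm w0 > 0" by (simp add: w0_def zero_prod_def)
  have V'iff: "v \<in> V' \<longleftrightarrow> v \<in> ?V \<and> snd v = 0" for v
  proof -
    have "v \<bullet> w0 = snd v * (w0 \<bullet> w0)" if "v \<in> ?V"
      using y0o[OF that] by (simp add: w0_def inner_prod_def inner_diff_left algebra_simps)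
    moreover have "w0 \<bullet> w0 \<noteq> 0" using nw0 by simp
    ultimately show ?thesis unfolding V'_def by auto
  qed
  have "subspace V'"
    unfolding V'_def using homogenization_subspace[of L]
    by (auto simp: subspace_def inner_add_left)
  then obtain E where E: "orthonormal E" "span E = V'"
    by (rule orthonormal_basis_exists)
  have fE: "finite E" using E(1) by (rule orthonormal_finite)
  define u0 where "u0 = w0 /\<^sub>R norm w0"
  have u0V: "u0 \<in> ?V" unfolding u0_def by (intro subspace_mul homogenization_subspace wV)
  have u0: "norm u0 = 1" "u0 \<notin> E"
  proof -
    show "norm u0 = 1" using nw0 by (simp add: u0_def)
    then have "u0 \<bullet> w0 \<noteq> 0" using nw0 by (simp add: u0_def)
    then have "u0 \<notin> V'" by (simp add: V'_def)
    then show "u0 \<notin> E" using E(2) span_superset by blast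
  qed
  have EV: "v \<in> ?V" "v \<bullet> w0 = 0" "snd v = 0" if "v \<in> E" for v
  proof -
    have v: "v \<in> V'" using that E(2) span_superset by blast
    then show "v \<in> ?V" "v \<bullet> w0 = 0" by (auto simp: V'_def)
    show "snd v = 0" using v V'iff by blast
  qed
  define U where "U = insert u0 E"
  have spanU: "span U = ?V"
  proof
    show "span U \<subseteq> ?V"
      unfolding U_def using EV(1) u0V homogenization_subspace by (intro span_minimal) auto
    show "?V \<subseteq> span U"
    proof
      fix v assume v: "v \<in> ?V"
      define v' where "v' = v - (v \<bullet> u0) *\<^sub>R u0"
      have "v' \<in> ?V"
        unfolding v'_def using v u0V homogenization_subspace[of L] by (intro subspace_diff subspace_mul)
      moreover have "v' \<bullet> w0 = 0"
        using nw0 by (simp add: v'_def u0_def inner_diff_left dot_square_norm power2_eq_square field_simps)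
      ultimately have "v' \<in> span E" using E(2) by (simp add: V'_def)
      then have "v' \<in> span U" unfolding U_def using span_mono[of E "insert u0 E"] by auto
      moreover have "v = v' + (v \<bullet> u0) *\<^sub>R u0" by (simp add: v'_def)
      moreover have "u0 \<in> span U" unfolding U_def by (intro span_base) auto
      ultimately show "v \<in> span U" by (metis span_add span_mul)
    qed
  qed
  have ortU: "orthonormal U"
    using E(1) u0(1) EV(2)
    by (auto simp: orthonormal_basis_of_def U_def pairwise_insert orthogonal_def u0_def inner_commute)
  have cardE: "card E = d"
  proof -
    have "card U = dim ?V" using orthonormal_card_dim[OF ortU] spanU by simp
    then have "int (card E + 1) = int d + 1"
      using homogenization_dim[of L] u0(2) fE L(2) by (simp add: U_def)
    then show ?thesis by simp
  qed
  obtain h where h: "bij_betw h {..<d} E"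
    using ex_bij_betw_nat_finite[OF fE] cardE by (auto simp: atLeast0LessThan)
  have hE: "h i \<in> E" if "i < d" for i using h that by (auto simp: bij_betw_def)
  have hij: "h i \<bullet> h j = (if i = j then 1 else 0)" if "i < d" "j < d" for i j
    using orthonormal_inner[OF E(1) hE[OF that(1)] hE[OF that(2)]] bij_betw_imp_inj_on[OF h] that
    by (auto dest: inj_onD)
  define e where "e = (\<lambda>i. if i < d then h i else u0)"
  have eU: "e ` {..<Suc d} = U"
  proof -
    have "e ` {..<d} = E" using h by (auto simp: e_def bij_betw_def)
    moreover have "e d = u0" by (simp add: e_def)
    ultimately show ?thesis by (simp only: lessThan_Suc image_insert U_def)
  qed
  define b where "b = ?A \<circ> e"
  have Aw: "?A w \<noteq> 0" using T by (simp add: w_def dani_flow_def zero_prod_def)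
  define f where "f = (\<lambda>i. if i < d then h i else ?A w /\<^sub>R norm (?A w))"
  have AE: "?A v = T *\<^sub>R v" if "v \<in> E" for v
    using EV(3)[OF that] by (simp add: dani_flow_def prod_eq_iff)
  have Eorth: "v \<bullet> ?A w = 0" "?A w \<bullet> v = 0" if "v \<in> E" for v
  proof -
    have "fst v \<bullet> (x - y) = 0" using yo[OF EV(1)[OF that]] EV(3)[OF that] by simp
    then show "v \<bullet> ?A w = 0"
      using EV(3)[OF that] by (simp add: dani_flow_def w_def inner_prod_def inner_diff_right)
    then show "?A w \<bullet> v = 0" by (simp add: inner_commute)
  qed
  have diff: "w0 - w \<in> span E"
    using subspace_diff[OF homogenization_subspace wV(2,1)] unfolding E(2) V'iff
    by (simp add: w_def w0_def)
  then have spE: "w0 - w \<in> span (h ` {..<d})" using h by (simp add: bij_betw_def)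
  have dorth: "(w0 - w) \<bullet> ?A w = 0"
  proof -
    have "span E \<subseteq> {v. v \<bullet> ?A w = 0}"
      using Eorth by (intro span_minimal) (auto simp: subspace_def inner_add_left)
    then show ?thesis using diff by auto
  qed
  have "?A w0 = ?A w + T *\<^sub>R (w0 - w)"
    by (simp add: dani_flow_def w_def w0_def algebra_simps)
  then have bd: "b d = (1 / norm w0) *\<^sub>R (?A w + T *\<^sub>R (w0 - w))"
    by (simp add: b_def e_def u0_def linear_scale[OF lin] divide_inverse)
  have fd: "?A w = norm (?A w) *\<^sub>R f d" using Aw by (simp add: f_def)
  have bdfd: "b d \<bullet> f d = norm (?A w) / norm w0"
  proof -
    have "b d \<bullet> f d = (?A w \<bullet> ?A w + T * ((w0 - w) \<bullet> ?A w)) / (norm w0 * norm (?A w))"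
      unfolding bd by (simp add: f_def inner_add_left divide_inverse)
    then show ?thesis unfolding dorth using Aw by (simp add: dot_square_norm power2_eq_square)
  qed
  have bf: "b i \<bullet> f i = T" if "i < d" for i
    using that hij[of i i] AE[OF hE[OF that]] by (simp add: b_def e_def f_def)
  have tri: "triangular_basis (Suc d) b f"
    unfolding triangular_basis_def
  proof (intro conjI allI impI)
    fix i j assume ij: "i < Suc d" "j < Suc d"
    have "f d \<bullet> f d = 1"
      using Aw by (simp add: f_def dot_square_norm power2_eq_square)
    then show "f i \<bullet> f j = (if i = j then 1 else 0)"
      using ij hij[of i j] Eorth[OF hE[of i]] Eorth[OF hE[of j]]
      by (cases "i = d"; cases "j = d") (simp_all add: f_def less_Suc_eq)
  next
    fix i assume i: "i < Suc d"
    show "0 < b i \<bullet> f i"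
    proof (cases "i = d")
      case True
      then show ?thesis using Aw nw0 by (simp add: bdfd)
    next
      case False
      then show ?thesis using i T by (simp add: bf)
    qed
    show "b i \<in> span (f ` {..i})"
    proof (cases "i = d")
      case True
      have "h ` {..<d} \<subseteq> f ` {..d}" by (force simp: f_def)
      then have "w0 - w \<in> span (f ` {..d})" using spE span_mono by blast
      moreover have "?A w \<in> span (f ` {..d})"
        by (subst fd) (intro span_mul span_base, auto)
      ultimately show ?thesis unfolding True bd by (intro span_mul span_add)
    next
      case False
      then have "b i = T *\<^sub>R f i" using i AE[OF hE, of i] by (simp add: b_def e_def f_def)
      then show ?thesis by (auto intro!: span_mul intro: span_base)
    qed
  qed
  have bU: "b ` {..<Suc d} = ?A ` U" unfolding b_def image_comp[symmetric] eU ..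
  have "?A ` ?V = span (f ` {..<Suc d})"
    unfolding triangular_basis_span[OF tri, symmetric] bU spanU[symmetric]
    by (rule linear_span_image[OF lin, symmetric])
  then have "measure (subspace_lborel (?A ` ?V)) (fundamental_parallelepiped (?A ` U)) = (\<Prod>i<Suc d. b i \<bullet> f i)"
    using fundamental_parallelepiped_triangular[OF tri] bU by simp
  also have "\<dots> = T ^ d * (norm (?A w) / norm w0)"
    by (simp add: bf bdfd)
  finally show ?thesis
    using ortU spanU y y0 by (intro that[of U y y0]) (auto simp: w_def w0_def)
qed

lemma discrete_subgroup_linear_image:
  assumes A: "linear A" "inj A" and L: "discrete_subgroup \<Lambda>"
  shows "discrete_subgroup (A ` \<Lambda>)"
  unfolding discrete_subgroup_def
proof (intro conjI ballI allI)
  show "0 \<in> A ` \<Lambda>" using L linear_0[OF A(1)] by (force simp: discrete_subgroup_def)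
  fix x y assume "x \<in> A ` \<Lambda>" "y \<in> A ` \<Lambda>"
  then show "x - y \<in> A ` \<Lambda>"
    using L by (auto simp: discrete_subgroup_def linear_diff[OF A(1), symmetric])
next
  fix R
  obtain K where K: "K > 0" "\<And>x. K * norm x \<le> norm (A x)"
    using linear_inj_bounded_below_pos[OF A] by blast
  have "{v \<in> A ` \<Lambda>. norm v \<le> R} \<subseteq> A ` {v \<in> \<Lambda>. norm v \<le> R / K}"
  proof safe
    fix u assume "u \<in> \<Lambda>" "norm (A u) \<le> R"
    then have "K * norm u \<le> R" using K(2)[of u] by linarith
    then show "A u \<in> A ` {v \<in> \<Lambda>. norm v \<le> R / K}"
      using \<open>u \<in> \<Lambda>\<close> K(1) by (intro imageI) (simp add: field_simps)
  qed
  then show "finite {v \<in> A ` \<Lambda>. norm v \<le> R}"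
    by (rule finite_subset) (use L in \<open>simp add: discrete_subgroup_def\<close>)
qed

lemma discrete_subgroup_integer_section:
  assumes "subspace V"
  shows "discrete_subgroup (V \<inter> integer_points)"
proof -
  have "finite {v \<in> V \<inter> integer_points. norm v \<le> R}" for R
    by (rule finite_subset[OF _ integer_points_discrete[of R]]) auto
  then show ?thesis
    unfolding discrete_subgroup_def
    using assms integer_points_0 integer_points_diff by (auto simp: subspace_0 subspace_diff)
qed

lemma reduced_basis_pos: "reduced_basis \<Lambda> k b e \<Longrightarrow> i < k \<Longrightarrow> 0 < b i \<bullet> e i"
  by (simp add: reduced_basis_def triangular_basis_def)

lemma reduced_basis_growth:
  assumes "reduced_basis \<Lambda> k b e" "i \<le> j" "j < k"
  shows "b i \<bullet> e i \<le> 2 ^ k * (b j \<bullet> e j)"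
proof -
  have "b i \<bullet> e i \<le> 2 ^ (j - i) * (b j \<bullet> e j)"
    using assms(2,3)
  proof (induction j rule: dec_induct)
    case base
    then show ?case by simp
  next
    case (step j)
    then have "b i \<bullet> e i \<le> 2 ^ (j - i) * (b j \<bullet> e j)" by simp
    also have "\<dots> \<le> 2 ^ (j - i) * (2 * (b (Suc j) \<bullet> e (Suc j)))"
      using assms(1) step by (intro mult_left_mono) (auto simp: reduced_basis_def)
    finally show ?case using step by (simp add: Suc_diff_le mult.assoc)
  qed
  also have "\<dots> \<le> 2 ^ k * (b j \<bullet> e j)"
    using assms reduced_basis_pos[OF assms(1,3)] by (intro mult_right_mono power_increasing) auto
  finally show ?thesis .
qed

lemma reduced_basis_first_norm:
  assumes "reduced_basis \<Lambda> k b e" "0 < k"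
  shows "norm (b 0) = b 0 \<bullet> e 0"
proof -
  have t: "b 0 \<in> span {e 0}" "e 0 \<bullet> e 0 = 1" "0 < b 0 \<bullet> e 0"
    using assms by (auto simp: reduced_basis_def triangular_basis_def)
  then obtain q where q: "b 0 = q *\<^sub>R e 0" by (auto simp: span_singleton)
  moreover have "norm (e 0) = 1" using t(2) by (simp add: norm_eq_1)
  ultimately show ?thesis using t by simp
qed

text \<open>
  A nonzero lattice vector is at least as long as the Gram--Schmidt length at its last nonzero
  coefficient, which is an integer.
\<close>

lemma reduced_basis_first_short:
  assumes r: "reduced_basis \<Lambda> k b e" and v: "v \<in> \<Lambda>" "v \<noteq> 0"
  shows "b 0 \<bullet> e 0 \<le> 2 ^ k * norm v"
proof -
  have t: "triangular_basis k b e" using r by (simp add: reduced_basis_def)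
  obtain z :: "nat \<Rightarrow> int" where z: "v = (\<Sum>i<k. of_int (z i) *\<^sub>R b i)"
    using r v(1) by (auto simp: reduced_basis_def int_combinations_def)
  obtain i where i: "i < k" "z i \<noteq> 0"
  proof -
    have "(\<Sum>i<k. of_int (z i) *\<^sub>R b i) = 0" if "\<And>i. i < k \<Longrightarrow> z i = 0"
      using that by (intro sum.neutral) auto
    then show ?thesis using v(2) that unfolding z by blast
  qed
  obtain j where j: "j < k" "z j \<noteq> 0" "\<And>i. j < i \<Longrightarrow> i < k \<Longrightarrow> z i = 0"
    using largest_nonzero_coefficient[of i k z] i by metis
  have "v \<bullet> e j = of_int (z j) * (b j \<bullet> e j)"
    unfolding z using j by (intro triangular_basis_top_coefficient[OF t]) auto
  moreover have "1 \<le> \<bar>real_of_int (z j)\<bar>"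
    using j(2) by linarith
  ultimately have "b j \<bullet> e j \<le> \<bar>v \<bullet> e j\<bar>"
    using reduced_basis_pos[OF r j(1)] by (simp add: abs_mult)
  also have "\<dots> \<le> norm v * norm (e j)" by (rule Cauchy_Schwarz_ineq2)
  also have "norm (e j) = 1" using t j(1) by (simp add: triangular_basis_def norm_eq_1)
  finally have "b j \<bullet> e j \<le> norm v" by simp
  then have "2 ^ k * (b j \<bullet> e j) \<le> 2 ^ k * norm v" by (rule mult_left_mono) simp
  moreover have "b 0 \<bullet> e 0 \<le> 2 ^ k * (b j \<bullet> e j)"
    by (rule reduced_basis_growth[OF r _ j(1)]) simp
  ultimately show ?thesis by (rule order_trans[rotated])
qed

lemma reduced_basis_covolume:
  assumes "reduced_basis \<Lambda> k b e" "span \<Lambda> = V"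
  shows "covolume V \<Lambda> = (\<Prod>i<k. b i \<bullet> e i)"
  using covolume_triangular[of k b e] int_combinations_span[of k b e] assms
  by (simp add: reduced_basis_def)

lemma reduced_basis_lattice_basis:
  "reduced_basis \<Lambda> k b e \<Longrightarrow> lattice_basis \<Lambda> (b ` {..<k})"
  using int_combinations_lattice_basis by (auto simp: reduced_basis_def)

section \<open>Rational affine subspaces under the flow\<close>

abbreviation section_lattice :: "(real ^ 'n) set \<Rightarrow> ((real ^ 'n) \<times> real) set" where
  "section_lattice L \<equiv> homogenization L \<inter> integer_points"

lemma rational_affine_span:
  assumes "rational_affine d L"
  shows "span (section_lattice L) = homogenization L"
proof
  show "span (section_lattice L) \<subseteq> homogenization L"
    by (rule span_minimal) (auto simp: homogenization_subspace)
  obtain B where B: "B \<subseteq> integer_points" "span B = homogenization L"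
    using assms by (auto simp: rational_affine_def)
  then have "B \<subseteq> section_lattice L" using span_superset by blast
  then show "homogenization L \<subseteq> span (section_lattice L)"
    using B(2) span_mono by blast
qed

lemma rational_affine_dim:
  assumes "rational_affine d L"
  shows "dim (section_lattice L) = Suc d"
proof -
  have "dim (section_lattice L) = dim (homogenization L)"
    using rational_affine_span[OF assms] dim_span[of "section_lattice L"] by simp
  moreover have "int (dim (homogenization L)) = int d + 1"
    using assms by (simp add: homogenization_dim rational_affine_def)
  ultimately show ?thesis by simp
qed

lemma rational_affine_flow_reduced_basis:
  assumes L: "rational_affine d L" and T: "T > 0"
  obtains b e where "reduced_basis (dani_flow x T ` section_lattice L) (Suc d) b e"
    and "covolume (dani_flow x T ` homogenization L) (dani_flow x T ` section_lattice L) = (\<Prod>i<Suc d. b i \<bullet> e i)"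
proof -
  let ?A = "dani_flow x T"
  note A = dani_flow_linear[of x T] dani_flow_inj[OF T, of x]
  have "discrete_subgroup (?A ` section_lattice L)"
    by (intro discrete_subgroup_linear_image A discrete_subgroup_integer_section homogenization_subspace)
  moreover have "dim (?A ` section_lattice L) = Suc d"
    using dim_image_eq[OF A(1) inj_on_subset[OF A(2) subset_UNIV]] rational_affine_dim[OF L] by simp
  ultimately obtain b e where be: "reduced_basis (?A ` section_lattice L) (Suc d) b e"
    using reduced_basis_exists by blast
  moreover have "span (?A ` section_lattice L) = ?A ` homogenization L"
    using linear_span_image[OF A(1), of "section_lattice L"] rational_affine_span[OF L] by simp
  ultimately show ?thesis using reduced_basis_covolume[OF be] by (intro that) simp_all
qed

text \<open>
  A lower bound for all heights that is not sharp (heights are at least \<open>1\<close>) but follows at once from a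
  reduced basis, whose first vector is a nonzero integer vector.
\<close>

definition height_bound :: "nat \<Rightarrow> real" where
  "height_bound d = (1 / 2 ^ Suc d) ^ Suc d"

lemma height_bound_pos: "0 < height_bound d"
  by (simp add: height_bound_def)

lemma height_ge:
  assumes L: "rational_affine d L"
  shows "height_bound d \<le> height L"
proof -
  obtain b e where be: "reduced_basis (section_lattice L) (Suc d) b e"
    using reduced_basis_exists[OF discrete_subgroup_integer_section[OF homogenization_subspace] rational_affine_dim[OF L]]
    by blast
  have "b 0 \<in> section_lattice L"
    using be int_combinations_base[of 0 "Suc d" b] by (simp add: reduced_basis_def)
  moreover have "b 0 \<noteq> 0" using reduced_basis_pos[OF be, of 0] by auto
  ultimately have "1 \<le> b 0 \<bullet> e 0"
    using integer_points_norm_ge_1 reduced_basis_first_norm[OF be] by (metis IntD2 zero_less_Suc)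
  then have "1 / 2 ^ Suc d \<le> b i \<bullet> e i" if "i < Suc d" for i
    using reduced_basis_growth[OF be _ that, of 0] by (simp add: field_simps)
  then have "(\<Prod>i<Suc d. 1 / 2 ^ Suc d) \<le> (\<Prod>i<Suc d. b i \<bullet> e i)"
    by (intro prod_mono) auto
  then show ?thesis
    using reduced_basis_covolume[OF be rational_affine_span[OF L]]
    by (simp add: height_bound_def height_def)
qed

lemma height_pos: "rational_affine d L \<Longrightarrow> 0 < height L"
  using height_ge height_bound_pos less_le_trans by blast

lemma covolume_flow:
  fixes x :: "real ^ 'n"
  assumes L: "rational_affine d L" and T: "T > 0"
  obtains y y0 where
    "y \<in> L" "\<And>z. z \<in> L \<Longrightarrow> norm (x - y) \<le> norm (x - z)"
    "y0 \<in> L" "\<And>z. z \<in> L \<Longrightarrow> norm y0 \<le> norm z"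
    "covolume (dani_flow x T ` homogenization L) (dani_flow x T ` section_lattice L)
      = height L * (T ^ d * (norm (dani_flow x T (y, 1)) / norm (y0, 1 :: real)))"
proof -
  have "affine L" "aff_dim L = int d" using L by (auto simp: rational_affine_def)
  from dani_flow_volume[OF this T, of x]
  obtain U y y0 where U: "orthonormal U" "span U = homogenization L"
    and y: "y \<in> L" "\<And>z. z \<in> L \<Longrightarrow> norm (x - y) \<le> norm (x - z)"
    "y0 \<in> L" "\<And>z. z \<in> L \<Longrightarrow> norm y0 \<le> norm z"
    and vol: "measure (subspace_lborel (dani_flow x T ` homogenization L)) (fundamental_parallelepiped (dani_flow x T ` U))
     = T ^ d * (norm (dani_flow x T (y, 1)) / norm (y0, 1 :: real))" by blast
  obtain b e where be: "reduced_basis (section_lattice L) (Suc d) b e"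
    using reduced_basis_exists[OF discrete_subgroup_integer_section[OF homogenization_subspace] rational_affine_dim[OF L]]
    by blast
  have "covolume (dani_flow x T ` span U) (dani_flow x T ` section_lattice L) = covolume (span U) (section_lattice L) *
    measure (subspace_lborel (dani_flow x T ` span U)) (fundamental_parallelepiped (dani_flow x T ` U))"
    using rational_affine_span[OF L] U(2)
    by (intro covolume_linear_image[OF dani_flow_linear dani_flow_inj[OF T] U(1) reduced_basis_lattice_basis[OF be]]) simp
  then show ?thesis using y vol U(2) by (intro that[of y y0]) (simp_all add: height_def)
qed

lemma homogenization_UNIV: "homogenization (UNIV :: (real ^ 'n) set) = UNIV"
proof -
  have "int (dim (homogenization (UNIV :: (real ^ 'n) set))) = int (DIM((real ^ 'n) \<times> real))"
    by (simp add: homogenization_dim aff_dim_UNIV)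
  then show ?thesis
    using dim_eq_full[of "homogenization (UNIV :: (real ^ 'n) set)"] homogenization_subspace[of "UNIV :: (real ^ 'n) set"]
    by (simp add: span_eq_iff[THEN iffD2])
qed

lemma rational_affine_UNIV: "rational_affine CARD('n) (UNIV :: (real ^ 'n) set)"
  unfolding rational_affine_def homogenization_UNIV
  by (intro conjI exI[of _ Basis])
    (auto simp: aff_dim_UNIV integer_points_iff_Basis inner_Basis independent_Basis)

lemma height_UNIV: "height (UNIV :: (real ^ 'n) set) = 1"
proof -
  have "lattice_basis (integer_points :: ((real ^ 'n) \<times> real) set) Basis"
    by (rule integer_points_lattice_basis)
  from covolume_eq[OF this] lattice_basis_span[OF this]
  have "covolume UNIV (integer_points :: ((real ^ 'n) \<times> real) set) =
    measure (subspace_lborel (span Basis)) (fundamental_parallelepiped (Basis :: ((real ^ 'n) \<times> real) set))"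
    by simp
  also have "\<dots> = 1" by (rule fundamental_parallelepiped_orthonormal[OF orthonormal_Basis])
  finally have "covolume UNIV (integer_points :: ((real ^ 'n) \<times> real) set) = 1" .
  then show ?thesis by (simp add: height_def homogenization_UNIV)
qed

text \<open>
  The flow is unimodular: this is the covolume formula for \<open>L\<close> the whole space, where \<open>y = x\<close> and
  \<open>y0 = 0\<close>.
\<close>

lemma covolume_flow_integer_points:
  fixes x :: "real ^ 'n"
  assumes "T > 0"
  shows "covolume UNIV (dani_flow x T ` integer_points) = 1"
proof (rule covolume_flow[OF rational_affine_UNIV assms, of x])
  fix y y0 :: "real ^ 'n"
  assume y: "\<And>z. z \<in> UNIV \<Longrightarrow> norm (x - y) \<le> norm (x - z)"
    and y0: "\<And>z. z \<in> UNIV \<Longrightarrow> norm y0 \<le> norm z"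
    and c: "covolume (dani_flow x T ` homogenization UNIV) (dani_flow x T ` section_lattice UNIV)
      = height (UNIV :: (real ^ 'n) set) * (T ^ CARD('n) * (norm (dani_flow x T (y, 1)) / norm (y0, 1 :: real)))"
  have "y = x" "y0 = 0" using y[of x] y0[of 0] by auto
  then have "T ^ CARD('n) * (norm (dani_flow x T (y, 1)) / norm (y0, 1 :: real)) = 1"
    using assms by (simp add: dani_flow_def norm_Pair)
  moreover have "range (dani_flow x T) = UNIV"
    using dani_flow_inj[OF assms] dani_flow_linear linear_injective_imp_surjective by blast
  ultimately show ?thesis using c unfolding homogenization_UNIV height_UNIV by (simp only: Int_UNIV_left mult_1)
qed

section \<open>Approximation by subspaces and short vectors\<close>

text \<open>
  In terms of the parameter \<open>T\<close>, a simultaneous bound \<open>\<delta>\<close> for the two expressions that determine,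
  up to constants, the covolume of the image of the lattice of \<open>L\<close> under the flow.
\<close>

definition approximable :: "nat \<Rightarrow> real ^ 'n \<Rightarrow> real \<Rightarrow> real \<Rightarrow> bool" where
  "approximable d x T \<delta> \<longleftrightarrow> (\<exists>L. rational_affine d L \<and>
     sup_dist x L * height L * T ^ Suc d \<le> \<delta> \<and> height L \<le> \<delta> * T ^ (CARD('n) - d))"

definition short_vector :: "real ^ 'n \<Rightarrow> real \<Rightarrow> real \<Rightarrow> bool" where
  "short_vector x T \<delta> \<longleftrightarrow> (\<exists>v\<in>integer_points. v \<noteq> 0 \<and> norm (dani_flow x T v) \<le> \<delta>)"

lemma norm_dani_flow_bounds:
  fixes x :: "real ^ 'n"
  assumes "T > 0"
  shows "norm (dani_flow x T (y, 1)) \<le> T * norm (x - y) + 1 / T ^ CARD('n)"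
    and "T * norm (x - y) \<le> norm (dani_flow x T (y, 1))"
    and "1 / T ^ CARD('n) \<le> norm (dani_flow x T (y, 1))"
proof -
  have e: "dani_flow x T (y, 1) = (T *\<^sub>R (y - x), 1 / T ^ CARD('n))"
    by (simp add: dani_flow_def)
  have n: "norm (T *\<^sub>R (y - x)) = T * norm (x - y)" "norm (1 / T ^ CARD('n)) = 1 / T ^ CARD('n)"
    using assms by (simp_all add: norm_minus_commute)
  show "norm (dani_flow x T (y, 1)) \<le> T * norm (x - y) + 1 / T ^ CARD('n)"
    using norm_Pair_le[of "T *\<^sub>R (y - x)" "1 / T ^ CARD('n)"] unfolding e n .
  show "T * norm (x - y) \<le> norm (dani_flow x T (y, 1))"
    using norm_fst_le[of "T *\<^sub>R (y - x)" "1 / T ^ CARD('n)"] unfolding e n .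
  show "1 / T ^ CARD('n) \<le> norm (dani_flow x T (y, 1))"
    using norm_snd_le[of "1 / T ^ CARD('n)" "T *\<^sub>R (y - x)"] unfolding e n .
qed

text \<open>
  The image under the flow of the lattice of \<open>L\<close> has covolume at most a constant times \<open>\<delta>\<close>. This is
  the product of \<open>d + 1\<close> Gram--Schmidt lengths of a reduced basis, none of which is much smaller than
  the first.
\<close>

lemma approximable_imp_short_vector:
  fixes x :: "real ^ 'n"
  assumes d: "d < CARD('n)" and pos: "\<delta>' > 0"
  shows "\<exists>\<delta>>0. \<forall>T\<ge>1. approximable d x T \<delta> \<longrightarrow> short_vector x T \<delta>'"
proof -
  let ?n = "CARD('n)" let ?k = "Suc d"
  \<comment> \<open>A power of \<open>2\<close> for the growth of the lengths, and \<open>sqrt n\<close> for passing from the Euclidean to the maximum norm.\<close>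
  define C where "C = (2 ^ ?k) ^ ?k * (sqrt ?n + 1)"
  have C: "C > 0" unfolding C_def by (intro mult_pos_pos add_nonneg_pos) auto
  define \<delta> where "\<delta> = \<delta>' ^ ?k / C"
  have "short_vector x T \<delta>'" if T: "T \<ge> 1" and app: "approximable d x T \<delta>" for T
  proof -
    obtain L where L: "rational_affine d L" and s: "sup_dist x L * height L * T ^ ?k \<le> \<delta>"
      and H: "height L \<le> \<delta> * T ^ (?n - d)"
      using app by (auto simp: approximable_def)
    have T0: "T > 0" using T by simp
    let ?A = "dani_flow x T"
    obtain b e where be: "reduced_basis (?A ` section_lattice L) ?k b e"
      and cov: "covolume (?A ` homogenization L) (?A ` section_lattice L) = (\<Prod>i<?k. b i \<bullet> e i)"
      using rational_affine_flow_reduced_basis[OF L T0] by blast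
    obtain y y0 where y: "y \<in> L" "\<And>z. z \<in> L \<Longrightarrow> norm (x - y) \<le> norm (x - z)"
      and "y0 \<in> L" "\<And>z. z \<in> L \<Longrightarrow> norm y0 \<le> norm z"
      and cov': "covolume (?A ` homogenization L) (?A ` section_lattice L)
        = height L * (T ^ d * (norm (?A (y, 1)) / norm (y0, 1 :: real)))"
      using covolume_flow[OF L T0] by blast
    have h: "height L > 0" by (rule height_pos[OF L])
    have "1 \<le> norm (y0, 1 :: real)" using norm_snd_le[of "1::real" y0] by simp
    then have "norm (?A (y, 1)) / norm (y0, 1 :: real) \<le> norm (?A (y, 1)) / 1"
      by (intro divide_left_mono) auto
    then have "norm (?A (y, 1)) / norm (y0, 1 :: real) \<le> norm (?A (y, 1))" by simp
    also have "\<dots> \<le> T * norm (x - y) + 1 / T ^ ?n"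
      by (rule norm_dani_flow_bounds[OF T0])
    also have "\<dots> \<le> T * (sqrt ?n * sup_dist x L) + 1 / T ^ ?n"
      using sup_dist_bounds(2)[OF y] T0 by simp
    finally have "(\<Prod>i<?k. b i \<bullet> e i) \<le> height L * (T ^ d * (T * (sqrt ?n * sup_dist x L) + 1 / T ^ ?n))"
      unfolding cov[symmetric] cov' using h T0 by (intro mult_left_mono) auto
    also have "\<dots> = sqrt ?n * (sup_dist x L * height L * T ^ ?k) + height L * (T ^ d / T ^ ?n)"
      by (simp add: algebra_simps)
    also have "T ^ d / T ^ ?n = 1 / T ^ (?n - d)"
      using d T0 by (simp add: power_diff field_simps)
    also have "height L * (1 / T ^ (?n - d)) \<le> \<delta>"
      using H T0 by (simp add: divide_le_eq)
    also have "sqrt ?n * (sup_dist x L * height L * T ^ ?k) \<le> sqrt ?n * \<delta>"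
      using s by (intro mult_left_mono) auto
    finally have P: "(\<Prod>i<?k. b i \<bullet> e i) \<le> (sqrt ?n + 1) * \<delta>" by (simp add: algebra_simps)
    have p0: "0 < b 0 \<bullet> e 0" by (rule reduced_basis_pos[OF be]) simp
    have "(b 0 \<bullet> e 0) ^ ?k = (\<Prod>i<?k. b 0 \<bullet> e 0)" by simp
    also have "\<dots> \<le> (\<Prod>i<?k. 2 ^ ?k * (b i \<bullet> e i))"
      using reduced_basis_growth[OF be, of 0] p0 by (intro prod_mono) (auto intro: less_imp_le)
    also have "\<dots> = (2 ^ ?k) ^ ?k * (\<Prod>i<?k. b i \<bullet> e i)"
      by (simp only: prod.distrib prod_constant card_lessThan)
    also have "\<dots> \<le> (2 ^ ?k) ^ ?k * ((sqrt ?n + 1) * \<delta>)"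
      using P by (intro mult_left_mono) auto
    also have "\<dots> = C * \<delta>" by (simp only: C_def mult.assoc)
    also have "\<dots> = \<delta>' ^ ?k" using C by (simp add: \<delta>_def)
    finally have "b 0 \<bullet> e 0 \<le> \<delta>'"
      using pos by (meson less_imp_le power_le_imp_le_base)
    then have short: "norm (b 0) \<le> \<delta>'" using reduced_basis_first_norm[OF be] by simp
    have "b 0 \<in> ?A ` section_lattice L"
      using be int_combinations_base[of 0 ?k b] by (simp add: reduced_basis_def)
    then obtain v where v: "v \<in> section_lattice L" "b 0 = ?A v" by auto
    have "b 0 \<noteq> 0" using p0 by auto
    then have "v \<noteq> 0" using v(2) linear_0[OF dani_flow_linear[of x T]] by auto
    then show ?thesis using v short by (auto simp: short_vector_def)
  qed
  moreover have "\<delta> > 0" using C pos by (simp add: \<delta>_def)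
  ultimately show ?thesis by blast
qed

text \<open>
  Suppose that the product over \<open>i \<le> d\<close> exceeds \<open>\<eta>\<close>. Then the complementary product is less than
  \<open>1 / \<eta>\<close>; all its factors are at least \<open>r (d + 1) / K\<close>, and there is at least one, so
  \<open>r (d + 1) \<le> K / \<eta>\<close>. Hence every earlier \<open>r i\<close> is at most \<open>K\<^sup>2 / \<eta>\<close>, and the smallness of \<open>r 0\<close>
  contradicts the supposition.
\<close>

lemma prefix_product_small:
  fixes r :: "nat \<Rightarrow> real"
  assumes pos: "\<And>i. i < m \<Longrightarrow> 0 < r i"
    and growth: "\<And>i j. i \<le> j \<Longrightarrow> j < m \<Longrightarrow> r i \<le> K * r j" and K: "K > 0"
    and one: "(\<Prod>i<m. r i) = 1" and d: "Suc d < m" and \<eta>: "0 < \<eta>" "\<eta> \<le> 1"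
    and small: "r 0 * (K\<^sup>2 / \<eta>) ^ d \<le> \<eta>"
  shows "(\<Prod>i<Suc d. r i) \<le> \<eta>"
proof (rule ccontr)
  let ?k = "Suc d"
  assume "\<not> ?thesis"
  then have P: "\<eta> < (\<Prod>i<?k. r i)" by simp
  have split: "(\<Prod>i<?k. r i) * (\<Prod>i=?k..<m. r i) = 1"
    using prod.atLeastLessThan_concat[of 0 ?k m r] d one by (simp only: atLeast0LessThan)
  have Qpos: "0 < (\<Prod>i=?k..<m. r i)" using pos by (intro prod_pos) auto
  have "\<eta> * (\<Prod>i=?k..<m. r i) < 1"
    using P Qpos split by (metis mult_strict_right_mono)
  then have Q: "(\<Prod>i=?k..<m. r i) < 1 / \<eta>" using \<eta>(1) by (simp add: field_simps)
  have rk: "r ?k / K < 1 / \<eta>"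
  proof (rule ccontr)
    assume "\<not> ?thesis"
    then have big: "1 / \<eta> \<le> r ?k / K" by simp
    have "(1 / \<eta>) \<le> (1 / \<eta>) ^ (m - ?k)"
      using \<eta> d by (intro self_le_power) auto
    also have "\<dots> \<le> (r ?k / K) ^ (m - ?k)" using big \<eta> by (intro power_mono) auto
    also have "\<dots> = (\<Prod>i=?k..<m. r ?k / K)" by simp
    also have "\<dots> \<le> (\<Prod>i=?k..<m. r i)"
      using growth[of ?k] K pos[of ?k] d by (intro prod_mono) (auto simp: field_simps)
    finally show False using Q by simp
  qed
  have "(\<Prod>i<d. r (Suc i)) \<le> (\<Prod>i<d. K\<^sup>2 / \<eta>)"
  proof (rule prod_mono, intro conjI)
    fix i assume "i \<in> {..<d}"
    then have i: "Suc i \<le> ?k" "Suc i < m" using d by auto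
    show "0 \<le> r (Suc i)" using pos[OF i(2)] by simp
    have "r (Suc i) \<le> K * r ?k" by (rule growth[OF i(1) d])
    also have "\<dots> \<le> K * (K / \<eta>)"
    proof (rule mult_left_mono)
      show "r ?k \<le> K / \<eta>" using rk K by (simp add: divide_less_eq)
    qed (use K in simp)
    finally show "r (Suc i) \<le> K\<^sup>2 / \<eta>" by (simp add: power2_eq_square)
  qed
  then have "r 0 * (\<Prod>i<d. r (Suc i)) \<le> r 0 * (K\<^sup>2 / \<eta>) ^ d"
    using pos[of 0] d by (intro mult_left_mono) auto
  also have "\<dots> \<le> \<eta>" by (rule small)
  finally show False using P by (simp add: prod.lessThan_Suc_shift del: prod.lessThan_Suc)
qed

text \<open>
  The homogenizations of nonempty affine subspaces are the subspaces not contained in the hyperplane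
  \<open>{v. snd v = 0}\<close>.
\<close>

lemma affine_slice:
  fixes V :: "((real ^ 'n) \<times> real) set"
  assumes V: "subspace V" and v: "v \<in> V" "snd v \<noteq> 0"
  shows "affine {y. (y, 1) \<in> V}" "homogenization {y. (y, 1) \<in> V} = V"
    "aff_dim {y. (y, 1) \<in> V} + 1 = int (dim V)"
proof -
  let ?L = "{y. (y, 1) \<in> V}"
  show "affine ?L"
    unfolding affine_def
  proof safe
    fix y z and s t :: real assume yz: "(y, 1) \<in> V" "(z, 1) \<in> V" and st: "s + t = 1"
    have "s *\<^sub>R (y, 1) + t *\<^sub>R (z, 1) \<in> V"
      using V yz by (intro subspace_add subspace_mul)
    then show "(s *\<^sub>R y + t *\<^sub>R z, 1) \<in> V" using st by simp
  qed
  have hit: "(fst u /\<^sub>R snd u, 1) \<in> V" if "u \<in> V" "snd u \<noteq> 0" for u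
  proof -
    have "(1 / snd u) *\<^sub>R u \<in> V" using V that(1) by (rule subspace_mul)
    then show ?thesis using that(2) by (cases u) (simp add: divide_inverse)
  qed
  show hom: "homogenization ?L = V"
    unfolding homogenization_eq_span
  proof
    show "span ((\<lambda>y. (y, 1)) ` ?L) \<subseteq> V" using V by (intro span_minimal) auto
    have nz: "u \<in> span ((\<lambda>y. (y, 1)) ` ?L)" if "u \<in> V" "snd u \<noteq> 0" for u
    proof -
      have "snd u *\<^sub>R (fst u /\<^sub>R snd u, 1 :: real) \<in> span ((\<lambda>y. (y, 1)) ` ?L)"
        using hit[OF that] by (intro span_mul span_base) auto
      then show ?thesis using that(2) by (cases u) (simp add: real_scaleR_def)
    qed
    show "V \<subseteq> span ((\<lambda>y. (y, 1)) ` ?L)"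
    proof
      fix u assume u: "u \<in> V"
      show "u \<in> span ((\<lambda>y. (y, 1)) ` ?L)"
      proof (cases "snd u = 0")
        case True
        have "u + v \<in> span ((\<lambda>y. (y, 1)) ` ?L)" "v \<in> span ((\<lambda>y. (y, 1)) ` ?L)"
          using True u v V by (auto intro!: nz subspace_add)
        then have "(u + v) - v \<in> span ((\<lambda>y. (y, 1)) ` ?L)" by (rule span_diff)
        then show ?thesis by simp
      qed (use nz u in auto)
    qed
  qed
  show "aff_dim ?L + 1 = int (dim V)"
    using homogenization_dim[of ?L] hom by simp
qed

text \<open>
  A reduced basis of the image of all integer points has a short first vector, hence by
  \<open>prefix_product_small\<close> its first \<open>d + 1\<close> members span a lattice of small covolume. Pulled back by the
  flow they span a subspace \<open>V\<close>, whose integer points are exactly their integer combinations since they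
  are part of a basis. It is not horizontal, because horizontal integer vectors are stretched by
  \<open>T \<ge> 1\<close> and thus remain of length at least \<open>1\<close>. So \<open>V\<close> comes from an affine subspace \<open>L\<close>, and the
  covolume formula yields both bounds. Its denominator \<open>|(y0, 1)|\<close> is harmless if \<open>L\<close> is within
  distance \<open>1\<close> of \<open>x\<close>; for \<open>L\<close> farther away the covolume would be bounded below.
\<close>

lemma short_vector_imp_approximable:
  fixes x :: "real ^ 'n"
  assumes d: "d < CARD('n)" and pos: "\<delta>' > 0"
  shows "\<exists>\<delta>>0. \<forall>T\<ge>1. short_vector x T \<delta> \<longrightarrow> approximable d x T \<delta>'"
proof -
  let ?n = "CARD('n)" let ?k = "Suc d" let ?m = "Suc CARD('n)"
  \<comment> \<open>\<open>X\<close> bounds \<open>|(y0, 1)|\<close> for all \<open>L\<close> within distance \<open>1\<close> of \<open>x\<close>.\<close>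
  define X where "X = 2 + norm x"
  have X: "X \<ge> 2" by (simp add: X_def)
  \<comment> \<open>The target for the covolume: the term with \<open>\<delta>'\<close> gives the conclusion, the one with the least height forces \<open>L\<close> to be near \<open>x\<close>.\<close>
  define \<eta> where "\<eta> = min 1 (min \<delta>' (height_bound d / 2)) / X"
  have h0: "height_bound d > 0" by (rule height_bound_pos)
  have \<eta>: "0 < \<eta>" "\<eta> < 1" "\<eta> * X \<le> \<delta>'" "\<eta> * X < height_bound d"
    using X pos h0 by (auto simp: \<eta>_def min_def divide_less_eq)
  define K :: real where "K = 2 ^ ?m"
  have K: "K \<ge> 1" unfolding K_def by (rule one_le_power) simp
  \<comment> \<open>\<open>M\<close> is the factor of \<open>r 0\<close> in \<open>prefix_product_small\<close>, and \<open>\<delta>\<close> makes \<open>K \<delta> M = \<eta>\<close>.\<close>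
  define M where "M = (K\<^sup>2 / \<eta>) ^ d"
  have M: "M \<ge> 1"
  proof -
    have "1 \<le> K\<^sup>2" using K by simp
    then have "1 \<le> K\<^sup>2 / \<eta>" using \<eta> by (simp add: le_divide_eq)
    then show ?thesis unfolding M_def by (rule one_le_power)
  qed
  define \<delta> where "\<delta> = \<eta> / (K * M)"
  have \<delta>: "\<delta> > 0" using \<eta> K M by (simp add: \<delta>_def)
  have "approximable d x T \<delta>'" if T: "T \<ge> 1" and sv: "short_vector x T \<delta>" for T
  proof -
    have T0: "T > 0" using T by simp
    let ?A = "dani_flow x T"
    note A = dani_flow_linear[of x T] dani_flow_inj[OF T0, of x]
    let ?\<Lambda> = "?A ` integer_points"
    have surj: "range ?A = UNIV" by (rule linear_injective_imp_surjective[OF A]) (rule refl)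
    have U: "section_lattice (UNIV :: (real ^ 'n) set) = integer_points"
      by (simp add: homogenization_UNIV)
    obtain b e where be: "reduced_basis (?A ` section_lattice (UNIV :: (real ^ 'n) set)) ?m b e"
      and cov1: "covolume (?A ` homogenization UNIV) (?A ` section_lattice UNIV) = (\<Prod>i<?m. b i \<bullet> e i)"
      by (rule rational_affine_flow_reduced_basis[OF rational_affine_UNIV T0, of x])
    note be = be[unfolded U]
    have one: "(\<Prod>i<?m. b i \<bullet> e i) = 1"
      using cov1 covolume_flow_integer_points[OF T0, of x] unfolding U homogenization_UNIV surj by simp
    have tri: "triangular_basis ?m b e" and gen: "?\<Lambda> = int_combinations ?m b"
      using be by (auto simp: reduced_basis_def)
    have growth: "\<And>i j. i \<le> j \<Longrightarrow> j < ?m \<Longrightarrow> b i \<bullet> e i \<le> K * (b j \<bullet> e j)"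
      using reduced_basis_growth[OF be] by (simp add: K_def)
    obtain v where v: "v \<in> integer_points" "v \<noteq> 0" "norm (?A v) \<le> \<delta>"
      using sv by (auto simp: short_vector_def)
    have "?A v \<noteq> 0" using v(2) A(2) unfolding linear_injective_0[OF A(1)] by blast
    then have "b 0 \<bullet> e 0 \<le> K * norm (?A v)"
      using reduced_basis_first_short[OF be] v(1) by (simp add: K_def)
    also have "\<dots> \<le> K * \<delta>" using v(3) K by (intro mult_left_mono) auto
    also have "\<dots> = \<eta> / M" using K by (simp add: \<delta>_def)
    finally have r0: "b 0 \<bullet> e 0 \<le> \<eta> / M" .
    have r0M: "(b 0 \<bullet> e 0) * M \<le> \<eta>" using r0 M by (simp add: le_divide_eq)
    have P: "(\<Prod>i<?k. b i \<bullet> e i) \<le> \<eta>"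
      using reduced_basis_pos[OF be] growth K one d \<eta> r0M unfolding M_def
      by (intro prefix_product_small[of ?m _ K]) auto
    have r01: "norm (b 0) < 1"
    proof -
      have "\<eta> / M \<le> \<eta>" using M \<eta> by (simp add: divide_le_eq)
      then show ?thesis using r0 \<eta> reduced_basis_first_norm[OF be] by simp
    qed
    have "\<exists>c. i < ?m \<longrightarrow> c \<in> integer_points \<and> ?A c = b i" for i
    proof (cases "i < ?m")
      case True
      then have "b i \<in> ?\<Lambda>" unfolding gen by (rule int_combinations_base)
      then obtain c where "b i = ?A c" "c \<in> integer_points" by (rule imageE)
      then show ?thesis by (intro exI[of _ c]) simp
    qed simp
    then obtain c where c: "\<And>i. i < ?m \<Longrightarrow> c i \<in> integer_points" "\<And>i. i < ?m \<Longrightarrow> ?A (c i) = b i"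
      by metis
    have km: "?k < ?m" using d by simp
    define V where "V = span (c ` {..<?k})"
    have sV: "subspace V" by (simp add: V_def)
    have tri_k: "triangular_basis ?k b e" using triangular_basis_take[OF tri] km by simp
    have Ac: "?A ` c ` {..<?k} = b ` {..<?k}"
      using c(2) km by (auto simp: image_image intro!: image_cong)
    have AV: "?A ` V = span (b ` {..<?k})"
      unfolding V_def Ac[symmetric] by (rule linear_span_image[OF A(1), symmetric])
    have dimV: "dim V = ?k"
    proof -
      have "dim V = dim (?A ` V)"
        by (rule dim_image_eq[OF A(1) inj_on_subset[OF A(2) subset_UNIV], symmetric])
      also have "\<dots> = card (b ` {..<?k})"
        unfolding AV by (rule dim_span_eq_card_independent[OF triangular_basis_independent[OF tri_k]])
      finally show ?thesis by (simp add: card_image[OF triangular_basis_inj[OF tri_k]])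
    qed
    have c0: "c 0 \<in> V" unfolding V_def by (intro span_base) auto
    have q0: "snd (c 0) \<noteq> 0"
    proof
      assume q: "snd (c 0) = 0"
      have "?A (c 0) = T *\<^sub>R c 0" using q by (simp add: dani_flow_def prod_eq_iff)
      then have "norm (b 0) = T * norm (c 0)" using c(2)[of 0] T0 by simp
      moreover have "b 0 \<noteq> 0" using reduced_basis_pos[OF be, of 0] by auto
      then have "c 0 \<noteq> 0" using c(2)[of 0] linear_0[OF A(1)] by auto
      then have "1 \<le> norm (c 0)" using c(1)[of 0] integer_points_norm_ge_1 by simp
      ultimately show False using r01 T mult_mono[of 1 T 1 "norm (c 0)"] by simp
    qed
    define L where "L = {y. (y, 1) \<in> V}"
    have hom: "homogenization L = V" and aff: "affine L" and dimL: "aff_dim L = int d"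
      using affine_slice[OF sV c0 q0] dimV by (auto simp: L_def)
    have rat: "rational_affine d L"
    proof -
      obtain B where B: "B \<subseteq> c ` {..<?k}" "independent B" "c ` {..<?k} \<subseteq> span B"
        using maximal_independent_subset by blast
      have "span B = V"
        unfolding V_def using B by (metis span_mono span_minimal subspace_span subset_antisym)
      moreover have "B \<subseteq> integer_points" using B(1) c(1) km by auto
      ultimately show ?thesis
        unfolding rational_affine_def hom using aff dimL B(2) by blast
    qed
    have sec: "?A ` section_lattice L = int_combinations ?k b"
      unfolding hom
    proof
      show "int_combinations ?k b \<subseteq> ?A ` (V \<inter> integer_points)"
      proof
        fix u assume "u \<in> int_combinations ?k b"
        then obtain z :: "nat \<Rightarrow> int" where z: "u = (\<Sum>i<?k. of_int (z i) *\<^sub>R b i)"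
          by (auto simp: int_combinations_def)
        let ?w = "\<Sum>i<?k. of_int (z i) *\<^sub>R c i"
        have "u = ?A ?w"
          unfolding z linear_sum[OF A(1)] linear_scale[OF A(1)] using c(2) km by (intro sum.cong) auto
        moreover have "?w \<in> V" unfolding V_def by (intro span_sum span_mul span_base) auto
        moreover have "?w \<in> integer_points"
          using c(1) km by (intro subgroup_int_combination integer_points_0 integer_points_diff) auto
        ultimately show "u \<in> ?A ` (V \<inter> integer_points)" by blast
      qed
      show "?A ` (V \<inter> integer_points) \<subseteq> int_combinations ?k b"
      proof (rule image_subsetI)
        fix u assume "u \<in> V \<inter> integer_points"
        then have u: "u \<in> V" "u \<in> integer_points" by auto
        then have "?A u \<in> int_combinations ?m b" using gen by blast
        then obtain z :: "nat \<Rightarrow> int" where z: "?A u = (\<Sum>i<?m. of_int (z i) *\<^sub>R b i)"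
          by (auto simp: int_combinations_def)
        have "z i = 0" if i: "?k \<le> i" "i < ?m" for i
        proof (rule ccontr)
          assume "z i \<noteq> 0"
          then obtain j where j: "j < ?m" "z j \<noteq> 0" "\<And>i. j < i \<Longrightarrow> i < ?m \<Longrightarrow> z i = 0"
            using largest_nonzero_coefficient[of i ?m z] i by metis
          have kj: "?k \<le> j" using j(3)[of i] \<open>z i \<noteq> 0\<close> i by (meson le_trans not_le)
          have "?A u \<bullet> e j = of_int (z j) * (b j \<bullet> e j)"
            unfolding z using j by (intro triangular_basis_top_coefficient[OF tri]) auto
          moreover have "b j \<bullet> e j > 0" by (rule reduced_basis_pos[OF be j(1)])
          moreover have "?A u \<bullet> e j = 0"
          proof -
            have "?A u \<in> span (b ` {..<?k})" using u(1) AV by blast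
            moreover have "span (b ` {..<?k}) \<subseteq> {x. x \<bullet> e j = 0}"
              using triangular_basis_inner[OF tri _ j(1)] kj
              by (intro span_minimal) (auto simp: subspace_def inner_add_left)
            ultimately show ?thesis by auto
          qed
          ultimately show False using j(2) by simp
        qed
        then have "(\<Sum>i<?m. of_int (z i) *\<^sub>R b i) = (\<Sum>i<?k. of_int (z i) *\<^sub>R b i)"
          using km by (intro sum.mono_neutral_right) auto
        then show "?A u \<in> int_combinations ?k b"
          unfolding int_combinations_def z by simp
      qed
    qed
    have cov: "covolume (?A ` homogenization L) (?A ` section_lattice L) = (\<Prod>i<?k. b i \<bullet> e i)"
      unfolding sec unfolding hom AV triangular_basis_span[OF tri_k] by (rule covolume_triangular[OF tri_k])
    obtain y y0 where y: "y \<in> L" "\<And>z. z \<in> L \<Longrightarrow> norm (x - y) \<le> norm (x - z)"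
      and y0: "y0 \<in> L" "\<And>z. z \<in> L \<Longrightarrow> norm y0 \<le> norm z"
      and cov': "covolume (?A ` homogenization L) (?A ` section_lattice L)
        = height L * (T ^ d * (norm (?A (y, 1)) / norm (y0, 1 :: real)))"
      using covolume_flow[OF rat T0] by blast
    define H where "H = height L"
    have H: "H > 0" unfolding H_def by (rule height_pos[OF rat])
    define D where "D = norm (x - y)"
    define W where "W = norm (y0, 1 :: real)"
    have W: "W > 0" by (simp add: W_def zero_prod_def)
    have WX: "W \<le> X - 1 + D"
    proof -
      have "W \<le> norm y0 + norm (1::real)" unfolding W_def by (rule norm_Pair_le)
      also have "norm y0 \<le> norm y" by (rule y0(2)[OF y(1)])
      also have "norm y \<le> norm x + D" unfolding D_def using norm_triangle_sub[of y x] by (simp add: norm_minus_commute)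
      finally show ?thesis by (simp add: X_def)
    qed
    have PW: "H * (T ^ d * norm (?A (y, 1))) \<le> \<eta> * W"
    proof -
      have "H * (T ^ d * (norm (?A (y, 1)) / W)) \<le> \<eta>"
        using P cov cov' by (simp add: H_def W_def)
      then show ?thesis using W by (simp add: field_simps)
    qed
    have c1: "H * T ^ ?k * D \<le> \<eta> * W"
    proof -
      have "H * (T ^ d * (T * D)) \<le> H * (T ^ d * norm (?A (y, 1)))"
        using H T0 norm_dani_flow_bounds(2)[OF T0, of x y] by (intro mult_left_mono) (auto simp: D_def)
      then show ?thesis using PW by (simp add: mult_ac)
    qed
    have c2: "H / T ^ (?n - d) \<le> \<eta> * W"
    proof -
      have "H * (T ^ d * (1 / T ^ ?n)) \<le> H * (T ^ d * norm (?A (y, 1)))"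
        using H T0 norm_dani_flow_bounds(3)[OF T0, of x y] by (intro mult_left_mono) auto
      moreover have "T ^ d * (1 / T ^ ?n) = 1 / T ^ (?n - d)"
        using d T0 by (simp add: power_diff field_simps)
      ultimately have "H * (1 / T ^ (?n - d)) \<le> H * (T ^ d * norm (?A (y, 1)))" by (simp only:)
      then show ?thesis using PW by simp
    qed
    have D1: "D \<le> 1"
    proof (rule ccontr)
      assume "\<not> D \<le> 1"
      then have D: "1 < D" by simp
      have "X - 1 + D \<le> X * D"
      proof -
        have "0 \<le> (X - 1) * (D - 1)" using X D by simp
        then show ?thesis by (simp add: algebra_simps)
      qed
      then have "\<eta> * W \<le> \<eta> * (X * D)" using WX \<eta>(1) by (intro mult_left_mono) auto
      then have "(H * T ^ ?k) * D \<le> (\<eta> * X) * D" using c1 by (simp add: mult_ac)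
      then have "H * T ^ ?k \<le> \<eta> * X" using D by simp
      moreover have "H * 1 \<le> H * T ^ ?k" using H T one_le_power[OF T, of ?k] by (intro mult_left_mono) auto
      ultimately show False using height_ge[OF rat] \<eta>(4) by (simp add: H_def)
    qed
    have fin: "\<eta> * W \<le> \<delta>'"
    proof -
      have "\<eta> * W \<le> \<eta> * X" using WX D1 \<eta>(1) by (intro mult_left_mono) auto
      then show ?thesis using \<eta>(3) by simp
    qed
    have "sup_dist x L * (H * T ^ ?k) \<le> D * (H * T ^ ?k)"
      using sup_dist_bounds(1)[OF y] H T0 by (intro mult_right_mono) (auto simp: D_def)
    then have "sup_dist x L * H * T ^ ?k \<le> \<delta>'"
      using c1 fin by (simp add: mult_ac)
    moreover have "H \<le> \<delta>' * T ^ (?n - d)"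
      using c2 fin T0 by (simp add: divide_le_eq) (meson mult_right_mono order_trans zero_le_power less_imp_le)
    ultimately show ?thesis using rat unfolding approximable_def H_def by blast
  qed
  then show ?thesis using \<delta> by blast
qed

section \<open>Singular and badly approximable points\<close>

lemma power_powr_omega:
  assumes "d < n" "T > 0"
  shows "(T ^ (n - d)) powr omega n d = T ^ Suc d"
proof -
  have "real (n - d) * omega n d = real (Suc d)"
    using assms(1) by (simp add: omega_def of_nat_diff)
  then have "(T powr real (n - d)) powr omega n d = T powr real (Suc d)"
    by (simp only: powr_powr)
  then show ?thesis using assms(2) by (simp only: powr_realpow)
qed

text \<open>
  From left to right \<open>N\<close> is \<open>\<delta>\<close> times the power \<open>n - d\<close> of \<open>T\<close>, so that \<open>H(L) \<le> N\<close> becomes the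
  second bound; from right to left \<open>T\<close> is the root of \<open>N\<close> of that order.
\<close>

lemma Sing_iff_approximable:
  fixes x :: "real ^ 'n"
  assumes d: "d < CARD('n)"
  shows "x \<in> Sing d \<longleftrightarrow> (\<forall>\<delta>>0. \<exists>T\<^sub>0. \<forall>T\<ge>T\<^sub>0. T \<ge> 1 \<longrightarrow> approximable d x T \<delta>)"
    (is "_ \<longleftrightarrow> ?R")
proof
  let ?w = "omega CARD('n) d"
  assume x: "x \<in> Sing d"
  show ?R
  proof (intro allI impI)
    fix \<delta> :: real assume \<delta>: "\<delta> > 0"
    define \<epsilon> where "\<epsilon> = min (1 / 2) (\<delta> * \<delta> powr ?w)"
    have \<epsilon>: "\<epsilon> \<in> {0<..<1}" "\<epsilon> \<le> \<delta> * \<delta> powr ?w" using \<delta> by (auto simp: \<epsilon>_def)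
    obtain N0 where N0: "\<And>N. N > N0 \<Longrightarrow> \<exists>L. rational_affine d L \<and>
      sup_dist x L \<le> \<epsilon> * inverse (height L) * N powr (- ?w) \<and> height L \<le> N"
      using x \<epsilon>(1) unfolding Sing_def by blast
    have "approximable d x T \<delta>" if T: "T \<ge> N0 / \<delta> + 1" "T \<ge> 1" for T
    proof -
      define N where "N = \<delta> * T ^ (CARD('n) - d)"
      have "T \<le> T ^ (CARD('n) - d)" using T(2) d by (intro self_le_power) auto
      then have "N0 / \<delta> < T ^ (CARD('n) - d)" using T(1) by simp
      then have "N0 < N" using \<delta> by (simp add: N_def field_simps)
      then obtain L where L: "rational_affine d L"
        and s: "sup_dist x L \<le> \<epsilon> * inverse (height L) * N powr (- ?w)" and H: "height L \<le> N"
        using N0 by blast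
      have h: "height L > 0" by (rule height_pos[OF L])
      have Nw: "N powr ?w = \<delta> powr ?w * T ^ Suc d"
        unfolding N_def using \<delta> T(2) power_powr_omega[OF d, of T] by (subst powr_mult) auto
      have "N > 0" using \<delta> T(2) by (simp add: N_def)
      have "sup_dist x L * height L * T ^ Suc d \<le> (\<epsilon> * inverse (height L) * N powr (- ?w)) * height L * T ^ Suc d"
        using s h T(2) by (intro mult_right_mono) auto
      also have "\<dots> = \<epsilon> / \<delta> powr ?w"
        using h T(2) \<delta> by (simp add: powr_minus Nw field_simps del: power_Suc)
      also have "\<dots> \<le> \<delta>" using \<epsilon>(2) \<delta> by (simp add: divide_le_eq)
      finally show ?thesis using L H unfolding approximable_def N_def by blast
    qed
    then show "\<exists>T\<^sub>0. \<forall>T\<ge>T\<^sub>0. T \<ge> 1 \<longrightarrow> approximable d x T \<delta>" by blast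
  qed
next
  let ?w = "omega CARD('n) d" let ?j = "CARD('n) - d"
  assume R: ?R
  show "x \<in> Sing d"
    unfolding Sing_def
  proof (intro CollectI ballI)
    fix \<epsilon> :: real assume \<epsilon>: "\<epsilon> \<in> {0<..<1}"
    obtain T0 where T0: "\<And>T. T \<ge> T0 \<Longrightarrow> T \<ge> 1 \<Longrightarrow> approximable d x T \<epsilon>"
      using R \<epsilon> by (meson greaterThanLessThan_iff)
    have "\<exists>L. rational_affine d L \<and> sup_dist x L \<le> \<epsilon> * inverse (height L) * N powr (- ?w) \<and> height L \<le> N"
      if N: "N > (max 1 T0) ^ ?j" for N
    proof -
      have j: "?j > 0" using d by simp
      define T where "T = root ?j N"
      have "N > 0" using N by (meson less_trans max.strict_coboundedI1 zero_less_one zero_less_power)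
      then have TN: "T ^ ?j = N" using j by (simp add: T_def)
      have "root ?j ((max 1 T0) ^ ?j) \<le> T"
        unfolding T_def using N j by (intro real_root_le_mono) auto
      then have T: "max 1 T0 \<le> T" using j by (simp add: real_root_power_cancel)
      obtain L where L: "rational_affine d L" and s: "sup_dist x L * height L * T ^ Suc d \<le> \<epsilon>"
        and H: "height L \<le> \<epsilon> * T ^ ?j"
        using T0[of T] T unfolding approximable_def by auto
      have h: "height L > 0" by (rule height_pos[OF L])
      have Nw: "N powr ?w = T ^ Suc d"
        unfolding TN[symmetric] using T by (intro power_powr_omega[OF d]) auto
      have "sup_dist x L \<le> \<epsilon> / (height L * T ^ Suc d)"
        using s h T by (simp add: pos_le_divide_eq mult_ac del: power_Suc)
      also have "\<dots> = \<epsilon> * inverse (height L) * N powr (- ?w)"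
        by (simp add: powr_minus Nw divide_inverse del: power_Suc)
      finally have "sup_dist x L \<le> \<epsilon> * inverse (height L) * N powr (- ?w)" .
      moreover have "height L \<le> N"
      proof -
        have "\<epsilon> * N \<le> 1 * N" using \<epsilon> \<open>N > 0\<close> by (intro mult_right_mono) auto
        then show ?thesis using H unfolding TN by simp
      qed
      ultimately show ?thesis using L by blast
    qed
    then show "\<exists>N\<^sub>0. \<forall>N>N\<^sub>0. \<exists>L. rational_affine d L \<and>
      sup_dist x L \<le> \<epsilon> * inverse (height L) * N powr (- ?w) \<and> height L \<le> N" by blast
  qed
qed

text \<open>
  For a given \<open>L\<close> the two bounds compete as \<open>T\<close> varies. At the value of \<open>T\<close> for which the second one
  is an equality, the first one is the negation of the inequality in the definition of \<^const>\<open>Bad\<close>, with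
  \<open>\<epsilon>\<close> the power \<open>1 + \<omega>\<close> of \<open>\<delta>\<close>. That value of \<open>T\<close> is at least \<open>1\<close> once \<open>\<delta>\<close> is at most the lower
  bound for heights.
\<close>

lemma Bad_iff_approximable:
  fixes x :: "real ^ 'n"
  assumes d: "d < CARD('n)"
  shows "x \<in> Bad d \<longleftrightarrow> (\<exists>\<delta>>0. \<forall>T\<ge>1. \<not> approximable d x T \<delta>)"
    (is "_ \<longleftrightarrow> ?R")
proof
  let ?w = "omega CARD('n) d" let ?j = "CARD('n) - d"
  have w: "?w > 0" using d by (simp add: omega_def)
  assume "x \<in> Bad d"
  then obtain \<epsilon> where \<epsilon>: "\<epsilon> \<in> {0<..<1}"
    and bad: "\<And>L. rational_affine d L \<Longrightarrow> sup_dist x L > \<epsilon> * height L powr (- 1 - ?w)"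
    unfolding Bad_def by blast
  define \<delta> where "\<delta> = \<epsilon> powr (1 / (1 + ?w))"
  have \<delta>: "\<delta> > 0" using \<epsilon> by (simp add: \<delta>_def)
  have \<delta>\<epsilon>: "\<delta> * \<delta> powr ?w = \<epsilon>"
  proof -
    have "\<delta> * \<delta> powr ?w = \<delta> powr (1 + ?w)" using \<delta> by (simp add: powr_add)
    also have "\<dots> = \<epsilon>" using \<epsilon> w by (simp add: \<delta>_def powr_powr)
    finally show ?thesis .
  qed
  have "\<not> approximable d x T \<delta>" if T: "T \<ge> 1" for T
  proof
    assume "approximable d x T \<delta>"
    then obtain L where L: "rational_affine d L" and s: "sup_dist x L * height L * T ^ Suc d \<le> \<delta>"
      and H: "height L \<le> \<delta> * T ^ ?j"
      by (auto simp: approximable_def)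
    define h where "h = height L"
    have h: "h > 0" unfolding h_def by (rule height_pos[OF L])
    have "h powr ?w \<le> (\<delta> * T ^ ?j) powr ?w"
      using H h w unfolding h_def by (intro powr_mono2) auto
    also have "\<dots> = \<delta> powr ?w * T ^ Suc d"
      using \<delta> T power_powr_omega[OF d, of T] by (subst powr_mult) auto
    finally have hw: "h powr ?w \<le> \<delta> powr ?w * T ^ Suc d" .
    have "\<epsilon> / (h * h powr ?w) < sup_dist x L"
    proof -
      have "h powr (- 1 - ?w) = 1 / (h * h powr ?w)"
        using h by (simp add: powr_diff powr_minus field_simps)
      then show ?thesis using bad[OF L] by (simp add: h_def)
    qed
    then have "\<epsilon> < sup_dist x L * (h * h powr ?w)" using h by (simp add: divide_less_eq)
    also have "\<dots> \<le> sup_dist x L * (h * (\<delta> powr ?w * T ^ Suc d))"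
    proof -
      have "0 < sup_dist x L"
        using bad[OF L] \<epsilon> h by (smt (verit) greaterThanLessThan_iff h_def mult_pos_pos powr_gt_zero)
      then show ?thesis using hw h by (intro mult_left_mono) auto
    qed
    also have "\<dots> = (sup_dist x L * h * T ^ Suc d) * \<delta> powr ?w" by (simp only: mult_ac)
    also have "\<dots> \<le> \<delta> * \<delta> powr ?w" using s unfolding h_def by (intro mult_right_mono) auto
    finally show False using \<delta>\<epsilon> by simp
  qed
  then show ?R using \<delta> by blast
next
  let ?w = "omega CARD('n) d" let ?j = "CARD('n) - d"
  have w: "?w > 0" using d by (simp add: omega_def)
  have j: "?j > 0" using d by simp
  assume ?R
  then obtain \<delta>0 where \<delta>0: "\<delta>0 > 0" "\<And>T. T \<ge> 1 \<Longrightarrow> \<not> approximable d x T \<delta>0" by blast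
  define \<delta> where "\<delta> = min \<delta>0 (min (1 / 2) (height_bound d))"
  have \<delta>: "\<delta> > 0" "\<delta> < 1" "\<delta> \<le> \<delta>0" "\<delta> \<le> height_bound d"
    using \<delta>0(1) height_bound_pos[of d] by (auto simp: \<delta>_def)
  have not: "\<not> approximable d x T \<delta>" if "T \<ge> 1" for T
  proof
    assume "approximable d x T \<delta>"
    then obtain L where L: "rational_affine d L" "sup_dist x L * height L * T ^ Suc d \<le> \<delta>"
      "height L \<le> \<delta> * T ^ ?j" by (auto simp: approximable_def)
    have "\<delta> * T ^ ?j \<le> \<delta>0 * T ^ ?j" using \<delta>(3) that by (intro mult_right_mono) auto
    then have "approximable d x T \<delta>0" using L \<delta>(3) unfolding approximable_def by fastforce
    then show False using \<delta>0(2)[OF that] by blast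
  qed
  define \<epsilon> where "\<epsilon> = \<delta> * \<delta> powr ?w"
  have \<epsilon>: "\<epsilon> \<in> {0<..<1}"
  proof -
    have "\<delta> powr ?w < 1" using powr_less_mono2[OF w, of \<delta> 1] \<delta> by simp
    then show ?thesis using \<delta> mult_strict_mono[of \<delta> 1 "\<delta> powr ?w" 1] by (simp add: \<epsilon>_def)
  qed
  have "sup_dist x L > \<epsilon> * height L powr (- 1 - ?w)" if L: "rational_affine d L" for L
  proof (rule ccontr)
    define h where "h = height L"
    have h: "h > 0" unfolding h_def by (rule height_pos[OF L])
    assume "\<not> sup_dist x L > \<epsilon> * height L powr (- 1 - ?w)"
    then have s: "sup_dist x L \<le> \<epsilon> * h powr (- 1 - ?w)" by (simp add: h_def)
    define T where "T = root ?j (h / \<delta>)"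
    have TN: "T ^ ?j = h / \<delta>" using j h \<delta> by (simp add: T_def)
    have "1 \<le> h / \<delta>" using height_ge[OF L] \<delta> by (simp add: h_def)
    then have T: "1 \<le> T" using j by (simp add: T_def)
    have Tw: "T ^ Suc d = h powr ?w / \<delta> powr ?w"
      using power_powr_omega[OF d, of T] T h \<delta> unfolding TN by (simp add: powr_divide)
    have "sup_dist x L * (h * T ^ Suc d) \<le> (\<epsilon> * h powr (- 1 - ?w)) * (h * T ^ Suc d)"
      using s h T by (intro mult_right_mono) auto
    also have "h powr (- 1 - ?w) = 1 / (h * h powr ?w)"
      using h by (simp add: powr_diff powr_minus field_simps)
    also have "(\<epsilon> * (1 / (h * h powr ?w))) * (h * T ^ Suc d) = \<delta>"
      unfolding Tw \<epsilon>_def using h \<delta> by simp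
    finally have "sup_dist x L * height L * T ^ Suc d \<le> \<delta>"
      by (simp add: h_def mult_ac)
    moreover have "height L \<le> \<delta> * T ^ ?j" unfolding TN using \<delta> by (simp add: h_def)
    ultimately have "approximable d x T \<delta>" using L unfolding approximable_def by blast
    then show False using not[OF T] by blast
  qed
  then show "x \<in> Bad d" using \<epsilon> unfolding Bad_def by blast
qed

lemma eventually_small_transfer:
  fixes F G :: "real \<Rightarrow> real \<Rightarrow> bool"
  assumes FG: "\<And>\<delta>'. \<delta>' > 0 \<Longrightarrow> \<exists>\<delta>>0. \<forall>T\<ge>1. F T \<delta> \<longrightarrow> G T \<delta>'"
    and F: "\<forall>\<delta>>0. \<exists>T\<^sub>0. \<forall>T\<ge>T\<^sub>0. T \<ge> 1 \<longrightarrow> F T \<delta>"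
  shows "\<forall>\<delta>>0. \<exists>T\<^sub>0. \<forall>T\<ge>T\<^sub>0. T \<ge> 1 \<longrightarrow> G T \<delta>"
proof (intro allI impI)
  fix \<delta>' :: real assume "\<delta>' > 0"
  then obtain \<delta> where \<delta>: "\<delta> > 0" "\<And>T. T \<ge> 1 \<Longrightarrow> F T \<delta> \<Longrightarrow> G T \<delta>'" using FG by blast
  obtain T0 where "\<And>T. T \<ge> T0 \<Longrightarrow> T \<ge> 1 \<Longrightarrow> F T \<delta>" using F \<delta>(1) by blast
  then show "\<exists>T\<^sub>0. \<forall>T\<ge>T\<^sub>0. T \<ge> 1 \<longrightarrow> G T \<delta>'" using \<delta>(2) by blast
qed

lemma never_small_transfer:
  fixes F G :: "real \<Rightarrow> real \<Rightarrow> bool"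
  assumes FG: "\<And>\<delta>'. \<delta>' > 0 \<Longrightarrow> \<exists>\<delta>>0. \<forall>T\<ge>1. F T \<delta> \<longrightarrow> G T \<delta>'"
    and G: "\<exists>\<delta>>0. \<forall>T\<ge>1. \<not> G T \<delta>"
  shows "\<exists>\<delta>>0. \<forall>T\<ge>1. \<not> F T \<delta>"
proof -
  obtain \<delta>' where \<delta>': "\<delta>' > 0" "\<And>T. T \<ge> 1 \<Longrightarrow> \<not> G T \<delta>'" using G by blast
  then obtain \<delta> where "\<delta> > 0" "\<And>T. T \<ge> 1 \<Longrightarrow> F T \<delta> \<Longrightarrow> G T \<delta>'" using FG by blast
  then show ?thesis using \<delta>'(2) by blast
qed

lemma Sing_iff_short_vector:
  fixes x :: "real ^ 'n"
  assumes d: "d < CARD('n)"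
  shows "x \<in> Sing d \<longleftrightarrow> (\<forall>\<delta>>0. \<exists>T\<^sub>0. \<forall>T\<ge>T\<^sub>0. T \<ge> 1 \<longrightarrow> short_vector x T \<delta>)"
  unfolding Sing_iff_approximable[OF d]
  using eventually_small_transfer[OF approximable_imp_short_vector[OF d, where x = x]]
    eventually_small_transfer[OF short_vector_imp_approximable[OF d, where x = x]]
  by (rule iffI)

lemma Bad_iff_short_vector:
  fixes x :: "real ^ 'n"
  assumes d: "d < CARD('n)"
  shows "x \<in> Bad d \<longleftrightarrow> (\<exists>\<delta>>0. \<forall>T\<ge>1. \<not> short_vector x T \<delta>)"
  unfolding Bad_iff_approximable[OF d]
  using never_small_transfer[OF short_vector_imp_approximable[OF d, where x = x]]
    never_small_transfer[OF approximable_imp_short_vector[OF d, where x = x]]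
  by (rule iffI)

theorem proposition1p1:
  fixes d :: nat
  assumes "d \<le> CARD('n::finite) - 1"
  shows "(Sing 0 :: (real ^ 'n) set) = Sing d \<and> (Bad 0 :: (real ^ 'n) set) = Bad d"
proof -
  have d: "d < CARD('n)" and 0: "0 < CARD('n)"
    using assms zero_less_card_finite[where 'a = 'n] by linarith+
  have "(Sing 0 :: (real ^ 'n) set) = Sing d"
    by (rule set_eqI) (simp only: Sing_iff_short_vector[OF d] Sing_iff_short_vector[OF 0])
  moreover have "(Bad 0 :: (real ^ 'n) set) = Bad d"
    by (rule set_eqI) (simp only: Bad_iff_short_vector[OF d] Bad_iff_short_vector[OF 0])
  ultimately show ?thesis ..
qed

end
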